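(* Let $\kappa$ be a field, $G$ a group and $\sigma\in pm(G)$. Then there exist a commutative subalgebra $B^\sigma$ of $\kappa_{par}^\sigma G$ generated by idempotents $e_g^\sigma$ $(g\in G)$, and a unital partial action $\theta^\sigma=\{\theta^\sigma_g:D^\sigma_{g^{-1}}\to D^\sigma_g\}_{g\in G}$ of $G$ on $B^\sigma$ with $D^\sigma_g=e_g^\sigma B^\sigma$, for which $\sigma$ is a $\kappa$-valued twist, such that the map $$\Phi^\sigma:\kappa_{par}^\sigma G\to B^\sigma\ast_{(\theta^\sigma,\sigma)}G,\quad\text{determined by } [g]^\sigma\mapsto e_g^\sigma\delta_g\ (g\in G),$$ is an isomorphism of $\kappa$-algebras, whose inverse is given by $$\Psi^\sigma:B^\sigma\ast_{(\theta^\sigma,\sigma)}G\to\kappa_{par}^\sigma G,\quad b\,\delta_g\mapsto b\,[g]^\sigma .$$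
   Context: All algebras are associative and unital with $1\neq0$. A partial projective representation of $G$ in a unital $\kappa$-algebra $R$ is a map $\Gamma:G\to R$ for which there is $\sigma:G\times G\to\kappa$ such that for all $g,h\in G$: (1) $\sigma(g,h)=0$ implies $\Gamma(g^{-1})\Gamma(gh)=0$ and $\Gamma(gh)\Gamma(h^{-1})=0$; (2) $\Gamma(g^{-1})\Gamma(g)\Gamma(h)=\sigma(g,h)\Gamma(g^{-1})\Gamma(gh)$; (3) $\Gamma(g)\Gamma(h)\Gamma(h^{-1})=\sigma(g,h)\Gamma(gh)\Gamma(h^{-1})$; (4) $\Gamma(1_G)=1_R$. If moreover $\Gamma(g)\Gamma(h)=0$ implies $\sigma(g,h)=0$, then $\sigma$ is called a factor set of $\Gamma$. $pm(G)$ is the set of all factor sets of partial projective representations of $G$ in unital $\kappa$-algebras. For $\sigma\in pm(G)$, the twisted partial group algebra $\kappa_{par}^\sigma G$ is the universal unital $\kappa$-algebra generated by symbols $[g]^\sigma$ ($g\in G$) subject to: $[g^{-1}]^\sigma[gh]^\sigma=[gh]^\sigma[h^{-1}]^\sigma=0$ whenever $\sigma(g,h)=0$; $[g^{-1}]^\sigma[g]^\sigma[h]^\sigma=\sigma(g,h)[g^{-1}]^\sigma[gh]^\sigma$; $[g]^\sigma[h]^\sigma[h^{-1}]^\sigma=\sigma(g,h)[gh]^\sigma[h^{-1}]^\sigma$; $[g]^\sigma[1_G]^\sigma=[1_G]^\sigma[g]^\sigma=[g]^\sigma$, for all $g,h\in G$ (so $[1_G]^\sigma=1$). Unital partial action of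 $G$ on a $\kappa$-algebra $A$: a family of $\kappa$-algebra isomorphisms $\theta_g:D_{g^{-1}}\to D_g$ ($g\in G$), where $D_g$ is an ideal of $A$ generated by a central idempotent $1_g$ of $A$ ($D_g=0$ allowed), such that $D_1=A$, $\theta_1=\mathrm{id}_A$, $\theta_g(D_{g^{-1}}D_h)=D_gD_{gh}$, and $\theta_g\theta_h(a)=\theta_{gh}(a)$ for $a\in D_{h^{-1}}D_{(gh)^{-1}}$. A $\kappa$-valued twist of $\theta$ is a function $\sigma:G\times G\to\kappa$ with $\sigma(g,h)=0\iff 1_g1_{gh}=0$ such that $\varsigma_{g,h}:=\sigma(g,h)1_g1_{gh}$ satisfies $\varsigma_{1,g}=\varsigma_{g,1}=1_g$ and $\theta_g(1_{g^{-1}}\varsigma_{h,t})\varsigma_{g,ht}=\varsigma_{g,h}\varsigma_{gh,t}$ for all $g,h,t\in G$. The crossed product is $A\ast_{(\theta,\sigma)}G=\bigoplus_{g\in G}D_g\delta_g$ with multiplication $(a_g\delta_g)(b_h\delta_h)=\sigma(g,h)\,a_g\theta_g(1_{g^{-1}}b_h)\,\delta_{gh}$. *)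

theory Defs
  imports "HOL-Algebra.Module" "HOL-Algebra.QuotRing" "HOL-Algebra.Subrings"
    "HOL-Algebra.Ideal_Product"
begin

section \<open>Associative unital algebras\<close>

text \<open>The library locale \<^locale>\<open>algebra\<close> only covers commutative algebras.\<close>

locale kalgebra = module K A + A?: ring A for K (structure) and A (structure) +
  assumes smult_mult_left:
      "\<lbrakk> k \<in> carrier K; x \<in> carrier A; y \<in> carrier A \<rbrakk> \<Longrightarrow>
       (k \<odot>\<^bsub>A\<^esub> x) \<otimes>\<^bsub>A\<^esub> y = k \<odot>\<^bsub>A\<^esub> (x \<otimes>\<^bsub>A\<^esub> y)"
    and smult_mult_right:
      "\<lbrakk> k \<in> carrier K; x \<in> carrier A; y \<in> carrier A \<rbrakk> \<Longrightarrow>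
       x \<otimes>\<^bsub>A\<^esub> (k \<odot>\<^bsub>A\<^esub> y) = k \<odot>\<^bsub>A\<^esub> (x \<otimes>\<^bsub>A\<^esub> y)"
    and one_neq_zero: "\<one>\<^bsub>A\<^esub> \<noteq> \<zero>\<^bsub>A\<^esub>"

definition kalg_hom ::
    "('k, 'n) ring_scheme \<Rightarrow> ('k, 'a, 'p) module_scheme \<Rightarrow> ('k, 'b, 'q) module_scheme \<Rightarrow> ('a \<Rightarrow> 'b) set"
  where "kalg_hom K A B =
    {f \<in> ring_hom A B. \<forall>k\<in>carrier K. \<forall>x\<in>carrier A. f (k \<odot>\<^bsub>A\<^esub> x) = k \<odot>\<^bsub>B\<^esub> f x}"

definition kalg_iso ::
    "('k, 'n) ring_scheme \<Rightarrow> ('k, 'a, 'p) module_scheme \<Rightarrow> ('k, 'b, 'q) module_scheme \<Rightarrow> ('a \<Rightarrow> 'b) set"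
  where "kalg_iso K A B = {f \<in> kalg_hom K A B. bij_betw f (carrier A) (carrier B)}"

definition k_subalgebra ::
    "('k, 'n) ring_scheme \<Rightarrow> ('k, 'a, 'p) module_scheme \<Rightarrow> 'a set \<Rightarrow> bool"
  where "k_subalgebra K A B \<longleftrightarrow>
    subring B A \<and> (\<forall>k\<in>carrier K. \<forall>b\<in>B. k \<odot>\<^bsub>A\<^esub> b \<in> B)"

text \<open>Unital subalgebra generated by a set.\<close>

definition alg_generate ::
    "('k, 'n) ring_scheme \<Rightarrow> ('k, 'a, 'p) module_scheme \<Rightarrow> 'a set \<Rightarrow> 'a set"
  where "alg_generate K A S = \<Inter>{B. k_subalgebra K A B \<and> S \<subseteq> B}"

text \<open>
  Quotient by a two-sided ideal: the library quotient ring, with the scalar action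
  induced on cosets.
\<close>

definition alg_quot :: "('k, 'a) module \<Rightarrow> 'a set \<Rightarrow> ('k, 'a set) module"
  where "alg_quot A I = ring.extend (A Quot I)
    (module.fields (\<lambda>k X. \<Union>x\<in>X. I +>\<^bsub>A\<^esub> (k \<odot>\<^bsub>A\<^esub> x)))"

text \<open>
  Free unital associative algebra on a set \<open>X\<close>, as the monoid algebra of the words over \<open>X\<close>:
  an element is the family of its coefficients, and the product is the Cauchy product
  over all factorizations of a word.
\<close>

definition free_algebra ::
    "('k, 'n) ring_scheme \<Rightarrow> 'x set \<Rightarrow> ('k, 'x list \<Rightarrow> 'k) module"
  where "free_algebra K X =
    \<lparr>carrier = {f. (\<forall>w. f w \<in> carrier K) \<and> (\<forall>w. w \<notin> lists X \<longrightarrow> f w = \<zero>\<^bsub>K\<^esub>) \<and>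
                   finite {w. f w \<noteq> \<zero>\<^bsub>K\<^esub>}},
     mult = (\<lambda>f g w. \<Oplus>\<^bsub>K\<^esub>i\<in>{..length w}. f (take i w) \<otimes>\<^bsub>K\<^esub> g (drop i w)),
     one = (\<lambda>w. if w = [] then \<one>\<^bsub>K\<^esub> else \<zero>\<^bsub>K\<^esub>),
     zero = (\<lambda>w. \<zero>\<^bsub>K\<^esub>),
     add = (\<lambda>f g w. f w \<oplus>\<^bsub>K\<^esub> g w),
     smult = (\<lambda>k f w. k \<otimes>\<^bsub>K\<^esub> f w)\<rparr>"

definition free_gen :: "('k, 'n) ring_scheme \<Rightarrow> 'x \<Rightarrow> 'x list \<Rightarrow> 'k"
  where "free_gen K x = (\<lambda>w. if w = [x] then \<one>\<^bsub>K\<^esub> else \<zero>\<^bsub>K\<^esub>)"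


section \<open>Partial projective representations and factor sets\<close>

definition partial_proj_rep ::
    "('g, 'm) monoid_scheme \<Rightarrow> ('k, 'n) ring_scheme \<Rightarrow> ('k, 'r) module \<Rightarrow>
     ('g \<Rightarrow> 'r) \<Rightarrow> ('g \<Rightarrow> 'g \<Rightarrow> 'k) \<Rightarrow> bool"
  where "partial_proj_rep G K R \<Gamma> \<sigma> \<longleftrightarrow>
    \<Gamma> \<in> carrier G \<rightarrow> carrier R \<and>
    (\<forall>g\<in>carrier G. \<forall>h\<in>carrier G. \<sigma> g h \<in> carrier K) \<and>
    (\<forall>g\<in>carrier G. \<forall>h\<in>carrier G.
      (\<sigma> g h = \<zero>\<^bsub>K\<^esub> \<longrightarrow>
         \<Gamma> (inv\<^bsub>G\<^esub> g) \<otimes>\<^bsub>R\<^esub> \<Gamma> (g \<otimes>\<^bsub>G\<^esub> h) = \<zero>\<^bsub>R\<^esub> \<and>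
         \<Gamma> (g \<otimes>\<^bsub>G\<^esub> h) \<otimes>\<^bsub>R\<^esub> \<Gamma> (inv\<^bsub>G\<^esub> h) = \<zero>\<^bsub>R\<^esub>) \<and>
      \<Gamma> (inv\<^bsub>G\<^esub> g) \<otimes>\<^bsub>R\<^esub> \<Gamma> g \<otimes>\<^bsub>R\<^esub> \<Gamma> h =
         \<sigma> g h \<odot>\<^bsub>R\<^esub> (\<Gamma> (inv\<^bsub>G\<^esub> g) \<otimes>\<^bsub>R\<^esub> \<Gamma> (g \<otimes>\<^bsub>G\<^esub> h)) \<and>
      \<Gamma> g \<otimes>\<^bsub>R\<^esub> \<Gamma> h \<otimes>\<^bsub>R\<^esub> \<Gamma> (inv\<^bsub>G\<^esub> h) =
         \<sigma> g h \<odot>\<^bsub>R\<^esub> (\<Gamma> (g \<otimes>\<^bsub>G\<^esub> h) \<otimes>\<^bsub>R\<^esub> \<Gamma> (inv\<^bsub>G\<^esub> h))) \<and>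
    \<Gamma> \<one>\<^bsub>G\<^esub> = \<one>\<^bsub>R\<^esub>"

definition factor_set ::
    "('g, 'm) monoid_scheme \<Rightarrow> ('k, 'n) ring_scheme \<Rightarrow> ('k, 'r) module \<Rightarrow>
     ('g \<Rightarrow> 'r) \<Rightarrow> ('g \<Rightarrow> 'g \<Rightarrow> 'k) \<Rightarrow> bool"
  where "factor_set G K R \<Gamma> \<sigma> \<longleftrightarrow>
    partial_proj_rep G K R \<Gamma> \<sigma> \<and>
    (\<forall>g\<in>carrier G. \<forall>h\<in>carrier G. \<Gamma> g \<otimes>\<^bsub>R\<^esub> \<Gamma> h = \<zero>\<^bsub>R\<^esub> \<longrightarrow> \<sigma> g h = \<zero>\<^bsub>K\<^esub>)"

text \<open>
  HOL cannot quantify over types inside a formula, so the type of the elements of the algebra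
  \<open>R\<close> is a parameter.  A statement assuming \<open>\<sigma> \<in> pm TYPE('r) G K\<close> with a free type variable
  \<open>'r\<close> covers factor sets of representations in all algebras.
\<close>

definition pm ::
    "'r itself \<Rightarrow> ('g, 'm) monoid_scheme \<Rightarrow> ('k, 'n) ring_scheme \<Rightarrow> ('g \<Rightarrow> 'g \<Rightarrow> 'k) set"
  where "pm _ G K =
    {\<sigma>. \<exists>(R :: ('k, 'r) module) \<Gamma>. kalgebra K R \<and> factor_set G K R \<Gamma> \<sigma>}"


section \<open>The twisted partial group algebra\<close>

text \<open>
  The last relation \<open>[1] = 1\<close> is stated separately: in a free \<^emph>\<open>unital\<close> algebra the
  relations \<open>[g][1] = [1][g] = [g]\<close> alone do not make \<open>[1]\<close> the unit.
\<close>

definition par_relators ::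
    "('g, 'm) monoid_scheme \<Rightarrow> ('k, 'n) ring_scheme \<Rightarrow> ('g \<Rightarrow> 'g \<Rightarrow> 'k) \<Rightarrow> ('g list \<Rightarrow> 'k) set"
  where "par_relators G K \<sigma> =
    (let F = free_algebra K (carrier G); x = free_gen K in
      {x (inv\<^bsub>G\<^esub> g) \<otimes>\<^bsub>F\<^esub> x (g \<otimes>\<^bsub>G\<^esub> h) | g h.
         g \<in> carrier G \<and> h \<in> carrier G \<and> \<sigma> g h = \<zero>\<^bsub>K\<^esub>} \<union>
      {x (g \<otimes>\<^bsub>G\<^esub> h) \<otimes>\<^bsub>F\<^esub> x (inv\<^bsub>G\<^esub> h) | g h.
         g \<in> carrier G \<and> h \<in> carrier G \<and> \<sigma> g h = \<zero>\<^bsub>K\<^esub>} \<union>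
      {x (inv\<^bsub>G\<^esub> g) \<otimes>\<^bsub>F\<^esub> x g \<otimes>\<^bsub>F\<^esub> x h \<ominus>\<^bsub>F\<^esub>
         \<sigma> g h \<odot>\<^bsub>F\<^esub> (x (inv\<^bsub>G\<^esub> g) \<otimes>\<^bsub>F\<^esub> x (g \<otimes>\<^bsub>G\<^esub> h)) | g h.
         g \<in> carrier G \<and> h \<in> carrier G} \<union>
      {x g \<otimes>\<^bsub>F\<^esub> x h \<otimes>\<^bsub>F\<^esub> x (inv\<^bsub>G\<^esub> h) \<ominus>\<^bsub>F\<^esub>
         \<sigma> g h \<odot>\<^bsub>F\<^esub> (x (g \<otimes>\<^bsub>G\<^esub> h) \<otimes>\<^bsub>F\<^esub> x (inv\<^bsub>G\<^esub> h)) | g h.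
         g \<in> carrier G \<and> h \<in> carrier G} \<union>
      {x g \<otimes>\<^bsub>F\<^esub> x \<one>\<^bsub>G\<^esub> \<ominus>\<^bsub>F\<^esub> x g | g. g \<in> carrier G} \<union>
      {x \<one>\<^bsub>G\<^esub> \<otimes>\<^bsub>F\<^esub> x g \<ominus>\<^bsub>F\<^esub> x g | g. g \<in> carrier G} \<union>
      {x \<one>\<^bsub>G\<^esub> \<ominus>\<^bsub>F\<^esub> \<one>\<^bsub>F\<^esub>})"

definition par_ideal ::
    "('g, 'm) monoid_scheme \<Rightarrow> ('k, 'n) ring_scheme \<Rightarrow> ('g \<Rightarrow> 'g \<Rightarrow> 'k) \<Rightarrow> ('g list \<Rightarrow> 'k) set"
  where "par_ideal G K \<sigma> = Idl\<^bsub>free_algebra K (carrier G)\<^esub> (par_relators G K \<sigma>)"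

definition twisted_par_alg ::
    "('g, 'm) monoid_scheme \<Rightarrow> ('k, 'n) ring_scheme \<Rightarrow> ('g \<Rightarrow> 'g \<Rightarrow> 'k) \<Rightarrow>
     ('k, ('g list \<Rightarrow> 'k) set) module"
  where "twisted_par_alg G K \<sigma> = alg_quot (free_algebra K (carrier G)) (par_ideal G K \<sigma>)"

definition par_gen ::
    "('g, 'm) monoid_scheme \<Rightarrow> ('k, 'n) ring_scheme \<Rightarrow> ('g \<Rightarrow> 'g \<Rightarrow> 'k) \<Rightarrow> 'g \<Rightarrow>
     ('g list \<Rightarrow> 'k) set"
  where "par_gen G K \<sigma> g = par_ideal G K \<sigma> +>\<^bsub>free_algebra K (carrier G)\<^esub> free_gen K g"


section \<open>Unital partial actions, twists and crossed products\<close>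

text \<open>
  Below, \<open>D g\<close> is the domain ideal, \<open>u g\<close> the central idempotent generating it
  (written \<open>1_g\<close> on paper), and only the values of \<open>\<theta> g\<close> on \<open>D (inv g)\<close> matter.  Each \<open>D g\<close> is
  regarded as an algebra with unit \<open>u g\<close>.
\<close>

locale unital_partial_action = group G + kalgebra K A
  for G (structure) and K (structure) and A :: "('k, 'a) module" (structure) +
  fixes D :: "'g \<Rightarrow> 'a set" and u :: "'g \<Rightarrow> 'a" and \<theta> :: "'g \<Rightarrow> 'a \<Rightarrow> 'a"
  constrains G :: "('g, 'm) monoid_scheme"
  assumes u_closed: "g \<in> carrier G \<Longrightarrow> u g \<in> carrier A"
    and u_idem: "g \<in> carrier G \<Longrightarrow> u g \<otimes>\<^bsub>A\<^esub> u g = u g"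
    and u_central: "\<lbrakk> g \<in> carrier G; a \<in> carrier A \<rbrakk> \<Longrightarrow> u g \<otimes>\<^bsub>A\<^esub> a = a \<otimes>\<^bsub>A\<^esub> u g"
    and D_eq: "g \<in> carrier G \<Longrightarrow> D g = Idl\<^bsub>A\<^esub> {u g}"
    and D_one: "D \<one>\<^bsub>G\<^esub> = carrier A"
    and theta_iso: "g \<in> carrier G \<Longrightarrow>
      \<theta> g \<in> kalg_iso K (A\<lparr>carrier := D (inv\<^bsub>G\<^esub> g), one := u (inv\<^bsub>G\<^esub> g)\<rparr>)
                      (A\<lparr>carrier := D g, one := u g\<rparr>)"
    and theta_one: "a \<in> carrier A \<Longrightarrow> \<theta> \<one>\<^bsub>G\<^esub> a = a"
    and theta_image: "\<lbrakk> g \<in> carrier G; h \<in> carrier G \<rbrakk> \<Longrightarrow>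
      \<theta> g ` ideal_prod A (D (inv\<^bsub>G\<^esub> g)) (D h) = ideal_prod A (D g) (D (g \<otimes>\<^bsub>G\<^esub> h))"
    and theta_comp: "\<lbrakk> g \<in> carrier G; h \<in> carrier G;
        a \<in> ideal_prod A (D (inv\<^bsub>G\<^esub> h)) (D (inv\<^bsub>G\<^esub> (g \<otimes>\<^bsub>G\<^esub> h))) \<rbrakk> \<Longrightarrow>
      \<theta> g (\<theta> h a) = \<theta> (g \<otimes>\<^bsub>G\<^esub> h) a"

definition twist_elem ::
    "('g, 'm) monoid_scheme \<Rightarrow> ('k, 'a) module \<Rightarrow> ('g \<Rightarrow> 'a) \<Rightarrow> ('g \<Rightarrow> 'g \<Rightarrow> 'k) \<Rightarrow> 'g \<Rightarrow> 'g \<Rightarrow> 'a"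
  where "twist_elem G A u \<sigma> g h = \<sigma> g h \<odot>\<^bsub>A\<^esub> (u g \<otimes>\<^bsub>A\<^esub> u (g \<otimes>\<^bsub>G\<^esub> h))"

definition kvalued_twist ::
    "('g, 'm) monoid_scheme \<Rightarrow> ('k, 'n) ring_scheme \<Rightarrow> ('k, 'a) module \<Rightarrow>
     ('g \<Rightarrow> 'a) \<Rightarrow> ('g \<Rightarrow> 'a \<Rightarrow> 'a) \<Rightarrow> ('g \<Rightarrow> 'g \<Rightarrow> 'k) \<Rightarrow> bool"
  where "kvalued_twist G K A u \<theta> \<sigma> \<longleftrightarrow>
    (let \<tau> = twist_elem G A u \<sigma> in
      (\<forall>g\<in>carrier G. \<forall>h\<in>carrier G. \<sigma> g h \<in> carrier K) \<and>
      (\<forall>g\<in>carrier G. \<forall>h\<in>carrier G.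
         \<sigma> g h = \<zero>\<^bsub>K\<^esub> \<longleftrightarrow> u g \<otimes>\<^bsub>A\<^esub> u (g \<otimes>\<^bsub>G\<^esub> h) = \<zero>\<^bsub>A\<^esub>) \<and>
      (\<forall>g\<in>carrier G. \<tau> \<one>\<^bsub>G\<^esub> g = u g \<and> \<tau> g \<one>\<^bsub>G\<^esub> = u g) \<and>
      (\<forall>g\<in>carrier G. \<forall>h\<in>carrier G. \<forall>t\<in>carrier G.
         \<theta> g (u (inv\<^bsub>G\<^esub> g) \<otimes>\<^bsub>A\<^esub> \<tau> h t) \<otimes>\<^bsub>A\<^esub> \<tau> g (h \<otimes>\<^bsub>G\<^esub> t) =
         \<tau> g h \<otimes>\<^bsub>A\<^esub> \<tau> (g \<otimes>\<^bsub>G\<^esub> h) t))"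

text \<open>
  The direct sum of the \<open>D g\<close> consists of the finitely supported families; the family \<open>a\<close>
  stands for the sum of all \<open>a g \<delta>_g\<close>.  The product is the additive extension of
  \<open>(a \<delta>_g)(b \<delta>_h) = \<sigma>(g,h) a \<theta>_g(1_{g^{-1}} b) \<delta>_{gh}\<close>: the coefficient at \<open>s\<close> collects
  the pairs \<open>(g, h)\<close> with \<open>h = g^{-1} s\<close>.
\<close>

definition crossed_product ::
    "('g, 'm) monoid_scheme \<Rightarrow> ('k, 'a) module \<Rightarrow> ('g \<Rightarrow> 'a set) \<Rightarrow>
     ('g \<Rightarrow> 'a) \<Rightarrow> ('g \<Rightarrow> 'a \<Rightarrow> 'a) \<Rightarrow> ('g \<Rightarrow> 'g \<Rightarrow> 'k) \<Rightarrow> ('k, 'g \<Rightarrow> 'a) module"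
  where "crossed_product G A D u \<theta> \<sigma> =
    \<lparr>carrier = {a \<in> (\<Pi>\<^sub>E g\<in>carrier G. D g). finite {g \<in> carrier G. a g \<noteq> \<zero>\<^bsub>A\<^esub>}},
     mult = (\<lambda>a b. \<lambda>s\<in>carrier G.
       \<Oplus>\<^bsub>A\<^esub>g\<in>{g \<in> carrier G. a g \<noteq> \<zero>\<^bsub>A\<^esub>}.
         \<sigma> g (inv\<^bsub>G\<^esub> g \<otimes>\<^bsub>G\<^esub> s) \<odot>\<^bsub>A\<^esub>
           (a g \<otimes>\<^bsub>A\<^esub> \<theta> g (u (inv\<^bsub>G\<^esub> g) \<otimes>\<^bsub>A\<^esub> b (inv\<^bsub>G\<^esub> g \<otimes>\<^bsub>G\<^esub> s)))),
     one = (\<lambda>s\<in>carrier G. if s = \<one>\<^bsub>G\<^esub> then \<one>\<^bsub>A\<^esub> else \<zero>\<^bsub>A\<^esub>),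
     zero = (\<lambda>s\<in>carrier G. \<zero>\<^bsub>A\<^esub>),
     add = (\<lambda>a b. \<lambda>s\<in>carrier G. a s \<oplus>\<^bsub>A\<^esub> b s),
     smult = (\<lambda>k a. \<lambda>s\<in>carrier G. k \<odot>\<^bsub>A\<^esub> a s)\<rparr>"

text \<open>The homogeneous element \<open>a \<delta>_g\<close>.\<close>

definition delta ::
    "('g, 'm) monoid_scheme \<Rightarrow> ('k, 'a) module \<Rightarrow> 'a \<Rightarrow> 'g \<Rightarrow> 'g \<Rightarrow> 'a"
  where "delta G A a g = (\<lambda>s\<in>carrier G. if s = g then a else \<zero>\<^bsub>A\<^esub>)"

end

theory Submission
  imports Defs
begin

text \<open>
  Write \<open>[g]\<close> for the generators of \<open>P = \<kappa>\<^sub>p\<^sub>a\<^sub>r\<^sup>\<sigma> G\<close>.  Each \<open>[g]\<close> has a quasi-inverse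
  \<open>[g]\<^sup>* = \<sigma>(g, g\<inverse>)\<inverse> [g\<inverse>]\<close> (zero if \<open>\<sigma>(g, g\<inverse>) = 0\<close>, in which case \<open>[g] = 0\<close> as well), and the
  idempotents are \<open>e\<^sub>g = [g] [g]\<^sup>*\<close>.  The defining relations yield three rules: the \<open>e\<^sub>g\<close>
  commute, \<open>[g] e\<^sub>h = e\<^sub>g\<^sub>h [g]\<close>, and \<open>[g] [h] = \<sigma>(g, h) e\<^sub>g [gh]\<close> (lemmas \<open>e_commute\<close>,
  \<open>gen_e_shift\<close>, \<open>gen_mult\<close>).  Hence conjugation \<open>\<theta>\<^sub>g(b) = [g] b [g]\<^sup>*\<close> preserves the commutative
  algebra \<open>B\<close> generated by the \<open>e\<^sub>g\<close>, and \<open>\<theta>\<^sub>g(b)\<close> is the only element of \<open>e\<^sub>g B\<close> with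
  \<open>\<theta>\<^sub>g(b) [g] = [g] b\<close>.
  The axioms of a unital partial action, and the cocycle identity for \<open>\<sigma>\<close>, are then obtained
  by computing a product of generators in two ways and cancelling \<open>[s]\<close> on the right of
  \<open>B e\<^sub>s\<close> (lemma \<open>gen_right_cancel\<close>).

  That \<open>\<sigma>\<close> is a factor set, and not merely satisfies the relations, enters through the
  representation \<open>\<Gamma>\<close> of which it is one: \<open>\<Gamma>\<close> factors through \<open>P\<close>, so \<open>1 \<noteq> 0\<close> in \<open>P\<close>, and
  \<open>[g] [h] = 0\<close> forces \<open>\<Gamma>(g) \<Gamma>(h) = 0\<close> and hence \<open>\<sigma>(g, h) = 0\<close>.

  For the isomorphism, \<open>P\<close> is \<open>G\<close>-graded, since all relators are homogeneous when \<open>[g]\<close> gets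
  the degree \<open>g\<close>.  Let \<open>\<pi>\<^sub>s\<close> be the projection to degree \<open>s\<close>.  The component of degree \<open>s\<close> is
  \<open>B [s]\<close>, and \<open>b \<mapsto> b [s]\<close> is a bijection from \<open>D\<^sub>s = e\<^sub>s B\<close> to it with inverse
  \<open>x \<mapsto> x [s]\<^sup>*\<close>.  So \<open>\<Phi>(x) = (\<pi>\<^sub>s(x) [s]\<^sup>*)\<^sub>s\<close> is a linear bijection from \<open>P\<close> to the direct sum of
  the \<open>D\<^sub>s\<close> (lemma \<open>Phi_bij\<close>), and the identity
  \<open>\<pi>\<^sub>s(b [g] y) [s]\<^sup>* = \<sigma>(g, h) b \<theta>\<^sub>g(\<pi>\<^sub>h(y) [h]\<^sup>*)\<close> for \<open>h = g\<inverse> s\<close> shows that it is multiplicative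
  (lemmas \<open>beta_homogeneous_mult\<close>, \<open>Phi_mult\<close>).  Associativity of the crossed product need not be
  checked by hand: it is inherited from \<open>P\<close> along \<open>\<Phi>\<close>.
\<close>

section \<open>Algebras, subalgebras and homomorphisms\<close>

text \<open>
  Apart from \<open>1 \<noteq> 0\<close>, the algebra axioms are equations and existence statements about the
  operations, and therefore pass to an image as soon as the map respects the operations; the
  target is a mere structure here.  This makes an algebra out of the quotient by an ideal, and
  out of the crossed product.
\<close>

lemma kalgebra_surj_image:
  fixes A :: "('k, 'a, 'p) module_scheme" and B :: "('k, 'b, 'q) module_scheme"
  assumes "kalgebra K A"
    and surj: "f ` carrier A = carrier B"
    and mult: "\<And>x y. \<lbrakk>x \<in> carrier A; y \<in> carrier A\<rbrakk> \<Longrightarrow> f (x \<otimes>\<^bsub>A\<^esub> y) = f x \<otimes>\<^bsub>B\<^esub> f y"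
    and add: "\<And>x y. \<lbrakk>x \<in> carrier A; y \<in> carrier A\<rbrakk> \<Longrightarrow> f (x \<oplus>\<^bsub>A\<^esub> y) = f x \<oplus>\<^bsub>B\<^esub> f y"
    and smult: "\<And>k x. \<lbrakk>k \<in> carrier K; x \<in> carrier A\<rbrakk> \<Longrightarrow> f (k \<odot>\<^bsub>A\<^esub> x) = k \<odot>\<^bsub>B\<^esub> f x"
    and one: "f \<one>\<^bsub>A\<^esub> = \<one>\<^bsub>B\<^esub>" and zero: "f \<zero>\<^bsub>A\<^esub> = \<zero>\<^bsub>B\<^esub>"
    and nontriv: "\<one>\<^bsub>B\<^esub> \<noteq> \<zero>\<^bsub>B\<^esub>"
  shows "kalgebra K B"
proof -
  interpret A: kalgebra K A by fact
  have ex: "\<exists>a\<in>carrier A. x = f a" if "x \<in> carrier B" for x using that surj by blast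
  have cl: "f a \<in> carrier B" if "a \<in> carrier A" for a using that surj by blast
  note r = mult[symmetric] add[symmetric] smult[symmetric] one[symmetric] zero[symmetric] cl
  have ab: "abelian_group B"
  proof (rule abelian_groupI, goal_cases)
    case (1 x y) then obtain a b where "a \<in> carrier A" "b \<in> carrier A" "x = f a" "y = f b"
      using ex by meson
    then show ?case by (simp add: r)
  next
    case 2 show ?case by (simp add: r)
  next
    case (3 x y z) then obtain a b c where "a \<in> carrier A" "b \<in> carrier A" "c \<in> carrier A"
      "x = f a" "y = f b" "z = f c" using ex by meson
    then show ?case by (simp add: r A.M.a_assoc)
  next
    case (4 x y) then obtain a b where "a \<in> carrier A" "b \<in> carrier A" "x = f a" "y = f b"
      using ex by meson
    then show ?case by (simp add: r A.M.a_comm)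
  next
    case (5 x) then obtain a where "a \<in> carrier A" "x = f a" using ex by meson
    then show ?case by (simp add: r)
  next
    case (6 x) then obtain a where a: "a \<in> carrier A" "x = f a" using ex by meson
    show ?case
      by (rule bexI[of _ "f (\<ominus>\<^bsub>A\<^esub> a)"]) (use a in \<open>simp_all add: r A.M.l_neg\<close>)
  qed
  have mon: "monoid B"
  proof (rule monoidI, goal_cases)
    case (1 x y) then obtain a b where "a \<in> carrier A" "b \<in> carrier A" "x = f a" "y = f b"
      using ex by meson
    then show ?case by (simp add: r)
  next
    case 2 show ?case by (simp add: r)
  next
    case (3 x y z) then obtain a b c where "a \<in> carrier A" "b \<in> carrier A" "c \<in> carrier A"
      "x = f a" "y = f b" "z = f c" using ex by meson
    then show ?case by (simp add: r A.A.m_assoc)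
  next
    case (4 x) then obtain a where "a \<in> carrier A" "x = f a" using ex by meson
    then show ?case by (simp add: r)
  next
    case (5 x) then obtain a where "a \<in> carrier A" "x = f a" using ex by meson
    then show ?case by (simp add: r)
  qed
  have rng: "ring B"
  proof (rule ringI[OF ab mon], goal_cases)
    case (1 x y z) then obtain a b c where "a \<in> carrier A" "b \<in> carrier A" "c \<in> carrier A"
      "x = f a" "y = f b" "z = f c" using ex by meson
    then show ?case by (simp add: r A.A.l_distr)
  next
    case (2 x y z) then obtain a b c where "a \<in> carrier A" "b \<in> carrier A" "c \<in> carrier A"
      "x = f a" "y = f b" "z = f c" using ex by meson
    then show ?case by (simp add: r A.A.r_distr)
  qed
  have mod: "module K B"
  proof (rule moduleI[OF A.R.is_cring ab], goal_cases)
    case (1 k x) then obtain a where "a \<in> carrier A" "x = f a" using ex by meson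
    with 1 show ?case by (simp add: r)
  next
    case (2 k l x) then obtain a where "a \<in> carrier A" "x = f a" using ex by meson
    with 2 show ?case by (simp add: r A.smult_l_distr)
  next
    case (3 k x y) then obtain a b where "a \<in> carrier A" "b \<in> carrier A" "x = f a" "y = f b"
      using ex by meson
    with 3 show ?case by (simp add: r A.smult_r_distr)
  next
    case (4 k l x) then obtain a where "a \<in> carrier A" "x = f a" using ex by meson
    with 4 show ?case by (simp add: r A.smult_assoc1)
  next
    case (5 x) then obtain a where "a \<in> carrier A" "x = f a" using ex by meson
    then show ?case by (simp add: r)
  qed
  show ?thesis
  proof (intro kalgebra.intro kalgebra_axioms.intro rng mod nontriv, goal_cases)
    case (1 k x y) then obtain a b where "a \<in> carrier A" "b \<in> carrier A" "x = f a" "y = f b"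
      using ex by meson
    with 1 show ?case by (simp add: r A.smult_mult_left)
  next
    case (2 k x y) then obtain a b where "a \<in> carrier A" "b \<in> carrier A" "x = f a" "y = f b"
      using ex by meson
    with 2 show ?case by (simp add: r A.smult_mult_right)
  qed
qed

lemma (in kalgebra) a_inv_eq_smult: "x \<in> carrier A \<Longrightarrow> \<ominus>\<^bsub>A\<^esub> x = (\<ominus> \<one>) \<odot>\<^bsub>A\<^esub> x"
  using smult_l_minus[of \<one> x] by simp

lemma (in kalgebra) ideal_smult_closed:
  assumes I: "ideal I A" and k: "k \<in> carrier K" and y: "y \<in> I"
  shows "k \<odot>\<^bsub>A\<^esub> y \<in> I"
proof -
  have yA: "y \<in> carrier A" by (rule ideal.Icarr[OF I y])
  have "k \<odot>\<^bsub>A\<^esub> y = (k \<odot>\<^bsub>A\<^esub> \<one>\<^bsub>A\<^esub>) \<otimes>\<^bsub>A\<^esub> y"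
    using k yA by (simp add: smult_mult_left)
  also have "\<dots> \<in> I" by (rule ideal.I_l_closed[OF I y]) (use k in simp)
  finally show ?thesis .
qed

lemma (in kalgebra) k_subalgebraI:
  assumes "S \<subseteq> carrier A" "\<one>\<^bsub>A\<^esub> \<in> S"
    and "\<And>x y. \<lbrakk>x \<in> S; y \<in> S\<rbrakk> \<Longrightarrow> x \<oplus>\<^bsub>A\<^esub> y \<in> S"
    and "\<And>x y. \<lbrakk>x \<in> S; y \<in> S\<rbrakk> \<Longrightarrow> x \<otimes>\<^bsub>A\<^esub> y \<in> S"
    and sm: "\<And>k x. \<lbrakk>k \<in> carrier K; x \<in> S\<rbrakk> \<Longrightarrow> k \<odot>\<^bsub>A\<^esub> x \<in> S"
  shows "k_subalgebra K A S"
proof -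
  have "\<ominus>\<^bsub>A\<^esub> x \<in> S" if "x \<in> S" for x
  proof -
    have "x \<in> carrier A" using that assms(1) by auto
    then show ?thesis using sm[OF _ that, of "\<ominus> \<one>"] by (simp add: a_inv_eq_smult)
  qed
  then show ?thesis unfolding k_subalgebra_def
    by (intro conjI A.subringI) (use assms in auto)
qed

lemma kalg_homD:
  assumes "f \<in> kalg_hom K A B"
  shows "\<And>x. x \<in> carrier A \<Longrightarrow> f x \<in> carrier B"
    and "\<And>x y. \<lbrakk>x \<in> carrier A; y \<in> carrier A\<rbrakk> \<Longrightarrow> f (x \<otimes>\<^bsub>A\<^esub> y) = f x \<otimes>\<^bsub>B\<^esub> f y"
    and "\<And>x y. \<lbrakk>x \<in> carrier A; y \<in> carrier A\<rbrakk> \<Longrightarrow> f (x \<oplus>\<^bsub>A\<^esub> y) = f x \<oplus>\<^bsub>B\<^esub> f y"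
    and "f \<one>\<^bsub>A\<^esub> = \<one>\<^bsub>B\<^esub>"
    and "\<And>k x. \<lbrakk>k \<in> carrier K; x \<in> carrier A\<rbrakk> \<Longrightarrow> f (k \<odot>\<^bsub>A\<^esub> x) = k \<odot>\<^bsub>B\<^esub> f x"
  using assms by (auto simp: kalg_hom_def ring_hom_def)

lemma kalg_hom_zero:
  assumes "kalgebra K A" "kalgebra K B" "f \<in> kalg_hom K A B"
  shows "f \<zero>\<^bsub>A\<^esub> = \<zero>\<^bsub>B\<^esub>"
proof -
  interpret A: kalgebra K A by fact
  interpret B: kalgebra K B by fact
  show ?thesis using assms(3) A.A.ring_axioms B.A.ring_axioms
    by (intro ring_hom_zero) (auto simp: kalg_hom_def)
qed

lemma hom_minus_eq_zero_iff:
  assumes "kalgebra K A" "kalgebra K B" "f \<in> kalg_hom K A B"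
    and "x \<in> carrier A" "y \<in> carrier A"
  shows "f (x \<ominus>\<^bsub>A\<^esub> y) = \<zero>\<^bsub>B\<^esub> \<longleftrightarrow> f x = f y"
proof -
  interpret A: kalgebra K A by fact
  interpret B: kalgebra K B by fact
  interpret f: ring_hom_ring A B f
    using assms(3) by (intro ring_hom_ringI2) (auto simp: kalg_hom_def A.A.ring_axioms B.A.ring_axioms)
  have "f (x \<ominus>\<^bsub>A\<^esub> y) = f x \<ominus>\<^bsub>B\<^esub> f y"
    using assms(4,5) by (simp add: a_minus_def)
  then show ?thesis using assms(4,5) by (simp add: B.A.r_right_minus_eq)
qed

lemma (in kalgebra) k_subalgebra_Inter:
  assumes "\<And>B. B \<in> \<B> \<Longrightarrow> k_subalgebra K A B" "\<B> \<noteq> {}"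
  shows "k_subalgebra K A (\<Inter>\<B>)"
  using assms A.subring_Inter[of \<B>] by (auto simp: k_subalgebra_def)

lemma (in kalgebra) k_subalgebra_alg_generate:
  assumes "S \<subseteq> carrier A"
  shows "k_subalgebra K A (alg_generate K A S)"
  unfolding alg_generate_def
proof (rule k_subalgebra_Inter)
  have "k_subalgebra K A (carrier A)" by (rule k_subalgebraI) auto
  then show "{B. k_subalgebra K A B \<and> S \<subseteq> B} \<noteq> {}" using assms by auto
qed auto

lemma alg_generate_minimal:
  "\<lbrakk>k_subalgebra K A B; S \<subseteq> B\<rbrakk> \<Longrightarrow> alg_generate K A S \<subseteq> B"
  by (auto simp: alg_generate_def)

lemma alg_generate_incl: "S \<subseteq> alg_generate K A S"
  by (auto simp: alg_generate_def)

lemma k_subalgebraD: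
  assumes "k_subalgebra K A B"
  shows "B \<subseteq> carrier A" "\<zero>\<^bsub>A\<^esub> \<in> B" "\<one>\<^bsub>A\<^esub> \<in> B"
    and "\<And>x y. \<lbrakk>x \<in> B; y \<in> B\<rbrakk> \<Longrightarrow> x \<otimes>\<^bsub>A\<^esub> y \<in> B"
    and "\<And>x y. \<lbrakk>x \<in> B; y \<in> B\<rbrakk> \<Longrightarrow> x \<oplus>\<^bsub>A\<^esub> y \<in> B"
    and "\<And>k x. \<lbrakk>k \<in> carrier K; x \<in> B\<rbrakk> \<Longrightarrow> k \<odot>\<^bsub>A\<^esub> x \<in> B"
  using assms subringE[of B A] by (auto simp: k_subalgebra_def)

lemma (in kalgebra) centralizer_k_subalgebra:
  assumes "T \<subseteq> carrier A"
  shows "k_subalgebra K A {x \<in> carrier A. \<forall>t\<in>T. x \<otimes>\<^bsub>A\<^esub> t = t \<otimes>\<^bsub>A\<^esub> x}"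
proof (rule k_subalgebraI, goal_cases)
  case (4 x y)
  have "x \<otimes>\<^bsub>A\<^esub> y \<otimes>\<^bsub>A\<^esub> t = t \<otimes>\<^bsub>A\<^esub> (x \<otimes>\<^bsub>A\<^esub> y)" if "t \<in> T" for t
  proof -
    have c: "x \<in> carrier A" "y \<in> carrier A" "t \<in> carrier A" using 4 that assms by auto
    have "x \<otimes>\<^bsub>A\<^esub> y \<otimes>\<^bsub>A\<^esub> t = x \<otimes>\<^bsub>A\<^esub> (t \<otimes>\<^bsub>A\<^esub> y)" using 4 that c by (simp add: A.m_assoc)
    also have "\<dots> = t \<otimes>\<^bsub>A\<^esub> x \<otimes>\<^bsub>A\<^esub> y" using 4 that c by (simp add: A.m_assoc[symmetric])
    finally show ?thesis using c by (simp add: A.m_assoc)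
  qed
  then show ?case using 4 by auto
qed (use assms in \<open>auto simp: A.l_distr A.r_distr smult_mult_left smult_mult_right subset_iff\<close>)

text \<open>
  The centralizer of the generators is a subalgebra containing them, so the generators commute
  with the algebra they generate; the same argument for the centralizer of that algebra
  concludes.
\<close>

lemma (in kalgebra) alg_generate_commute:
  assumes S: "S \<subseteq> carrier A" and comm: "\<And>x y. \<lbrakk>x \<in> S; y \<in> S\<rbrakk> \<Longrightarrow> x \<otimes>\<^bsub>A\<^esub> y = y \<otimes>\<^bsub>A\<^esub> x"
    and x: "x \<in> alg_generate K A S" and y: "y \<in> alg_generate K A S"
  shows "x \<otimes>\<^bsub>A\<^esub> y = y \<otimes>\<^bsub>A\<^esub> x"
proof -
  let ?B = "alg_generate K A S"
  have BA: "?B \<subseteq> carrier A" using k_subalgebraD(1)[OF k_subalgebra_alg_generate[OF S]] .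
  have 1: "?B \<subseteq> {x \<in> carrier A. \<forall>t\<in>S. x \<otimes>\<^bsub>A\<^esub> t = t \<otimes>\<^bsub>A\<^esub> x}"
    by (rule alg_generate_minimal[OF centralizer_k_subalgebra[OF S]]) (use S comm in auto)
  have "?B \<subseteq> {x \<in> carrier A. \<forall>t\<in>?B. x \<otimes>\<^bsub>A\<^esub> t = t \<otimes>\<^bsub>A\<^esub> x}"
    by (rule alg_generate_minimal[OF centralizer_k_subalgebra[OF BA]]) (use S 1 in auto)
  then show ?thesis using x y by auto
qed

lemma (in kalgebra) k_subalgebra_kalgebra:
  assumes "k_subalgebra K A S"
  shows "kalgebra K (A\<lparr>carrier := S\<rparr>)"
proof -
  note S = k_subalgebraD[OF assms]
  have SA: "x \<in> carrier A" if "x \<in> S" for x using S(1) that by blast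
  have rng: "ring (A\<lparr>carrier := S\<rparr>)"
    using assms by (intro A.subring_is_ring) (simp add: k_subalgebra_def)
  show ?thesis
    by (intro kalgebra.intro kalgebra_axioms.intro moduleI R.is_cring rng ring.is_abelian_group[OF rng])
      (simp_all add: S SA smult_l_distr smult_r_distr smult_assoc1 smult_mult_left smult_mult_right
        one_neq_zero)
qed

lemma (in kalgebra) k_subalgebra_finsum:
  assumes "k_subalgebra K A S" "f \<in> T \<rightarrow> S"
  shows "finsum (A\<lparr>carrier := S\<rparr>) f T = finsum A f T"
proof -
  interpret S: kalgebra K "A\<lparr>carrier := S\<rparr>" by (rule k_subalgebra_kalgebra[OF assms(1)])
  have SA: "S \<subseteq> carrier A" by (rule k_subalgebraD(1)[OF assms(1)])
  show ?thesis using assms(2)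
  proof (induction T rule: infinite_finite_induct)
    case (infinite T) then show ?case by (simp add: S.M.finsum_infinite M.finsum_infinite)
  next
    case empty show ?case by simp
  next
    case (insert t T)
    then have "f \<in> T \<rightarrow> carrier A" "f t \<in> carrier A" "f \<in> T \<rightarrow> S" "f t \<in> S" using SA by auto
    then show ?case using insert by simp
  qed
qed

lemma (in kalgebra) kalg_iso_inv_into:
  assumes f: "f \<in> kalg_iso K A B"
  shows "inv_into (carrier A) f \<in> kalg_iso K B A"
proof -
  let ?g = "inv_into (carrier A) f"
  have hom: "f \<in> kalg_hom K A B" and bij: "bij_betw f (carrier A) (carrier B)"
    using f by (auto simp: kalg_iso_def)
  note h = kalg_homD[OF hom]
  have g: "?g y \<in> carrier A" "f (?g y) = y" if "y \<in> carrier B" for y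
    using that bij by (auto simp: bij_betw_def inv_into_into f_inv_into_f)
  have gI: "?g y = x" if "x \<in> carrier A" "f x = y" for x y
    using that bij by (auto simp: bij_betw_def)
  have "?g \<in> kalg_hom K B A"
    unfolding kalg_hom_def
  proof (intro CollectI conjI ring_hom_memI ballI, goal_cases)
    case (2 x y) show ?case by (rule gI) (use 2 in \<open>simp_all add: g h\<close>)
  next
    case (3 x y) show ?case by (rule gI) (use 3 in \<open>simp_all add: g h\<close>)
  next
    case 4 show ?case by (rule gI) (simp_all add: h)
  next
    case (5 k x) show ?case by (rule gI) (use 5 in \<open>simp_all add: g h\<close>)
  qed (simp add: g)
  then show ?thesis using bij by (simp add: kalg_iso_def bij_betw_inv_into)
qed

section \<open>The free algebra\<close>

text \<open>
  The product of the free algebra satisfies a recursion on the word at which it is evaluated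
  (lemma \<open>cauchy_Cons\<close>): if \<open>f\<^sub>a(u) = f(au)\<close>, then \<open>(f g)\<^sub>a = f() g\<^sub>a + f\<^sub>a g\<close>, where \<open>f()\<close> is
  the constant coefficient.  All laws, associativity included, follow from it by induction on
  words, without interchanging sums; they hold for arbitrary families of coefficients.
\<close>

definition cauchy :: "('k, 'n) ring_scheme \<Rightarrow> ('x list \<Rightarrow> 'k) \<Rightarrow> ('x list \<Rightarrow> 'k) \<Rightarrow> 'x list \<Rightarrow> 'k"
  where "cauchy K f g w = (\<Oplus>\<^bsub>K\<^esub>i\<in>{..length w}. f (take i w) \<otimes>\<^bsub>K\<^esub> g (drop i w))"

context cring
begin

abbreviation fam :: "('x list \<Rightarrow> 'a) \<Rightarrow> bool" where "fam f \<equiv> \<forall>w. f w \<in> carrier R"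

lemma cauchy_Nil: "\<lbrakk>fam f; fam g\<rbrakk> \<Longrightarrow> cauchy R f g [] = f [] \<otimes> g []"
  by (simp add: cauchy_def)

lemma cauchy_Cons:
  assumes "fam f" "fam g"
  shows "cauchy R f g (a # w) = f [] \<otimes> g (a # w) \<oplus> cauchy R (\<lambda>u. f (a # u)) g w"
proof -
  have "cauchy R f g (a # w) =
      (\<Oplus>i\<in>{..length w}. f (a # take i w) \<otimes> g (drop i w)) \<oplus> f [] \<otimes> g (a # w)"
    using assms by (simp add: cauchy_def finsum_Suc2 del: finsum_Suc)
  then show ?thesis using assms by (simp add: cauchy_def a_comm)
qed

lemma cauchy_closed: "\<lbrakk>fam f; fam g\<rbrakk> \<Longrightarrow> cauchy R f g w \<in> carrier R"
  by (simp add: cauchy_def)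

lemma cauchy_add_left:
  assumes "fam f" "fam f'" "fam g"
  shows "cauchy R (\<lambda>w. f w \<oplus> f' w) g w = cauchy R f g w \<oplus> cauchy R f' g w"
  using assms(1,2)
proof (induction w arbitrary: f f')
  case Nil then show ?case using assms by (simp add: cauchy_Nil l_distr)
next
  case (Cons a w)
  then show ?case using assms Cons.IH[of "\<lambda>u. f (a # u)" "\<lambda>u. f' (a # u)"]
    by (simp add: cauchy_Cons cauchy_closed l_distr a_ac)
qed

lemma cauchy_add_right:
  assumes "fam g" "fam g'" "fam f"
  shows "cauchy R f (\<lambda>w. g w \<oplus> g' w) w = cauchy R f g w \<oplus> cauchy R f g' w"
  using assms(3)
proof (induction w arbitrary: f)
  case Nil then show ?case using assms by (simp add: cauchy_Nil r_distr)
next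
  case (Cons a w)
  then show ?case using assms Cons.IH[of "\<lambda>u. f (a # u)"]
    by (simp add: cauchy_Cons cauchy_closed r_distr a_ac)
qed

lemma cauchy_smult_left:
  assumes "k \<in> carrier R" "fam f" "fam g"
  shows "cauchy R (\<lambda>w. k \<otimes> f w) g w = k \<otimes> cauchy R f g w"
  using assms(2)
proof (induction w arbitrary: f)
  case Nil then show ?case using assms by (simp add: cauchy_Nil m_assoc)
next
  case (Cons a w)
  then show ?case using assms Cons.IH[of "\<lambda>u. f (a # u)"]
    by (simp add: cauchy_Cons cauchy_closed r_distr m_assoc)
qed

lemma cauchy_smult_right:
  assumes "k \<in> carrier R" "fam f" "fam g"
  shows "cauchy R f (\<lambda>w. k \<otimes> g w) w = k \<otimes> cauchy R f g w"
  using assms(2)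
proof (induction w arbitrary: f)
  case Nil then show ?case using assms by (simp add: cauchy_Nil m_lcomm)
next
  case (Cons a w)
  then show ?case using assms Cons.IH[of "\<lambda>u. f (a # u)"]
    by (simp add: cauchy_Cons cauchy_closed r_distr m_lcomm)
qed

lemma cauchy_assoc:
  assumes "fam f" "fam g" "fam h"
  shows "cauchy R (cauchy R f g) h w = cauchy R f (cauchy R g h) w"
  using assms
proof (induction w arbitrary: f g)
  case Nil then show ?case by (simp add: cauchy_Nil cauchy_closed m_assoc)
next
  case (Cons a w)
  let ?fa = "\<lambda>u. f (a # u)" and ?ga = "\<lambda>u. g (a # u)"
  have "cauchy R (cauchy R f g) h (a # w) = cauchy R f g [] \<otimes> h (a # w) \<oplus>
     cauchy R (\<lambda>u. f [] \<otimes> ?ga u \<oplus> cauchy R ?fa g u) h w"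
    using Cons.prems by (simp add: cauchy_Cons cauchy_closed)
  also have "\<dots> = f [] \<otimes> g [] \<otimes> h (a # w) \<oplus> (f [] \<otimes> cauchy R ?ga h w \<oplus> cauchy R (cauchy R ?fa g) h w)"
    using Cons.prems by (simp add: cauchy_Nil cauchy_add_left cauchy_smult_left cauchy_closed)
  also have "\<dots> = cauchy R f (cauchy R g h) (a # w)"
    using Cons.prems Cons.IH[of ?fa g]
    by (simp add: cauchy_Cons cauchy_closed r_distr m_assoc a_assoc)
  finally show ?case .
qed

lemma cauchy_zero_left: "fam f \<Longrightarrow> cauchy R (\<lambda>_. \<zero>) f w = \<zero>"
  by (simp add: cauchy_def)

lemma cauchy_one_left:
  "fam f \<Longrightarrow> cauchy R (\<lambda>w. if w = [] then \<one> else \<zero>) f w = f w"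
  by (cases w) (simp_all add: cauchy_Nil cauchy_Cons cauchy_zero_left)

lemma cauchy_one_right:
  "fam f \<Longrightarrow> cauchy R f (\<lambda>w. if w = [] then \<one> else \<zero>) w = f w"
  by (induction w arbitrary: f) (simp_all add: cauchy_Nil cauchy_Cons)

lemma fam_gen: "fam (free_gen R x)"
  by (simp add: free_gen_def)

lemma cauchy_gen_left:
  assumes "fam f"
  shows "cauchy R (free_gen R x) f w = (case w of [] \<Rightarrow> \<zero> | a # u \<Rightarrow> if a = x then f u else \<zero>)"
proof (cases w)
  case Nil then show ?thesis using assms by (simp add: cauchy_Nil fam_gen) (simp add: free_gen_def)
next
  case (Cons a u)
  have "(\<lambda>v. free_gen R x (a # v)) = (if a = x then (\<lambda>v. if v = [] then \<one> else \<zero>) else (\<lambda>_. \<zero>))"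
    by (auto simp: free_gen_def)
  then show ?thesis using assms Cons
    by (simp add: cauchy_Cons fam_gen cauchy_one_left cauchy_zero_left) (simp add: free_gen_def)
qed

lemma cauchy_gen_right:
  assumes "fam f"
  shows "cauchy R f (free_gen R x) [] = \<zero>"
    and "cauchy R f (free_gen R x) (w @ [a]) = (if a = x then f w else \<zero>)"
proof -
  show "cauchy R f (free_gen R x) [] = \<zero>"
    using assms by (simp add: cauchy_Nil fam_gen) (simp add: free_gen_def)
  show "cauchy R f (free_gen R x) (w @ [a]) = (if a = x then f w else \<zero>)"
    using assms
  proof (induction w arbitrary: f)
    case Nil
    then show ?case by (simp add: cauchy_Cons cauchy_Nil fam_gen) (simp add: free_gen_def)
  next
    case (Cons b w)
    have "free_gen R x (b # w @ [a]) = \<zero>" by (simp add: free_gen_def)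
    with Cons show ?case by (simp add: cauchy_Cons fam_gen)
  qed
qed

end

lemma free_algebra_simps:
  "carrier (free_algebra K X) = {f. (\<forall>w. f w \<in> carrier K) \<and> (\<forall>w. w \<notin> lists X \<longrightarrow> f w = \<zero>\<^bsub>K\<^esub>) \<and>
                   finite {w. f w \<noteq> \<zero>\<^bsub>K\<^esub>}}"
  "f \<otimes>\<^bsub>free_algebra K X\<^esub> g = cauchy K f g"
  "\<one>\<^bsub>free_algebra K X\<^esub> = (\<lambda>w. if w = [] then \<one>\<^bsub>K\<^esub> else \<zero>\<^bsub>K\<^esub>)"
  "\<zero>\<^bsub>free_algebra K X\<^esub> = (\<lambda>w. \<zero>\<^bsub>K\<^esub>)"
  "f \<oplus>\<^bsub>free_algebra K X\<^esub> g = (\<lambda>w. f w \<oplus>\<^bsub>K\<^esub> g w)"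
  "k \<odot>\<^bsub>free_algebra K X\<^esub> f = (\<lambda>w. k \<otimes>\<^bsub>K\<^esub> f w)"
  by (auto simp: free_algebra_def cauchy_def fun_eq_iff)

lemma (in cring) cauchy_support:
  assumes f: "f \<in> carrier (free_algebra R X)" and g: "g \<in> carrier (free_algebra R X)"
  shows "{w. cauchy R f g w \<noteq> \<zero>} \<subseteq> (\<lambda>(u, v). u @ v) ` ({w. f w \<noteq> \<zero>} \<times> {w. g w \<noteq> \<zero>})"
proof
  fix w assume "w \<in> {w. cauchy R f g w \<noteq> \<zero>}"
  then have ne: "cauchy R f g w \<noteq> \<zero>" by simp
  have "\<exists>i\<in>{..length w}. f (take i w) \<otimes> g (drop i w) \<noteq> \<zero>"
  proof (rule ccontr)
    assume "\<not> ?thesis"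
    then have "cauchy R f g w = (\<Oplus>i\<in>{..length w}. \<zero>)"
      unfolding cauchy_def by (intro finsum_cong') auto
    with ne show False by simp
  qed
  then obtain i where i: "f (take i w) \<otimes> g (drop i w) \<noteq> \<zero>" by auto
  then have "f (take i w) \<noteq> \<zero>" "g (drop i w) \<noteq> \<zero>"
    using f g by (auto simp: free_algebra_simps)
  then show "w \<in> (\<lambda>(u, v). u @ v) ` ({w. f w \<noteq> \<zero>} \<times> {w. g w \<noteq> \<zero>})"
    by (intro image_eqI[of _ _ "(take i w, drop i w)"]) auto
qed

lemma (in cring) free_algebra_mult_closed:
  assumes f: "f \<in> carrier (free_algebra R X)" and g: "g \<in> carrier (free_algebra R X)"
  shows "cauchy R f g \<in> carrier (free_algebra R X)"
proof -
  note s = cauchy_support[OF f g]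
  have "finite {w. cauchy R f g w \<noteq> \<zero>}"
    by (rule finite_subset[OF s]) (use f g in \<open>auto simp: free_algebra_simps\<close>)
  moreover have "cauchy R f g w = \<zero>" if "w \<notin> lists X" for w
  proof (rule ccontr)
    assume "cauchy R f g w \<noteq> \<zero>"
    then have "w \<in> (\<lambda>(u, v). u @ v) ` ({w. f w \<noteq> \<zero>} \<times> {w. g w \<noteq> \<zero>})"
      by (intro subsetD[OF s]) simp
    then obtain u v where uv: "w = u @ v" "f u \<noteq> \<zero>" "g v \<noteq> \<zero>" by auto
    then have "u \<in> lists X" "v \<in> lists X" using f g by (auto simp: free_algebra_simps)
    with uv that show False by simp
  qed
  ultimately show ?thesis using f g by (simp add: free_algebra_simps cauchy_closed)
qed

lemma (in field) free_algebra_kalgebra: "kalgebra R (free_algebra R X)"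
proof -
  let ?F = "free_algebra R X"
  note fs = free_algebra_simps
  have famD: "fam f" if "f \<in> carrier ?F" for f using that by (simp add: fs)
  have add_cl: "(\<lambda>w. f w \<oplus> g w) \<in> carrier ?F" if "f \<in> carrier ?F" "g \<in> carrier ?F" for f g
    using that by (auto simp: fs intro: finite_subset[of _ "{w. f w \<noteq> \<zero>} \<union> {w. g w \<noteq> \<zero>}"])
  have sm_cl: "(\<lambda>w. k \<otimes> f w) \<in> carrier ?F" if "k \<in> carrier R" "f \<in> carrier ?F" for k f
    using that by (auto simp: fs intro: finite_subset[of _ "{w. f w \<noteq> \<zero>}"])
  have one_cl: "\<one>\<^bsub>?F\<^esub> \<in> carrier ?F" by (auto simp: fs)
  have ab: "abelian_group ?F"
  proof (rule abelian_groupI, goal_cases)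
    case (6 f)
    have "(\<lambda>w. \<ominus> \<one> \<otimes> f w) \<in> carrier ?F" using sm_cl[OF _ 6] by simp
    then show ?case
      by (rule bexI[rotated]) (use famD[OF 6] in \<open>simp add: fs l_minus l_neg\<close>)
  next
    case (1 f g) then show ?case using add_cl by (simp add: fs(5))
  next
    case 2 then show ?case by (simp add: fs)
  next
    case (3 f g h) then show ?case by (simp add: fs(5) famD a_assoc)
  next
    case (4 f g) then show ?case by (simp add: fs(5) famD a_comm)
  next
    case (5 f) then show ?case by (simp add: fs(4,5) famD)
  qed
  have mon: "monoid ?F"
    by (rule monoidI)
      (use one_cl in \<open>auto simp: fs(2) free_algebra_mult_closed famD cauchy_assoc
        cauchy_one_left cauchy_one_right fs(3) intro!: ext\<close>)
  have rng: "ring ?F"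
    by (rule ringI[OF ab mon]) (auto simp: fs(2,5) cauchy_add_left cauchy_add_right famD intro!: ext)
  have mod: "module R ?F"
    by (rule moduleI[OF is_cring ab])
      (use sm_cl famD in \<open>simp_all add: fs(4-6) l_distr r_distr m_assoc\<close>)
  show ?thesis
  proof (intro kalgebra.intro kalgebra_axioms.intro rng mod)
    show "\<one>\<^bsub>?F\<^esub> \<noteq> \<zero>\<^bsub>?F\<^esub>" by (auto simp: fs fun_eq_iff)
  qed (auto simp: fs(2,6) cauchy_smult_left cauchy_smult_right famD intro!: ext)
qed

lemma (in field) free_gen_closed: "x \<in> X \<Longrightarrow> free_gen R x \<in> carrier (free_algebra R X)"
  by (auto simp: free_algebra_simps free_gen_def)

text \<open>
  A subalgebra contains all words in the generators it contains, and a finitely supported family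
  is a linear combination of words, so this is an induction on its support.  Below, this lemma
  replaces inductions on elements: a property of elements is turned into a subalgebra.
\<close>

lemma (in field) free_algebra_generated:
  assumes S: "k_subalgebra R (free_algebra R X) S" and gens: "free_gen R ` X \<subseteq> S"
  shows "S = carrier (free_algebra R X)"
proof -
  let ?F = "free_algebra R X"
  interpret F: kalgebra R ?F by (rule free_algebra_kalgebra)
  note fs = free_algebra_simps
  have sub: "subring S ?F" and sm: "\<And>k f. \<lbrakk>k \<in> carrier R; f \<in> S\<rbrakk> \<Longrightarrow> (\<lambda>w. k \<otimes> f w) \<in> S"
    using S by (auto simp: k_subalgebra_def fs(6))
  note su = subringE[OF sub]
  have mon: "(\<lambda>v. if v = w then \<one> else \<zero>) \<in> S" if "w \<in> lists X" for w
    using that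
  proof (induction w)
    case Nil then show ?case using su(3) by (simp add: fs)
  next
    case (Cons a w)
    have "(\<lambda>v. if v = a # w then \<one> else \<zero>) =
        cauchy R (free_gen R a) (\<lambda>v. if v = w then \<one> else \<zero>)"
      by (rule ext) (auto simp: cauchy_gen_left split: list.split)
    also have "\<dots> \<in> S"
      using su(6)[of "free_gen R a" "\<lambda>v. if v = w then \<one> else \<zero>"] Cons gens by (auto simp: fs(2))
    finally show ?case .
  qed
  have "f \<in> S" if "finite A" "f \<in> carrier ?F" "{w. f w \<noteq> \<zero>} \<subseteq> A" for f A
    using that
  proof (induction A arbitrary: f rule: finite_induct)
    case empty
    then have "f = \<zero>\<^bsub>?F\<^esub>" by (auto simp: fs)
    then show ?case using su(2) by simp
  next
    case (insert a A)
    let ?g = "f(a := \<zero>)"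
    have "?g \<in> carrier ?F" using insert.prems
      by (auto simp: fs elim: rev_finite_subset)
    moreover have "{w. ?g w \<noteq> \<zero>} \<subseteq> A" using insert.prems by auto
    ultimately have g: "?g \<in> S" by (rule insert.IH)
    show ?case
    proof (cases "a \<in> lists X")
      case True
      have "f a \<in> carrier R" using insert.prems by (simp add: fs)
      from su(7)[OF sm[OF this mon[OF True]] g]
      have "(\<lambda>w. f a \<otimes> (if w = a then \<one> else \<zero>) \<oplus> ?g w) \<in> S" by (simp add: fs)
      also have "(\<lambda>w. f a \<otimes> (if w = a then \<one> else \<zero>) \<oplus> ?g w) = f"
        using insert.prems by (auto simp: fs)
      finally show ?thesis .
    next
      case False
      then have "f a = \<zero>" using insert.prems(1) unfolding fs by blast
      then have "f = ?g" by auto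
      with g show ?thesis by simp
    qed
  qed
  then have "carrier ?F \<subseteq> S" by (auto simp: fs)
  then show ?thesis using su(1) by auto
qed

section \<open>Evaluation of the free algebra\<close>

definition word_ev :: "('a, 'm) monoid_scheme \<Rightarrow> ('x \<Rightarrow> 'a) \<Rightarrow> 'x list \<Rightarrow> 'a"
  where "word_ev M \<Gamma> w = foldr (\<lambda>x a. \<Gamma> x \<otimes>\<^bsub>M\<^esub> a) w \<one>\<^bsub>M\<^esub>"

lemma (in monoid) word_ev_closed:
  assumes "\<Gamma> \<in> X \<rightarrow> carrier G"
  shows "w \<in> lists X \<Longrightarrow> word_ev G \<Gamma> w \<in> carrier G"
  by (induction w) (use assms in \<open>auto simp: word_ev_def\<close>)

lemma (in monoid) word_ev_append:
  assumes "\<Gamma> \<in> X \<rightarrow> carrier G" "v \<in> lists X"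
  shows "w \<in> lists X \<Longrightarrow> word_ev G \<Gamma> (w @ v) = word_ev G \<Gamma> w \<otimes> word_ev G \<Gamma> v"
proof (induction w)
  case Nil then show ?case using word_ev_closed[OF assms] by (simp add: word_ev_def)
next
  case (Cons a w)
  moreover have "\<Gamma> a \<in> carrier G" "word_ev G \<Gamma> w \<in> carrier G" "word_ev G \<Gamma> v \<in> carrier G"
    using Cons assms by (auto intro: word_ev_closed)
  ultimately show ?case by (simp add: word_ev_def m_assoc)
qed

definition free_ev ::
    "('k, 'n) ring_scheme \<Rightarrow> ('k, 'a, 'p) module_scheme \<Rightarrow> ('x \<Rightarrow> 'a) \<Rightarrow> ('x list \<Rightarrow> 'k) \<Rightarrow> 'a"
  where "free_ev K A \<Gamma> f = (\<Oplus>\<^bsub>A\<^esub>w\<in>{w. f w \<noteq> \<zero>\<^bsub>K\<^esub>}. f w \<odot>\<^bsub>A\<^esub> word_ev A \<Gamma> w)"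

text \<open>
  The universal property.  By linearity and a reindexing of words, evaluation is
  multiplicative when the left factor is a generator.  The left factors \<open>y\<close> such that
  \<open>ev (y f) = ev y ev f\<close> for all \<open>f\<close> form a subalgebra, hence everything.
\<close>

lemma free_ev_hom:
  fixes A :: "('k, 'a, 'p) module_scheme"
  assumes "field K" "kalgebra K A" and \<Gamma>: "\<Gamma> \<in> X \<rightarrow> carrier A"
  shows "free_ev K A \<Gamma> \<in> kalg_hom K (free_algebra K X) A"
    and "\<And>x. x \<in> X \<Longrightarrow> free_ev K A \<Gamma> (free_gen K x) = \<Gamma> x"
proof -
  interpret K: field K by fact
  interpret A: kalgebra K A by fact
  let ?F = "free_algebra K X"
  interpret F: kalgebra K ?F by (rule K.free_algebra_kalgebra)
  note fs = free_algebra_simps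
  let ?ev = "free_ev K A \<Gamma>"
  let ?W = "word_ev A \<Gamma>"
  note Wcl = A.A.word_ev_closed[OF \<Gamma>]
  have supp: "{w. f w \<noteq> \<zero>\<^bsub>K\<^esub>} \<subseteq> lists X" "finite {w. f w \<noteq> \<zero>\<^bsub>K\<^esub>}" if "f \<in> carrier ?F" for f
    using that unfolding fs by auto
  have co: "f w \<in> carrier K" if "f \<in> carrier ?F" for f w using that by (simp add: fs)
  have ev_sup: "?ev f = (\<Oplus>\<^bsub>A\<^esub>w\<in>S. f w \<odot>\<^bsub>A\<^esub> ?W w)"
    if "f \<in> carrier ?F" "{w. f w \<noteq> \<zero>\<^bsub>K\<^esub>} \<subseteq> S" "finite S" "S \<subseteq> lists X" for f S
    unfolding free_ev_def
    by (rule A.add.finprod_mono_neutral_cong_left) (use that Wcl co in \<open>auto simp: subset_iff\<close>)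
  have ev_cl: "?ev f \<in> carrier A" if "f \<in> carrier ?F" for f
    unfolding free_ev_def using supp[OF that] Wcl co[OF that] by (intro A.M.finsum_closed) (auto simp: subset_iff)
  have ev_add: "?ev (f \<oplus>\<^bsub>?F\<^esub> g) = ?ev f \<oplus>\<^bsub>A\<^esub> ?ev g"
    if f: "f \<in> carrier ?F" and g: "g \<in> carrier ?F" for f g
  proof -
    let ?S = "{w. f w \<noteq> \<zero>\<^bsub>K\<^esub>} \<union> {w. g w \<noteq> \<zero>\<^bsub>K\<^esub>}"
    have S: "finite ?S" "?S \<subseteq> lists X" using supp[OF f] supp[OF g] by auto
    have "?ev (f \<oplus>\<^bsub>?F\<^esub> g) = (\<Oplus>\<^bsub>A\<^esub>w\<in>?S. (f \<oplus>\<^bsub>?F\<^esub> g) w \<odot>\<^bsub>A\<^esub> ?W w)"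
      by (rule ev_sup) (use f g S co in \<open>auto simp: fs(5) F.a_closed[unfolded fs(5)]\<close>)
    also have "\<dots> = (\<Oplus>\<^bsub>A\<^esub>w\<in>?S. f w \<odot>\<^bsub>A\<^esub> ?W w \<oplus>\<^bsub>A\<^esub> g w \<odot>\<^bsub>A\<^esub> ?W w)"
      by (rule A.M.finsum_cong')
        (use S f g co Wcl in \<open>auto simp: fs(5) A.smult_l_distr subset_iff\<close>)
    also have "\<dots> = (\<Oplus>\<^bsub>A\<^esub>w\<in>?S. f w \<odot>\<^bsub>A\<^esub> ?W w) \<oplus>\<^bsub>A\<^esub> (\<Oplus>\<^bsub>A\<^esub>w\<in>?S. g w \<odot>\<^bsub>A\<^esub> ?W w)"
      by (rule A.M.finsum_addf) (use S f g co Wcl in \<open>auto simp: subset_iff\<close>)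
    also have "\<dots> = ?ev f \<oplus>\<^bsub>A\<^esub> ?ev g"
      using ev_sup[OF f _ S] ev_sup[OF g _ S] by auto
    finally show ?thesis .
  qed
  have ev_smult: "?ev (k \<odot>\<^bsub>?F\<^esub> f) = k \<odot>\<^bsub>A\<^esub> ?ev f"
    if k: "k \<in> carrier K" and f: "f \<in> carrier ?F" for k f
  proof -
    let ?S = "{w. f w \<noteq> \<zero>\<^bsub>K\<^esub>}"
    note S = supp[OF f]
    have "?ev (k \<odot>\<^bsub>?F\<^esub> f) = (\<Oplus>\<^bsub>A\<^esub>w\<in>?S. (k \<odot>\<^bsub>?F\<^esub> f) w \<odot>\<^bsub>A\<^esub> ?W w)"
    proof (rule ev_sup)
      show "{w. (k \<odot>\<^bsub>?F\<^esub> f) w \<noteq> \<zero>\<^bsub>K\<^esub>} \<subseteq> ?S" using k by (auto simp: fs(6))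
    qed (use f k S in auto)
    also have "\<dots> = (\<Oplus>\<^bsub>A\<^esub>w\<in>?S. k \<odot>\<^bsub>A\<^esub> (f w \<odot>\<^bsub>A\<^esub> ?W w))"
      by (rule A.M.finsum_cong')
        (use S f k co Wcl in \<open>auto simp: fs(6) A.smult_assoc1 subset_iff\<close>)
    also have "\<dots> = k \<odot>\<^bsub>A\<^esub> (\<Oplus>\<^bsub>A\<^esub>w\<in>?S. f w \<odot>\<^bsub>A\<^esub> ?W w)"
      using A.finsum_smult_ldistr[of ?S k "\<lambda>w. f w \<odot>\<^bsub>A\<^esub> ?W w"] S f k co Wcl
      by (auto simp: subset_iff)
    finally show ?thesis by (simp add: free_ev_def)
  qed
  have ev_one: "?ev \<one>\<^bsub>?F\<^esub> = \<one>\<^bsub>A\<^esub>"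
  proof -
    have "{w. \<one>\<^bsub>?F\<^esub> w \<noteq> \<zero>\<^bsub>K\<^esub>} = {[]}" by (auto simp: fs(3))
    then show ?thesis by (simp add: free_ev_def word_ev_def) (simp add: fs(3))
  qed
  have ev_gen_mult: "?ev (free_gen K x \<otimes>\<^bsub>?F\<^esub> f) = \<Gamma> x \<otimes>\<^bsub>A\<^esub> ?ev f"
    if x: "x \<in> X" and f: "f \<in> carrier ?F" for x f
  proof -
    let ?S = "{w. f w \<noteq> \<zero>\<^bsub>K\<^esub>}"
    have v: "(free_gen K x \<otimes>\<^bsub>?F\<^esub> f) w = (case w of [] \<Rightarrow> \<zero>\<^bsub>K\<^esub> | a # u \<Rightarrow> if a = x then f u else \<zero>\<^bsub>K\<^esub>)" for w
      using f co by (simp add: fs(2) K.cauchy_gen_left)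
    have \<Gamma>x: "\<Gamma> x \<in> carrier A" using x \<Gamma> by auto
    have "w \<in> (#) x ` ?S" if "(free_gen K x \<otimes>\<^bsub>?F\<^esub> f) w \<noteq> \<zero>\<^bsub>K\<^esub>" for w
      using that by (cases w) (auto simp: v split: if_splits)
    then have "{w. (free_gen K x \<otimes>\<^bsub>?F\<^esub> f) w \<noteq> \<zero>\<^bsub>K\<^esub>} = (#) x ` ?S"
      by (auto simp: v)
    then have "?ev (free_gen K x \<otimes>\<^bsub>?F\<^esub> f) =
        (\<Oplus>\<^bsub>A\<^esub>w\<in>(#) x ` ?S. (free_gen K x \<otimes>\<^bsub>?F\<^esub> f) w \<odot>\<^bsub>A\<^esub> ?W w)"
      by (simp add: free_ev_def)
    also have "\<dots> = (\<Oplus>\<^bsub>A\<^esub>w\<in>?S. (free_gen K x \<otimes>\<^bsub>?F\<^esub> f) (x # w) \<odot>\<^bsub>A\<^esub> ?W (x # w))"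
      by (rule A.M.finsum_reindex)
        (use x supp[OF f] co[OF f] Wcl in \<open>auto simp: v subset_iff\<close>)
    also have "\<dots> = (\<Oplus>\<^bsub>A\<^esub>w\<in>?S. \<Gamma> x \<otimes>\<^bsub>A\<^esub> (f w \<odot>\<^bsub>A\<^esub> ?W w))"
    proof (rule A.M.finsum_cong')
      show "(\<lambda>w. \<Gamma> x \<otimes>\<^bsub>A\<^esub> (f w \<odot>\<^bsub>A\<^esub> ?W w)) \<in> ?S \<rightarrow> carrier A"
        using \<Gamma>x supp[OF f] co[OF f] Wcl by (auto simp: subset_iff)
      fix w assume "w \<in> ?S"
      then have "?W w \<in> carrier A" using supp(1)[OF f] by (intro Wcl) auto
      then show "(free_gen K x \<otimes>\<^bsub>?F\<^esub> f) (x # w) \<odot>\<^bsub>A\<^esub> ?W (x # w) =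
          \<Gamma> x \<otimes>\<^bsub>A\<^esub> (f w \<odot>\<^bsub>A\<^esub> ?W w)"
        using \<Gamma>x co[OF f] by (simp add: v A.smult_mult_right) (simp add: word_ev_def)
    qed simp
    also have "\<dots> = \<Gamma> x \<otimes>\<^bsub>A\<^esub> ?ev f"
      unfolding free_ev_def
      by (rule A.A.finsum_rdistr[symmetric])
        (use \<Gamma>x supp[OF f] co[OF f] Wcl in \<open>auto simp: subset_iff\<close>)
    finally show ?thesis .
  qed
  show ev_gen: "?ev (free_gen K x) = \<Gamma> x" if "x \<in> X" for x
    using ev_gen_mult[OF that F.one_closed] ev_one funcset_mem[OF \<Gamma> that] K.free_gen_closed[OF that]
    by simp
  let ?M = "{y \<in> carrier ?F. \<forall>f\<in>carrier ?F. ?ev (y \<otimes>\<^bsub>?F\<^esub> f) = ?ev y \<otimes>\<^bsub>A\<^esub> ?ev f}"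
  have "k_subalgebra K ?F ?M"
  proof (rule F.k_subalgebraI, goal_cases)
    case 2 then show ?case using ev_one ev_cl by auto
  next
    case (3 x y) then show ?case by (auto simp: F.A.l_distr A.A.l_distr ev_add ev_cl)
  next
    case (4 x y) then show ?case by (auto simp: F.A.m_assoc A.A.m_assoc ev_cl)
  next
    case (5 k x) then show ?case
      by (auto simp: F.smult_mult_left A.smult_mult_left ev_smult ev_cl)
  qed auto
  moreover have "free_gen K ` X \<subseteq> ?M" using ev_gen_mult ev_gen K.free_gen_closed by auto
  ultimately have M: "?M = carrier ?F" by (rule K.free_algebra_generated)
  show "?ev \<in> kalg_hom K ?F A"
    unfolding kalg_hom_def
  proof (intro CollectI conjI ring_hom_memI ballI)
    fix x y assume x: "x \<in> carrier ?F" and y: "y \<in> carrier ?F"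
    from x have "x \<in> ?M" using M by simp
    with y show "?ev (x \<otimes>\<^bsub>?F\<^esub> y) = ?ev x \<otimes>\<^bsub>A\<^esub> ?ev y" by auto
  qed (use ev_cl ev_add ev_smult ev_one in auto)
qed

section \<open>The grading of the free algebra by the group\<close>

text \<open>
  A word has as degree the product of its letters in the group.
\<close>
definition degree_part ::
    "('g, 'm) monoid_scheme \<Rightarrow> ('k, 'n) ring_scheme \<Rightarrow> 'g \<Rightarrow> ('g list \<Rightarrow> 'k) \<Rightarrow> 'g list \<Rightarrow> 'k"
  where "degree_part G K s f = (\<lambda>w. if word_ev G id w = s then f w else \<zero>\<^bsub>K\<^esub>)"

context
  fixes G :: "('g, 'm) monoid_scheme" and K :: "('k, 'n) ring_scheme"
  assumes G: "group G" and K: "field K"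
begin

interpretation G: group G by (rule G)
interpretation K: field K by (rule K)
interpretation F: kalgebra K "free_algebra K (carrier G)" by (rule K.free_algebra_kalgebra)

private abbreviation (input) "F \<equiv> free_algebra K (carrier G)"
private abbreviation (input) "dp \<equiv> degree_part G K"

lemma degree_part_closed: "f \<in> carrier F \<Longrightarrow> dp s f \<in> carrier F"
  by (auto simp: free_algebra_simps degree_part_def elim: rev_finite_subset)

lemma degree_part_add:
  "\<lbrakk>f \<in> carrier F; g \<in> carrier F\<rbrakk> \<Longrightarrow> dp s (f \<oplus>\<^bsub>F\<^esub> g) = dp s f \<oplus>\<^bsub>F\<^esub> dp s g"
  by (auto simp: free_algebra_simps degree_part_def)

lemma degree_part_smult:
  "\<lbrakk>k \<in> carrier K; f \<in> carrier F\<rbrakk> \<Longrightarrow> dp s (k \<odot>\<^bsub>F\<^esub> f) = k \<odot>\<^bsub>F\<^esub> dp s f"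
  by (auto simp: free_algebra_simps degree_part_def)

lemma degree_part_zero: "dp s \<zero>\<^bsub>F\<^esub> = \<zero>\<^bsub>F\<^esub>"
  by (auto simp: free_algebra_simps degree_part_def)

lemma degree_part_one: "dp s \<one>\<^bsub>F\<^esub> = (if s = \<one>\<^bsub>G\<^esub> then \<one>\<^bsub>F\<^esub> else \<zero>\<^bsub>F\<^esub>)"
  by (auto simp: free_algebra_simps degree_part_def word_ev_def)

lemma degree_part_gen_left:
  assumes g: "g \<in> carrier G" and s: "s \<in> carrier G" and f: "f \<in> carrier F"
  shows "dp s (free_gen K g \<otimes>\<^bsub>F\<^esub> f) = free_gen K g \<otimes>\<^bsub>F\<^esub> dp (inv\<^bsub>G\<^esub> g \<otimes>\<^bsub>G\<^esub> s) f"
proof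
  fix w
  have fam: "\<forall>w. f w \<in> carrier K" "\<forall>w. dp (inv\<^bsub>G\<^esub> g \<otimes>\<^bsub>G\<^esub> s) f w \<in> carrier K"
    using f by (auto simp: free_algebra_simps degree_part_def)
  show "dp s (free_gen K g \<otimes>\<^bsub>F\<^esub> f) w = (free_gen K g \<otimes>\<^bsub>F\<^esub> dp (inv\<^bsub>G\<^esub> g \<otimes>\<^bsub>G\<^esub> s) f) w"
  proof (cases w)
    case Nil then show ?thesis using fam
      by (simp add: free_algebra_simps(2) degree_part_def K.cauchy_gen_left)
  next
    case (Cons a u)
    show ?thesis
    proof (cases "u \<in> lists (carrier G)")
      case True
      then have "word_ev G id u \<in> carrier G" by (intro G.word_ev_closed) auto
      then have "(word_ev G id (g # u) = s) = (word_ev G id u = inv\<^bsub>G\<^esub> g \<otimes>\<^bsub>G\<^esub> s)"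
        using g s by (auto simp: word_ev_def G.m_assoc[symmetric])
      then show ?thesis using fam Cons
        by (auto simp: free_algebra_simps(2) degree_part_def K.cauchy_gen_left)
    next
      case False
      then have "f u = \<zero>\<^bsub>K\<^esub>" using f by (auto simp: free_algebra_simps(1))
      then show ?thesis using fam Cons
        by (simp add: free_algebra_simps(2) degree_part_def K.cauchy_gen_left)
    qed
  qed
qed

lemma degree_part_gen_right:
  assumes g: "g \<in> carrier G" and s: "s \<in> carrier G" and f: "f \<in> carrier F"
  shows "dp s (f \<otimes>\<^bsub>F\<^esub> free_gen K g) = dp (s \<otimes>\<^bsub>G\<^esub> inv\<^bsub>G\<^esub> g) f \<otimes>\<^bsub>F\<^esub> free_gen K g"
proof
  fix w
  have fam: "\<forall>w. f w \<in> carrier K" "\<forall>w. dp (s \<otimes>\<^bsub>G\<^esub> inv\<^bsub>G\<^esub> g) f w \<in> carrier K"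
    using f by (auto simp: free_algebra_simps degree_part_def)
  show "dp s (f \<otimes>\<^bsub>F\<^esub> free_gen K g) w = (dp (s \<otimes>\<^bsub>G\<^esub> inv\<^bsub>G\<^esub> g) f \<otimes>\<^bsub>F\<^esub> free_gen K g) w"
  proof (cases w rule: rev_cases)
    case Nil then show ?thesis using fam
      by (simp add: free_algebra_simps(2) degree_part_def K.cauchy_gen_right)
  next
    case (snoc u a)
    show ?thesis
    proof (cases "u \<in> lists (carrier G)")
      case True
      then have u: "word_ev G id u \<in> carrier G" by (intro G.word_ev_closed) auto
      have "word_ev G id (u @ [g]) = word_ev G id u \<otimes>\<^bsub>G\<^esub> g"
        using True g by (subst G.word_ev_append[where X = "carrier G"]) (auto simp: word_ev_def)
      then have "(word_ev G id (u @ [g]) = s) = (word_ev G id u = s \<otimes>\<^bsub>G\<^esub> inv\<^bsub>G\<^esub> g)"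
        using g s u by (auto simp: G.m_assoc)
      then show ?thesis using fam snoc
        by (auto simp: free_algebra_simps(2) degree_part_def K.cauchy_gen_right)
    next
      case False
      then have "f u = \<zero>\<^bsub>K\<^esub>" using f by (auto simp: free_algebra_simps(1))
      then show ?thesis using fam snoc
        by (simp add: free_algebra_simps(2) degree_part_def K.cauchy_gen_right)
    qed
  qed
qed

definition homogeneous :: "'g \<Rightarrow> ('g list \<Rightarrow> 'k) \<Rightarrow> bool"
  where "homogeneous d f \<longleftrightarrow>
    f \<in> carrier F \<and> (\<forall>s\<in>carrier G. dp s f = (if s = d then f else \<zero>\<^bsub>F\<^esub>))"

lemma homogeneous_one: "homogeneous \<one>\<^bsub>G\<^esub> \<one>\<^bsub>F\<^esub>"
  by (simp add: homogeneous_def degree_part_one)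

lemma homogeneous_gen_right:
  assumes "homogeneous d f" "g \<in> carrier G" "d \<in> carrier G"
  shows "homogeneous (d \<otimes>\<^bsub>G\<^esub> g) (f \<otimes>\<^bsub>F\<^esub> free_gen K g)"
proof -
  have "(s \<otimes>\<^bsub>G\<^esub> inv\<^bsub>G\<^esub> g = d) = (s = d \<otimes>\<^bsub>G\<^esub> g)" if "s \<in> carrier G" for s
    using assms that by (auto simp: G.m_assoc)
  then show ?thesis using assms
    by (auto simp: homogeneous_def degree_part_gen_right K.free_gen_closed)
qed

lemma homogeneous_gen: "g \<in> carrier G \<Longrightarrow> homogeneous g (free_gen K g)"
  using homogeneous_gen_right[OF homogeneous_one, of g] by (simp add: K.free_gen_closed)

lemma homogeneous_minus:
  assumes "homogeneous d f" "homogeneous d f'"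
  shows "homogeneous d (f \<ominus>\<^bsub>F\<^esub> f')"
proof -
  have m: "x \<ominus>\<^bsub>F\<^esub> y = x \<oplus>\<^bsub>F\<^esub> (\<ominus>\<^bsub>K\<^esub> \<one>\<^bsub>K\<^esub>) \<odot>\<^bsub>F\<^esub> y" if "y \<in> carrier F" for x y
    using that by (simp add: a_minus_def F.a_inv_eq_smult)
  show ?thesis using assms
    by (auto simp: homogeneous_def m degree_part_add degree_part_smult)
qed

lemma homogeneous_smult:
  "\<lbrakk>homogeneous d f; k \<in> carrier K\<rbrakk> \<Longrightarrow> homogeneous d (k \<odot>\<^bsub>F\<^esub> f)"
  by (auto simp: homogeneous_def degree_part_smult)

text \<open>
  An ideal generated by homogeneous elements is graded.  The elements all of whose
  components lie in the ideal form an ideal \<open>J\<close>: multiplication by a generator only shifts the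
  components, and the elements by which \<open>J\<close> can be multiplied form a subalgebra.
\<close>

lemma homogeneous_ideal:
  assumes S: "S \<subseteq> carrier F" and hom: "\<And>f. f \<in> S \<Longrightarrow> \<exists>d. homogeneous d f"
    and f: "f \<in> Idl\<^bsub>F\<^esub> S" and s: "s \<in> carrier G"
  shows "dp s f \<in> Idl\<^bsub>F\<^esub> S"
proof -
  let ?I = "Idl\<^bsub>F\<^esub> S"
  interpret I: ideal ?I F by (rule F.A.genideal_ideal[OF S])
  define J where "J = {f \<in> ?I. \<forall>s\<in>carrier G. dp s f \<in> ?I}"
  have JI: "J \<subseteq> ?I" by (auto simp: J_def)
  have JF: "J \<subseteq> carrier F" using JI I.a_subset by auto
  have Ja: "x \<oplus>\<^bsub>F\<^esub> y \<in> J" if "x \<in> J" "y \<in> J" for x y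
    using that JF by (auto simp: J_def degree_part_add subset_iff)
  have Js: "k \<odot>\<^bsub>F\<^esub> x \<in> J" if "k \<in> carrier K" "x \<in> J" for k x
  proof -
    note I_smult = F.ideal_smult_closed[OF I.is_ideal that(1)]
    show ?thesis using that JF I_smult by (auto simp: J_def degree_part_smult subset_iff)
  qed
  have J0: "\<zero>\<^bsub>F\<^esub> \<in> J" by (simp add: J_def degree_part_zero)
  have sg: "subgroup J (add_monoid F)"
  proof (rule F.add.subgroupI)
    fix x assume x: "x \<in> J"
    then show "\<ominus>\<^bsub>F\<^esub> x \<in> J"
      using F.a_inv_eq_smult[of x] JF Js[OF _ x, of "\<ominus>\<^bsub>K\<^esub> \<one>\<^bsub>K\<^esub>"] by auto
  qed (use JF J0 Ja in auto)
  let ?L = "{y \<in> carrier F. \<forall>f\<in>J. y \<otimes>\<^bsub>F\<^esub> f \<in> J}"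
  have L: "k_subalgebra K F ?L"
  proof (rule F.k_subalgebraI, goal_cases)
    case 2 then show ?case using JF by auto
  next
    case (3 x y) then show ?case using JF Ja by (auto simp: F.A.l_distr subset_iff)
  next
    case (4 x y) then show ?case using JF by (auto simp: F.A.m_assoc subset_iff)
  next
    case (5 k x) then show ?case using JF Js by (auto simp: F.smult_mult_left subset_iff)
  qed auto
  have "free_gen K ` carrier G \<subseteq> ?L"
    using JF by (auto simp: J_def degree_part_gen_left K.free_gen_closed I.I_l_closed subset_iff)
  with L have L': "?L = carrier F" by (rule K.free_algebra_generated)
  let ?R = "{y \<in> carrier F. \<forall>f\<in>J. f \<otimes>\<^bsub>F\<^esub> y \<in> J}"
  have R: "k_subalgebra K F ?R"
  proof (rule F.k_subalgebraI, goal_cases)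
    case 2 then show ?case using JF by auto
  next
    case (3 x y) then show ?case using JF Ja by (auto simp: F.A.r_distr subset_iff)
  next
    case (4 x y) then show ?case using JF by (auto simp: F.A.m_assoc[symmetric] subset_iff)
  next
    case (5 k x) then show ?case using JF Js by (auto simp: F.smult_mult_right subset_iff)
  qed auto
  have "free_gen K ` carrier G \<subseteq> ?R"
    using JF by (auto simp: J_def degree_part_gen_right K.free_gen_closed I.I_r_closed subset_iff)
  with R have R': "?R = carrier F" by (rule K.free_algebra_generated)
  have "ideal J F"
    by (rule idealI[OF F.ring_axioms sg]) (use L' R' in blast)+
  moreover have "S \<subseteq> J"
  proof
    fix f assume f: "f \<in> S"
    obtain d where d: "homogeneous d f" using hom[OF f] by auto
    have "f \<in> ?I" using F.A.genideal_self[OF S] f by auto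
    then show "f \<in> J" using d by (auto simp: J_def homogeneous_def)
  qed
  ultimately have "?I \<subseteq> J" by (rule F.A.genideal_minimal)
  then show ?thesis using f s by (auto simp: J_def)
qed

end

section \<open>The twisted partial group algebra\<close>

lemma alg_quot_simps:
  "carrier (alg_quot A I) = a_rcosets\<^bsub>A\<^esub> I"
  "mult (alg_quot A I) = rcoset_mult A I"
  "one (alg_quot A I) = I +>\<^bsub>A\<^esub> \<one>\<^bsub>A\<^esub>"
  "zero (alg_quot A I) = I"
  "add (alg_quot A I) = set_add A"
  "smult (alg_quot A I) = (\<lambda>k X. \<Union>x\<in>X. I +>\<^bsub>A\<^esub> (k \<odot>\<^bsub>A\<^esub> x))"
  by (simp_all add: alg_quot_def FactRing_def ring.defs module.defs)

context
  fixes K :: "('k, 'n) ring_scheme" and A :: "('k, 'a) module" and I :: "'a set"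
  assumes A: "kalgebra K A" and I: "ideal I A"
begin

interpretation A: kalgebra K A by (rule A)
interpretation I: ideal I A by (rule I)

lemma coset_eq_iff:
  "\<lbrakk>x \<in> carrier A; y \<in> carrier A\<rbrakk> \<Longrightarrow> I +>\<^bsub>A\<^esub> x = I +>\<^bsub>A\<^esub> y \<longleftrightarrow> x \<ominus>\<^bsub>A\<^esub> y \<in> I"
  by (rule A.A.quotient_eq_iff_same_a_r_cos[OF I, symmetric])

lemma coset_smult:
  assumes k: "k \<in> carrier K" and x: "x \<in> carrier A"
  shows "k \<odot>\<^bsub>alg_quot A I\<^esub> (I +>\<^bsub>A\<^esub> x) = I +>\<^bsub>A\<^esub> (k \<odot>\<^bsub>A\<^esub> x)"
proof -
  have "I +>\<^bsub>A\<^esub> (k \<odot>\<^bsub>A\<^esub> y) = I +>\<^bsub>A\<^esub> (k \<odot>\<^bsub>A\<^esub> x)" if y: "y \<in> I +>\<^bsub>A\<^esub> x" for y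
  proof -
    obtain i where i: "i \<in> I" "y = i \<oplus>\<^bsub>A\<^esub> x" using y by (auto simp: a_r_coset_def r_coset_def)
    have iA: "i \<in> carrier A" using i I.Icarr by auto
    have "k \<odot>\<^bsub>A\<^esub> y \<ominus>\<^bsub>A\<^esub> k \<odot>\<^bsub>A\<^esub> x = k \<odot>\<^bsub>A\<^esub> i"
      using i iA k x by (simp add: A.smult_r_distr a_minus_def A.M.a_assoc A.M.r_neg)
    then show ?thesis using A.ideal_smult_closed[OF I k i(1)] iA i k x by (simp add: coset_eq_iff)
  qed
  moreover have "x \<in> I +>\<^bsub>A\<^esub> x" by (rule I.a_rcos_self[OF x])
  ultimately show ?thesis unfolding alg_quot_simps by blast
qed

lemma coset_mult:
  "\<lbrakk>x \<in> carrier A; y \<in> carrier A\<rbrakk> \<Longrightarrow>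
    (I +>\<^bsub>A\<^esub> x) \<otimes>\<^bsub>alg_quot A I\<^esub> (I +>\<^bsub>A\<^esub> y) = I +>\<^bsub>A\<^esub> (x \<otimes>\<^bsub>A\<^esub> y)"
  by (simp add: alg_quot_simps I.rcoset_mult_add)

lemma coset_add:
  "\<lbrakk>x \<in> carrier A; y \<in> carrier A\<rbrakk> \<Longrightarrow>
    (I +>\<^bsub>A\<^esub> x) \<oplus>\<^bsub>alg_quot A I\<^esub> (I +>\<^bsub>A\<^esub> y) = I +>\<^bsub>A\<^esub> (x \<oplus>\<^bsub>A\<^esub> y)"
  by (simp add: alg_quot_simps I.a_rcos_sum)

lemma coset_zero: "I +>\<^bsub>A\<^esub> \<zero>\<^bsub>A\<^esub> = \<zero>\<^bsub>alg_quot A I\<^esub>"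
  by (simp add: alg_quot_simps I.a_rcos_const)

lemma coset_zero_iff: "x \<in> carrier A \<Longrightarrow> I +>\<^bsub>A\<^esub> x = \<zero>\<^bsub>alg_quot A I\<^esub> \<longleftrightarrow> x \<in> I"
  using coset_eq_iff[of x "\<zero>\<^bsub>A\<^esub>"] by (simp add: coset_zero a_minus_def)

lemma coset_surj: "(+>\<^bsub>A\<^esub>) I ` carrier A = carrier (alg_quot A I)"
  by (auto simp: alg_quot_simps A_RCOSETS_def RCOSETS_def a_r_coset_def)

lemma alg_quot_kalgebra:
  assumes "\<one>\<^bsub>A\<^esub> \<notin> I"
  shows "kalgebra K (alg_quot A I)" and "(+>\<^bsub>A\<^esub>) I \<in> kalg_hom K A (alg_quot A I)"
proof -
  show "kalgebra K (alg_quot A I)"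
  proof (rule kalgebra_surj_image[OF A coset_surj])
    show "\<one>\<^bsub>alg_quot A I\<^esub> \<noteq> \<zero>\<^bsub>alg_quot A I\<^esub>"
      using assms coset_zero_iff[of "\<one>\<^bsub>A\<^esub>"] by (simp add: alg_quot_simps(3))
  qed (simp_all add: coset_mult coset_add coset_smult coset_zero alg_quot_simps(3))
  show "(+>\<^bsub>A\<^esub>) I \<in> kalg_hom K A (alg_quot A I)"
    unfolding kalg_hom_def using coset_surj
    by (auto intro!: ring_hom_memI simp: coset_mult coset_add coset_smult alg_quot_simps(3))
qed

end

lemma ball_par_relators:
  fixes G (structure) and K (structure)
  defines "F \<equiv> free_algebra K (carrier G)" and "x \<equiv> free_gen K"
  shows "(\<forall>r\<in>par_relators G K \<sigma>. P r) \<longleftrightarrow>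
    (\<forall>g\<in>carrier G. \<forall>h\<in>carrier G.
      (\<sigma> g h = \<zero>\<^bsub>K\<^esub> \<longrightarrow> P (x (inv\<^bsub>G\<^esub> g) \<otimes>\<^bsub>F\<^esub> x (g \<otimes>\<^bsub>G\<^esub> h)) \<and> P (x (g \<otimes>\<^bsub>G\<^esub> h) \<otimes>\<^bsub>F\<^esub> x (inv\<^bsub>G\<^esub> h))) \<and>
      P (x (inv\<^bsub>G\<^esub> g) \<otimes>\<^bsub>F\<^esub> x g \<otimes>\<^bsub>F\<^esub> x h \<ominus>\<^bsub>F\<^esub>
         \<sigma> g h \<odot>\<^bsub>F\<^esub> (x (inv\<^bsub>G\<^esub> g) \<otimes>\<^bsub>F\<^esub> x (g \<otimes>\<^bsub>G\<^esub> h))) \<and>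
      P (x g \<otimes>\<^bsub>F\<^esub> x h \<otimes>\<^bsub>F\<^esub> x (inv\<^bsub>G\<^esub> h) \<ominus>\<^bsub>F\<^esub>
         \<sigma> g h \<odot>\<^bsub>F\<^esub> (x (g \<otimes>\<^bsub>G\<^esub> h) \<otimes>\<^bsub>F\<^esub> x (inv\<^bsub>G\<^esub> h)))) \<and>
    (\<forall>g\<in>carrier G. P (x g \<otimes>\<^bsub>F\<^esub> x \<one>\<^bsub>G\<^esub> \<ominus>\<^bsub>F\<^esub> x g) \<and> P (x \<one>\<^bsub>G\<^esub> \<otimes>\<^bsub>F\<^esub> x g \<ominus>\<^bsub>F\<^esub> x g)) \<and>
    P (x \<one>\<^bsub>G\<^esub> \<ominus>\<^bsub>F\<^esub> \<one>\<^bsub>F\<^esub>)"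
proof -
  have 1: "(\<forall>r\<in>{f g h | g h. g \<in> carrier G \<and> h \<in> carrier G \<and> Q g h}. P r) \<longleftrightarrow>
      (\<forall>g\<in>carrier G. \<forall>h\<in>carrier G. Q g h \<longrightarrow> P (f g h))" for f Q by blast
  have 2: "(\<forall>r\<in>{f g h | g h. g \<in> carrier G \<and> h \<in> carrier G}. P r) \<longleftrightarrow>
      (\<forall>g\<in>carrier G. \<forall>h\<in>carrier G. P (f g h))" for f by blast
  have 3: "(\<forall>r\<in>{f g | g. g \<in> carrier G}. P r) \<longleftrightarrow> (\<forall>g\<in>carrier G. P (f g))" for f by blast
  show ?thesis
    unfolding par_relators_def Let_def ball_Un 1 2 3 F_def x_def by (auto simp only: ball_simps)
qed

text \<open>
  The relators are the differences of the two sides of the axioms of a partial projective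
  representation.  Read for the quotient map, this makes \<open>g \<mapsto> [g]\<close> such a representation; read
  for an evaluation map, it makes every such representation factor through the quotient.
\<close>

lemma par_relators_killed_iff:
  fixes B :: "('k, 'b) module"
  assumes G: "group G" and K: "field K" and B: "kalgebra K B"
    and \<sigma>: "\<And>g h. \<lbrakk>g \<in> carrier G; h \<in> carrier G\<rbrakk> \<Longrightarrow> \<sigma> g h \<in> carrier K"
    and f: "f \<in> kalg_hom K (free_algebra K (carrier G)) B"
  shows "(\<forall>r\<in>par_relators G K \<sigma>. f r = \<zero>\<^bsub>B\<^esub>) \<longleftrightarrow> partial_proj_rep G K B (\<lambda>g. f (free_gen K g)) \<sigma>"
proof -
  interpret G: group G by (rule G)
  interpret K: field K by (rule K)
  let ?F = "free_algebra K (carrier G)"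
  interpret F: kalgebra K ?F by (rule K.free_algebra_kalgebra)
  interpret B: kalgebra K B by (rule B)
  note gc = K.free_gen_closed[where X = "carrier G"]
  note h = kalg_homD[OF f]
  have fg: "f (free_gen K g) \<in> carrier B" if "g \<in> carrier G" for g
    using h(1)[OF gc[OF that]] .
  have sub: "f (x \<ominus>\<^bsub>?F\<^esub> y) = \<zero>\<^bsub>B\<^esub> \<longleftrightarrow> f x = f y"
    if "x \<in> carrier ?F" "y \<in> carrier ?F" for x y
    by (rule hom_minus_eq_zero_iff[OF F.kalgebra_axioms B f that])
  show ?thesis
    unfolding ball_par_relators partial_proj_rep_def
    by (auto simp: sub h gc \<sigma> fg)
qed

context
  fixes G :: "('g, 'm) monoid_scheme" and K :: "('k, 'n) ring_scheme" and \<sigma> :: "'g \<Rightarrow> 'g \<Rightarrow> 'k"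
  assumes G: "group G" and K: "field K"
    and \<sigma>: "\<And>g h. \<lbrakk>g \<in> carrier G; h \<in> carrier G\<rbrakk> \<Longrightarrow> \<sigma> g h \<in> carrier K"
begin

interpretation G: group G by (rule G)
interpretation K: field K by (rule K)
interpretation F: kalgebra K "free_algebra K (carrier G)" by (rule K.free_algebra_kalgebra)

lemma par_relators_homogeneous:
  assumes "r \<in> par_relators G K \<sigma>"
  shows "\<exists>d. homogeneous G K d r"
proof -
  let ?F = "free_algebra K (carrier G)" and ?x = "free_gen K"
  note hg = homogeneous_gen[OF G K] and hr = homogeneous_gen_right[OF G K]
    and hm = homogeneous_minus[OF G K] and hs = homogeneous_smult[OF G K]
    and h1 = homogeneous_one[OF G K]
  have two: "homogeneous G K d (?x a \<otimes>\<^bsub>?F\<^esub> ?x b)"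
    if "a \<in> carrier G" "b \<in> carrier G" "a \<otimes>\<^bsub>G\<^esub> b = d" for a b d
    using hr[OF hg, of a b] that by simp
  have three: "homogeneous G K d (?x a \<otimes>\<^bsub>?F\<^esub> ?x b \<otimes>\<^bsub>?F\<^esub> ?x c)"
    if "a \<in> carrier G" "b \<in> carrier G" "c \<in> carrier G" "a \<otimes>\<^bsub>G\<^esub> b \<otimes>\<^bsub>G\<^esub> c = d" for a b c d
    using hr[OF two[OF _ _ refl], of a b c] that by simp
  have "\<forall>r\<in>par_relators G K \<sigma>. \<exists>d. homogeneous G K d r"
    unfolding ball_par_relators
  proof (intro conjI ballI impI, goal_cases)
    case (1 g h) then show ?case using two[OF _ _ refl, of "inv\<^bsub>G\<^esub> g" "g \<otimes>\<^bsub>G\<^esub> h"] by auto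
  next
    case (2 g h) then show ?case using two[OF _ _ refl, of "g \<otimes>\<^bsub>G\<^esub> h" "inv\<^bsub>G\<^esub> h"] by auto
  next
    case (3 g h)
    show ?case
      by (rule exI, rule hm[OF three[OF _ _ _ refl] hs[OF two]])
        (use 3 in \<open>auto simp: G.m_assoc[symmetric] \<sigma>\<close>)
  next
    case (4 g h)
    show ?case
      by (rule exI, rule hm[OF three[OF _ _ _ refl] hs[OF two]])
        (use 4 in \<open>auto simp: G.m_assoc[symmetric] \<sigma>\<close>)
  next
    case (5 g)
    then have "homogeneous G K g (?x g \<otimes>\<^bsub>?F\<^esub> ?x \<one>\<^bsub>G\<^esub> \<ominus>\<^bsub>?F\<^esub> ?x g)" by (intro hm two hg) auto
    then show ?case by blast
  next
    case (6 g)
    then have "homogeneous G K g (?x \<one>\<^bsub>G\<^esub> \<otimes>\<^bsub>?F\<^esub> ?x g \<ominus>\<^bsub>?F\<^esub> ?x g)" by (intro hm two hg) auto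
    then show ?case by blast
  next
    case 7 show ?case using hm[OF hg h1] by blast
  qed
  then show ?thesis using assms by blast
qed

lemma par_relators_closed: "par_relators G K \<sigma> \<subseteq> carrier (free_algebra K (carrier G))"
  using par_relators_homogeneous by (auto simp: homogeneous_def[OF G K])

lemma par_ideal_ideal: "ideal (par_ideal G K \<sigma>) (free_algebra K (carrier G))"
  unfolding par_ideal_def by (rule F.A.genideal_ideal[OF par_relators_closed])

lemma par_ideal_degree_part:
  "\<lbrakk>f \<in> par_ideal G K \<sigma>; s \<in> carrier G\<rbrakk> \<Longrightarrow> degree_part G K s f \<in> par_ideal G K \<sigma>"
  unfolding par_ideal_def
  by (rule homogeneous_ideal[OF G K par_relators_closed par_relators_homogeneous])

lemma par_ideal_killed:
  fixes B :: "('k, 'b) module"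
  assumes B: "kalgebra K B" and rep: "partial_proj_rep G K B \<Gamma> \<sigma>"
    and f: "f \<in> par_ideal G K \<sigma>"
  shows "free_ev K B \<Gamma> f = \<zero>\<^bsub>B\<^esub>"
proof -
  interpret B: kalgebra K B by (rule B)
  let ?F = "free_algebra K (carrier G)"
  have \<Gamma>: "\<Gamma> \<in> carrier G \<rightarrow> carrier B" using rep by (simp add: partial_proj_rep_def)
  note ev = free_ev_hom[OF K B \<Gamma>]
  interpret e: ring_hom_ring ?F B "free_ev K B \<Gamma>"
    using ev(1) by (intro ring_hom_ringI2) (auto simp: kalg_hom_def F.A.ring_axioms B.A.ring_axioms)
  have "partial_proj_rep G K B (\<lambda>g. free_ev K B \<Gamma> (free_gen K g)) \<sigma>"
    using rep by (simp add: partial_proj_rep_def ev(2) Pi_iff)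
  then have "\<forall>r\<in>par_relators G K \<sigma>. free_ev K B \<Gamma> r = \<zero>\<^bsub>B\<^esub>"
    using par_relators_killed_iff[OF G K B \<sigma> ev(1)] by simp
  then have "par_relators G K \<sigma> \<subseteq> a_kernel ?F B (free_ev K B \<Gamma>)"
    using par_relators_closed unfolding a_kernel_def' by blast
  then have "par_ideal G K \<sigma> \<subseteq> a_kernel ?F B (free_ev K B \<Gamma>)"
    unfolding par_ideal_def by (rule F.A.genideal_minimal[OF e.kernel_is_ideal])
  then show ?thesis using f unfolding a_kernel_def' by blast
qed

end

section \<open>The partial action of a factor set\<close>

text \<open>
  The partial action and the twist are computed from a partial projective representation with
  factor set \<open>\<sigma>\<close>; it will be \<open>g \<mapsto> [g]\<close> in the twisted partial group algebra.
\<close>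

locale partial_factor_rep = G: group G + K: field K + kalgebra K P
  for G :: "('g, 'm) monoid_scheme" (structure) and K :: "('k, 'n) ring_scheme" (structure)
    and P :: "('k, 'a) module" (structure) +
  fixes \<Gamma> :: "'g \<Rightarrow> 'a" and \<sigma> :: "'g \<Rightarrow> 'g \<Rightarrow> 'k"
  assumes rep: "partial_proj_rep G K P \<Gamma> \<sigma>"
    and mult_zero: "\<lbrakk>g \<in> carrier G; h \<in> carrier G; \<Gamma> g \<otimes>\<^bsub>P\<^esub> \<Gamma> h = \<zero>\<^bsub>P\<^esub>\<rbrakk> \<Longrightarrow> \<sigma> g h = \<zero>\<^bsub>K\<^esub>"
begin

abbreviation times (infixl "\<bullet>" 70) where "x \<bullet> y \<equiv> x \<otimes>\<^bsub>P\<^esub> y"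

lemma gen_closed [simp]: "g \<in> carrier G \<Longrightarrow> \<Gamma> g \<in> carrier P"
  and sigma_closed [simp]: "\<lbrakk>g \<in> carrier G; h \<in> carrier G\<rbrakk> \<Longrightarrow> \<sigma> g h \<in> carrier K"
  and gen_one: "\<Gamma> \<one> = \<one>\<^bsub>P\<^esub>"
  and sigma_zero: "\<lbrakk>g \<in> carrier G; h \<in> carrier G; \<sigma> g h = \<zero>\<^bsub>K\<^esub>\<rbrakk> \<Longrightarrow>
        \<Gamma> (inv g) \<bullet> \<Gamma> (g \<otimes> h) = \<zero>\<^bsub>P\<^esub> \<and> \<Gamma> (g \<otimes> h) \<bullet> \<Gamma> (inv h) = \<zero>\<^bsub>P\<^esub>"
  and rep_left: "\<lbrakk>g \<in> carrier G; h \<in> carrier G\<rbrakk> \<Longrightarrow>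
        \<Gamma> (inv g) \<bullet> \<Gamma> g \<bullet> \<Gamma> h = \<sigma> g h \<odot>\<^bsub>P\<^esub> (\<Gamma> (inv g) \<bullet> \<Gamma> (g \<otimes> h))"
  and rep_right: "\<lbrakk>g \<in> carrier G; h \<in> carrier G\<rbrakk> \<Longrightarrow>
        \<Gamma> g \<bullet> \<Gamma> h \<bullet> \<Gamma> (inv h) = \<sigma> g h \<odot>\<^bsub>P\<^esub> (\<Gamma> (g \<otimes> h) \<bullet> \<Gamma> (inv h))"
  using rep by (auto simp: partial_proj_rep_def)

lemma gen_zero:
  assumes "g \<in> carrier G" "\<sigma> g (inv g) = \<zero>\<^bsub>K\<^esub>"
  shows "\<Gamma> g = \<zero>\<^bsub>P\<^esub>" "\<Gamma> (inv g) = \<zero>\<^bsub>P\<^esub>"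
  using sigma_zero[of g "inv g"] assms by (simp_all add: gen_one)

lemma gen_inv_gen:
  "g \<in> carrier G \<Longrightarrow> \<Gamma> g \<bullet> \<Gamma> (inv g) \<bullet> \<Gamma> g = \<sigma> g (inv g) \<odot>\<^bsub>P\<^esub> \<Gamma> g"
  using rep_right[of g "inv g"] by (simp add: gen_one)

lemma smult_right_cancel:
  assumes "a \<in> carrier K" "b \<in> carrier K" "x \<in> carrier P" "x \<noteq> \<zero>\<^bsub>P\<^esub>"
    and eq: "a \<odot>\<^bsub>P\<^esub> x = b \<odot>\<^bsub>P\<^esub> x"
  shows "a = b"
proof (rule ccontr)
  assume "a \<noteq> b"
  let ?d = "a \<ominus>\<^bsub>K\<^esub> b"
  have "?d \<noteq> \<zero>\<^bsub>K\<^esub>" using \<open>a \<noteq> b\<close> assms by (simp add: K.r_right_minus_eq)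
  then have u: "?d \<in> Units K" using assms by (simp add: K.field_Units)
  have "?d \<odot>\<^bsub>P\<^esub> x = \<zero>\<^bsub>P\<^esub>"
    using assms by (simp add: a_minus_def smult_l_distr smult_l_minus M.r_neg)
  moreover have "x = inv\<^bsub>K\<^esub> ?d \<odot>\<^bsub>P\<^esub> (?d \<odot>\<^bsub>P\<^esub> x)"
    using u assms by (simp add: smult_assoc1[symmetric])
  ultimately show False using u assms by simp
qed

text \<open>
  Both values occur as coefficients of \<open>\<Gamma>(g\<inverse>)\<close> in \<open>\<Gamma>(g\<inverse>) \<Gamma>(g) \<Gamma>(g\<inverse>)\<close>, computed by the left and by
  the right axiom.  If \<open>\<Gamma>(g\<inverse>) = 0\<close>, then both vanish because \<open>\<sigma>\<close> is a factor set.
\<close>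

lemma sigma_inv_sym:
  assumes g: "g \<in> carrier G"
  shows "\<sigma> (inv g) g = \<sigma> g (inv g)"
proof (cases "\<Gamma> (inv g) = \<zero>\<^bsub>P\<^esub>")
  case True
  then have "\<Gamma> g \<bullet> \<Gamma> (inv g) = \<zero>\<^bsub>P\<^esub>" "\<Gamma> (inv g) \<bullet> \<Gamma> g = \<zero>\<^bsub>P\<^esub>" using g by simp_all
  then show ?thesis using mult_zero[of g "inv g"] mult_zero[of "inv g" g] g by simp
next
  case False
  have "\<sigma> (inv g) g \<odot>\<^bsub>P\<^esub> \<Gamma> (inv g) = \<sigma> g (inv g) \<odot>\<^bsub>P\<^esub> \<Gamma> (inv g)"
    using rep_left[of g "inv g"] gen_inv_gen[of "inv g"] g by (simp add: gen_one)
  then show ?thesis using False g by (intro smult_right_cancel[of _ _ "\<Gamma> (inv g)"]) simp_all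
qed

text \<open>
  The value \<open>0\<close> at \<open>\<sigma>(g, g\<inverse>) = 0\<close> does no harm because \<open>\<Gamma>(g)\<close> and \<open>\<Gamma>(g\<inverse>)\<close> vanish there
  (lemma \<open>gen_zero\<close>); it lets the rules for \<open>star\<close> and \<open>e\<close> hold without case distinctions.
\<close>

definition coef :: "'g \<Rightarrow> 'k"
  where "coef g = (if \<sigma> g (inv g) = \<zero>\<^bsub>K\<^esub> then \<zero>\<^bsub>K\<^esub> else inv\<^bsub>K\<^esub> (\<sigma> g (inv g)))"

text \<open>
  The quasi-inverse of \<open>\<Gamma>(g)\<close>, in the sense of inverse semigroups:
  \<open>\<Gamma>(g) star(g) \<Gamma>(g) = \<Gamma>(g)\<close>, with \<open>\<Gamma>(g) star(g)\<close> and \<open>star(g) \<Gamma>(g)\<close> among the commuting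
  idempotents.
\<close>

definition star :: "'g \<Rightarrow> 'a"
  where "star g = coef g \<odot>\<^bsub>P\<^esub> \<Gamma> (inv g)"

definition e :: "'g \<Rightarrow> 'a"
  where "e g = \<Gamma> g \<bullet> star g"

lemma coef_closed [simp]: "g \<in> carrier G \<Longrightarrow> coef g \<in> carrier K"
  by (auto simp: coef_def K.field_Units)

lemma star_closed [simp]: "g \<in> carrier G \<Longrightarrow> star g \<in> carrier P"
  by (simp add: star_def)

lemma e_closed [simp]: "g \<in> carrier G \<Longrightarrow> e g \<in> carrier P"
  by (simp add: e_def)

lemma coef_inv: "g \<in> carrier G \<Longrightarrow> coef (inv g) = coef g"
  by (simp add: coef_def sigma_inv_sym)

lemma coef_sigma_gen: "g \<in> carrier G \<Longrightarrow> (coef g \<otimes>\<^bsub>K\<^esub> \<sigma> g (inv g)) \<odot>\<^bsub>P\<^esub> \<Gamma> g = \<Gamma> g"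
  using gen_zero[of g] by (auto simp: coef_def K.field_Units)

lemma e_gen: "g \<in> carrier G \<Longrightarrow> e g \<bullet> \<Gamma> g = \<Gamma> g"
  using coef_sigma_gen[of g] gen_inv_gen[of g]
  by (simp add: e_def star_def smult_mult_left smult_mult_right smult_assoc1)

lemma star_gen: "g \<in> carrier G \<Longrightarrow> star g \<bullet> \<Gamma> g = e (inv g)"
  by (simp add: e_def star_def smult_mult_left smult_mult_right coef_inv)

lemma gen_star: "g \<in> carrier G \<Longrightarrow> \<Gamma> g \<bullet> star g = e g"
  by (simp add: e_def)

lemma gen_e: "g \<in> carrier G \<Longrightarrow> \<Gamma> g \<bullet> e (inv g) = \<Gamma> g"
  using e_gen[of g] by (simp add: star_gen[symmetric] A.m_assoc[symmetric] gen_star)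

lemma e_idem: "g \<in> carrier G \<Longrightarrow> e g \<bullet> e g = e g"
  using e_gen[of g] by (simp add: e_def A.m_assoc[symmetric])

lemma e_one: "e \<one> = \<one>\<^bsub>P\<^esub>"
  using e_gen[of \<one>] by (simp add: gen_one)

text \<open>
  Both sides are scalar multiples of \<open>\<Gamma>(gh) \<Gamma>(h\<inverse>)\<close>, by the right and the left axiom.  Instead of
  comparing the scalars, note that the left side is fixed by \<open>e(gh)\<close> from the left and the
  right side by \<open>e(h)\<close> from the right, so both equal \<open>e(gh) \<Gamma>(g) e(h)\<close>.
\<close>

lemma gen_e_shift:
  assumes g: "g \<in> carrier G" and h: "h \<in> carrier G"
  shows "\<Gamma> g \<bullet> e h = e (g \<otimes> h) \<bullet> \<Gamma> g"
proof -
  have 1: "\<Gamma> g \<bullet> e h = (coef h \<otimes>\<^bsub>K\<^esub> \<sigma> g h) \<odot>\<^bsub>P\<^esub> (\<Gamma> (g \<otimes> h) \<bullet> \<Gamma> (inv h))"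
    using g h rep_right[of g h]
    by (simp add: e_def star_def smult_mult_right A.m_assoc[symmetric] smult_assoc1)
  have "e (g \<otimes> h) \<bullet> \<Gamma> g =
      coef (g \<otimes> h) \<odot>\<^bsub>P\<^esub> (\<Gamma> (g \<otimes> h) \<bullet> \<Gamma> (inv (g \<otimes> h)) \<bullet> \<Gamma> g)"
    using g h by (simp add: e_def star_def smult_mult_right smult_mult_left)
  also have "\<Gamma> (g \<otimes> h) \<bullet> \<Gamma> (inv (g \<otimes> h)) \<bullet> \<Gamma> g =
      \<sigma> (inv (g \<otimes> h)) g \<odot>\<^bsub>P\<^esub> (\<Gamma> (g \<otimes> h) \<bullet> \<Gamma> (inv (g \<otimes> h) \<otimes> g))"
    using rep_left[of "inv (g \<otimes> h)" g] g h by simp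
  also have "inv (g \<otimes> h) \<otimes> g = inv h"
    using g h by (simp add: G.inv_mult_group G.m_assoc)
  finally have 2: "e (g \<otimes> h) \<bullet> \<Gamma> g =
      coef (g \<otimes> h) \<odot>\<^bsub>P\<^esub> (\<sigma> (inv (g \<otimes> h)) g \<odot>\<^bsub>P\<^esub> (\<Gamma> (g \<otimes> h) \<bullet> \<Gamma> (inv h)))" .
  have "\<Gamma> g \<bullet> e h = e (g \<otimes> h) \<bullet> (\<Gamma> g \<bullet> e h)"
    unfolding 1 using g h by (simp add: smult_mult_right A.m_assoc[symmetric] e_gen)
  also have "\<dots> = (e (g \<otimes> h) \<bullet> \<Gamma> g) \<bullet> e h" using g h by (simp add: A.m_assoc)
  also have "\<dots> = e (g \<otimes> h) \<bullet> \<Gamma> g"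
    unfolding 2 using g h gen_e[of "inv h"] by (simp add: smult_mult_left A.m_assoc)
  finally show ?thesis .
qed

lemma star_e_shift:
  assumes g: "g \<in> carrier G" and h: "h \<in> carrier G"
  shows "star g \<bullet> e h = e (inv g \<otimes> h) \<bullet> star g"
  using gen_e_shift[of "inv g" h] g h by (simp add: star_def smult_mult_left smult_mult_right)

lemma e_commute:
  assumes g: "g \<in> carrier G" and h: "h \<in> carrier G"
  shows "e g \<bullet> e h = e h \<bullet> e g"
proof -
  have "e g \<bullet> e h = \<Gamma> g \<bullet> (star g \<bullet> e h)" using g h by (simp add: e_def A.m_assoc)
  also have "\<dots> = (\<Gamma> g \<bullet> e (inv g \<otimes> h)) \<bullet> star g"
    using g h by (simp add: star_e_shift A.m_assoc)
  also have "\<dots> = e h \<bullet> \<Gamma> g \<bullet> star g"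
    using g h by (simp add: gen_e_shift G.m_assoc[symmetric])
  finally show ?thesis using g h by (simp add: A.m_assoc gen_star)
qed

lemma gen_mult:
  assumes g: "g \<in> carrier G" and h: "h \<in> carrier G"
  shows "\<Gamma> g \<bullet> \<Gamma> h = \<sigma> g h \<odot>\<^bsub>P\<^esub> (e g \<bullet> \<Gamma> (g \<otimes> h))"
proof -
  have "\<Gamma> g \<bullet> \<Gamma> h = \<Gamma> g \<bullet> (star g \<bullet> \<Gamma> g \<bullet> \<Gamma> h)"
    using g h gen_e[of g] by (simp add: A.m_assoc[symmetric] star_gen[symmetric])
  also have "star g \<bullet> \<Gamma> g \<bullet> \<Gamma> h = \<sigma> g h \<odot>\<^bsub>P\<^esub> (star g \<bullet> \<Gamma> (g \<otimes> h))"
    using g h rep_left[of g h]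
    by (simp add: star_def smult_mult_left smult_assoc1[symmetric] K.m_comm)
  finally show ?thesis using g h by (simp add: smult_mult_right e_def A.m_assoc)
qed

text \<open>
  If \<open>\<sigma>(g, h) = 0\<close>, then \<open>\<Gamma>(g\<inverse>) \<Gamma>(gh) = 0\<close> is a factor of \<open>e(g) e(gh)\<close>.  Conversely
  \<open>\<Gamma>(g) \<Gamma>(h)\<close> is a multiple of \<open>e(g) e(gh) \<Gamma>(gh)\<close>, and a factor set vanishes where this product does.
\<close>

lemma e_e_zero_iff:
  assumes g: "g \<in> carrier G" and h: "h \<in> carrier G"
  shows "e g \<bullet> e (g \<otimes> h) = \<zero>\<^bsub>P\<^esub> \<longleftrightarrow> \<sigma> g h = \<zero>\<^bsub>K\<^esub>"
proof
  assume "\<sigma> g h = \<zero>\<^bsub>K\<^esub>"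
  then have z: "\<Gamma> (inv g) \<bullet> \<Gamma> (g \<otimes> h) = \<zero>\<^bsub>P\<^esub>" using sigma_zero g h by blast
  have "e g \<bullet> e (g \<otimes> h) = star (inv g) \<bullet> (\<Gamma> (inv g) \<bullet> \<Gamma> (g \<otimes> h)) \<bullet> star (g \<otimes> h)"
    using star_gen[of "inv g"] g h by (simp add: A.m_assoc[symmetric]) (simp add: e_def A.m_assoc)
  then show "e g \<bullet> e (g \<otimes> h) = \<zero>\<^bsub>P\<^esub>" using z g h by simp
next
  assume z: "e g \<bullet> e (g \<otimes> h) = \<zero>\<^bsub>P\<^esub>"
  have "\<Gamma> g \<bullet> \<Gamma> h = \<sigma> g h \<odot>\<^bsub>P\<^esub> (e g \<bullet> e (g \<otimes> h) \<bullet> \<Gamma> (g \<otimes> h))"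
    using g h by (simp add: gen_mult A.m_assoc e_gen)
  then have "\<Gamma> g \<bullet> \<Gamma> h = \<zero>\<^bsub>P\<^esub>" using z g h by simp
  then show "\<sigma> g h = \<zero>\<^bsub>K\<^esub>" using mult_zero g h by blast
qed

lemma sigma_zero_e_e:
  assumes g: "g \<in> carrier G" and h: "h \<in> carrier G" and z: "\<sigma> g h = \<zero>\<^bsub>K\<^esub>"
  shows "e (inv (g \<otimes> h)) \<bullet> e (inv h) = \<zero>\<^bsub>P\<^esub>"
proof -
  have "e (inv (g \<otimes> h)) \<bullet> e (inv h) = star (g \<otimes> h) \<bullet> (\<Gamma> (g \<otimes> h) \<bullet> \<Gamma> (inv h)) \<bullet> star (inv h)"
    using star_gen[of "g \<otimes> h"] gen_star[of "inv h"] g h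
    by (simp add: A.m_assoc[symmetric]) (simp add: A.m_assoc)
  then show ?thesis using sigma_zero[OF g h z] g h by simp
qed

text \<open>
  Multiplication by \<open>\<Gamma>(g)\<close> is undone by multiplication by \<open>star(g)\<close>.  This is the tool that turns
  identities between multiples of \<open>\<Gamma>(g)\<close> into identities in \<open>B\<close>.
\<close>

lemma gen_right_cancel:
  assumes "g \<in> carrier G" "x \<in> carrier P" "y \<in> carrier P" "x \<bullet> e g = x" "y \<bullet> e g = y"
    and "x \<bullet> \<Gamma> g = y \<bullet> \<Gamma> g"
  shows "x = y"
proof -
  have "x \<bullet> \<Gamma> g \<bullet> star g = x" "y \<bullet> \<Gamma> g \<bullet> star g = y"
    using assms(1-5) by (simp_all add: A.m_assoc gen_star)
  then show ?thesis using assms(6) by metis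
qed

lemma sigma_one_right:
  assumes g: "g \<in> carrier G"
  shows "\<sigma> g \<one> \<odot>\<^bsub>P\<^esub> \<Gamma> g = \<Gamma> g"
  using rep_right[of g \<one>] g by (simp add: gen_one)

lemma sigma_one_left:
  assumes g: "g \<in> carrier G"
  shows "\<sigma> \<one> g \<odot>\<^bsub>P\<^esub> \<Gamma> g = \<Gamma> g"
  using rep_left[of \<one> g] g by (simp add: gen_one)

definition B :: "'a set" where "B = alg_generate K P (e ` carrier G)"

lemma B_subalgebra: "k_subalgebra K P B"
  unfolding B_def by (rule k_subalgebra_alg_generate) auto

lemmas B_simps [simp] = k_subalgebraD(2-6)[OF B_subalgebra]

lemma B_carrier [simp]: "b \<in> B \<Longrightarrow> b \<in> carrier P"
  by (rule subsetD[OF k_subalgebraD(1)[OF B_subalgebra]])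

lemma e_in_B [simp]: "g \<in> carrier G \<Longrightarrow> e g \<in> B"
  unfolding B_def by (rule subsetD[OF alg_generate_incl]) simp

lemma B_commute: "\<lbrakk>x \<in> B; y \<in> B\<rbrakk> \<Longrightarrow> x \<bullet> y = y \<bullet> x"
  unfolding B_def by (rule alg_generate_commute) (auto simp: e_commute)

lemma B_minimal: "\<lbrakk>k_subalgebra K P S; e ` carrier G \<subseteq> S; b \<in> B\<rbrakk> \<Longrightarrow> b \<in> S"
  unfolding B_def by (rule subsetD[OF alg_generate_minimal])

definition D :: "'g \<Rightarrow> 'a set" where "D g = e g <#\<^bsub>P\<^esub> B"

lemma D_iff: "g \<in> carrier G \<Longrightarrow> b \<in> D g \<longleftrightarrow> b \<in> B \<and> e g \<bullet> b = b"
  by (auto simp: D_def l_coset_def A.m_assoc[symmetric] e_idem) metis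

lemma e_mult_D: "\<lbrakk>g \<in> carrier G; b \<in> B\<rbrakk> \<Longrightarrow> e g \<bullet> b \<in> D g"
  by (simp add: D_iff A.m_assoc[symmetric] e_idem)

lemma D_e: "\<lbrakk>g \<in> carrier G; b \<in> D g\<rbrakk> \<Longrightarrow> b \<bullet> e g = b"
  using B_commute[of b "e g"] by (simp add: D_iff)

definition \<theta> :: "'g \<Rightarrow> 'a \<Rightarrow> 'a" where "\<theta> g b = \<Gamma> g \<bullet> b \<bullet> star g"

lemma theta_add: "\<lbrakk>g \<in> carrier G; a \<in> carrier P; b \<in> carrier P\<rbrakk> \<Longrightarrow> \<theta> g (a \<oplus>\<^bsub>P\<^esub> b) = \<theta> g a \<oplus>\<^bsub>P\<^esub> \<theta> g b"
  by (simp add: \<theta>_def A.l_distr A.r_distr)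

lemma theta_smult: "\<lbrakk>g \<in> carrier G; k \<in> carrier K; b \<in> carrier P\<rbrakk> \<Longrightarrow> \<theta> g (k \<odot>\<^bsub>P\<^esub> b) = k \<odot>\<^bsub>P\<^esub> \<theta> g b"
  by (simp add: \<theta>_def smult_mult_left smult_mult_right)

lemma theta_mult:
  assumes g: "g \<in> carrier G" and a: "a \<in> B" and b: "b \<in> B"
  shows "\<theta> g (a \<bullet> b) = \<theta> g a \<bullet> \<theta> g b"
proof -
  have "\<theta> g a \<bullet> \<theta> g b = \<Gamma> g \<bullet> (a \<bullet> (star g \<bullet> \<Gamma> g)) \<bullet> b \<bullet> star g"
    using g a b by (simp add: \<theta>_def A.m_assoc)
  also have "\<dots> = \<Gamma> g \<bullet> (e (inv g) \<bullet> a) \<bullet> b \<bullet> star g"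
    using g a b B_commute[of a "e (inv g)"] by (simp add: star_gen)
  also have "\<dots> = (\<Gamma> g \<bullet> e (inv g)) \<bullet> a \<bullet> b \<bullet> star g"
    using g a b by (simp add: A.m_assoc)
  also have "\<dots> = \<theta> g (a \<bullet> b)" using g a b by (simp add: gen_e \<theta>_def A.m_assoc)
  finally show ?thesis by simp
qed

lemma theta_one: "g \<in> carrier G \<Longrightarrow> \<theta> g \<one>\<^bsub>P\<^esub> = e g"
  by (simp add: \<theta>_def gen_star)

lemma theta_e:
  assumes g: "g \<in> carrier G" and h: "h \<in> carrier G"
  shows "\<theta> g (e h) = e g \<bullet> e (g \<otimes> h)"
proof -
  have "\<theta> g (e h) = e (g \<otimes> h) \<bullet> e g"
    using g h by (simp add: \<theta>_def gen_e_shift A.m_assoc gen_star)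
  then show ?thesis using g h by (simp add: e_commute)
qed

text \<open>
  The elements that \<open>\<theta> g\<close> maps into \<open>B\<close> form a subalgebra, because \<open>\<theta> g\<close> is multiplicative on \<open>B\<close>
  with value \<open>e(g)\<close> at \<open>1\<close>, and contain the generators by the shift rule.
\<close>

lemma theta_B [simp]:
  assumes g: "g \<in> carrier G" and b: "b \<in> B"
  shows "\<theta> g b \<in> B"
proof -
  let ?S = "{b \<in> B. \<theta> g b \<in> B}"
  have "k_subalgebra K P ?S"
    by (rule k_subalgebraI) (use g in \<open>auto simp: theta_one theta_add theta_mult theta_smult\<close>)
  then have "b \<in> ?S" by (rule B_minimal) (use g b in \<open>auto simp: theta_e\<close>)
  then show ?thesis by simp
qed

lemma theta_D: "\<lbrakk>g \<in> carrier G; b \<in> B\<rbrakk> \<Longrightarrow> \<theta> g b \<in> D g"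
  using theta_mult[of g "\<one>\<^bsub>P\<^esub>" b] by (simp add: D_iff theta_one)

text \<open>
  With \<open>gen_right_cancel\<close>, this determines \<open>\<theta> g b\<close> in \<open>D g\<close>, and allows to compute with \<open>\<theta>\<close> without
  touching the scalars in \<open>star\<close>.
\<close>

lemma theta_gen:
  assumes g: "g \<in> carrier G" and b: "b \<in> B"
  shows "\<theta> g b \<bullet> \<Gamma> g = \<Gamma> g \<bullet> b"
proof -
  have "\<theta> g b \<bullet> \<Gamma> g = \<Gamma> g \<bullet> (b \<bullet> e (inv g))"
    using g b by (simp add: \<theta>_def A.m_assoc star_gen)
  also have "\<dots> = (\<Gamma> g \<bullet> e (inv g)) \<bullet> b"
    using g b B_commute[of b "e (inv g)"] by (simp add: A.m_assoc)
  finally show ?thesis using g b by (simp add: gen_e)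
qed

lemma theta_e_inv_mult:
  "\<lbrakk>g \<in> carrier G; b \<in> B\<rbrakk> \<Longrightarrow> \<theta> g (e (inv g) \<bullet> b) = \<theta> g b"
  by (simp add: \<theta>_def A.m_assoc[symmetric] gen_e)

lemma theta_D_subset:
  assumes g: "g \<in> carrier G" and h: "h \<in> carrier G" and b: "b \<in> D h"
  shows "\<theta> g b \<in> D (g \<otimes> h)"
proof -
  have bB: "b \<in> B" "e h \<bullet> b = b" using D_iff[OF h] b by auto
  then have "\<theta> g b = \<theta> g (e h) \<bullet> \<theta> g b" using theta_mult[OF g e_in_B[OF h], of b] by simp
  also have "\<dots> = e (g \<otimes> h) \<bullet> (e g \<bullet> \<theta> g b)"
    using g h bB by (simp add: theta_e A.m_assoc[symmetric] e_commute)
  finally have eq: "\<theta> g b = e (g \<otimes> h) \<bullet> (e g \<bullet> \<theta> g b)" .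
  show ?thesis by (subst eq, rule e_mult_D) (use g h bB in simp_all)
qed

text \<open>
  Moving \<open>a\<close> to the left through \<open>\<Gamma>(g) \<Gamma>(h) = \<sigma>(g, h) e(g) \<Gamma>(gh)\<close> produces \<open>\<theta> g (\<theta> h a)\<close> factor by
  factor, and \<open>\<theta> (gh) a\<close> at once.  If \<open>\<sigma>(g, h) = 0\<close> this says nothing, but then \<open>a = 0\<close>,
  because the two idempotents fixing \<open>a\<close> are orthogonal.
\<close>

lemma theta_theta:
  assumes g: "g \<in> carrier G" and h: "h \<in> carrier G" and a: "a \<in> D (inv h)" "a \<in> D (inv (g \<otimes> h))"
  shows "\<theta> g (\<theta> h a) = \<theta> (g \<otimes> h) a"
proof (cases "\<sigma> g h = \<zero>\<^bsub>K\<^esub>")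
  case True
  have aB: "a \<in> B" "e (inv h) \<bullet> a = a" "e (inv (g \<otimes> h)) \<bullet> a = a" using D_iff a g h by auto
  have "a = (e (inv (g \<otimes> h)) \<bullet> e (inv h)) \<bullet> a" using aB g h by (simp add: A.m_assoc)
  then have "a = \<zero>\<^bsub>P\<^esub>" using sigma_zero_e_e[OF g h True] aB by simp
  then show ?thesis using g h by (simp add: \<theta>_def)
next
  case False
  have aB: "a \<in> B" using D_iff a h by auto
  let ?s = "g \<otimes> h"
  have s: "?s \<in> carrier G" using g h by simp
  have th: "\<theta> h a \<in> D h" using theta_D h aB by simp
  then have thB: "\<theta> h a \<in> B" using D_iff h by auto
  have x: "\<theta> g (\<theta> h a) \<in> D ?s" "\<theta> g (\<theta> h a) \<in> D g" using theta_D_subset g h th theta_D thB by auto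
  have "\<theta> ?s a \<in> D (?s \<otimes> inv h)" using theta_D_subset[of ?s "inv h" a] a g h by simp
  then have y: "\<theta> ?s a \<in> D ?s" "\<theta> ?s a \<in> D g" using theta_D s aB g h by (auto simp: G.m_assoc)
  have xB: "\<theta> g (\<theta> h a) \<in> B" "\<theta> ?s a \<in> B" using g h aB by simp_all
  have "\<theta> g (\<theta> h a) \<bullet> (\<Gamma> g \<bullet> \<Gamma> h) = \<Gamma> g \<bullet> \<Gamma> h \<bullet> a"
  proof -
    have "\<theta> g (\<theta> h a) \<bullet> (\<Gamma> g \<bullet> \<Gamma> h) = (\<theta> g (\<theta> h a) \<bullet> \<Gamma> g) \<bullet> \<Gamma> h"
      using g h aB by (simp add: A.m_assoc)
    also have "\<dots> = \<Gamma> g \<bullet> (\<theta> h a \<bullet> \<Gamma> h)" using g h aB by (simp add: theta_gen A.m_assoc)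
    finally show ?thesis using g h aB by (simp add: theta_gen A.m_assoc)
  qed
  then have "\<sigma> g h \<odot>\<^bsub>P\<^esub> (\<theta> g (\<theta> h a) \<bullet> e g \<bullet> \<Gamma> ?s) = \<sigma> g h \<odot>\<^bsub>P\<^esub> (e g \<bullet> (\<Gamma> ?s \<bullet> a))"
    using g h aB by (simp add: gen_mult smult_mult_left smult_mult_right A.m_assoc)
  also have "\<dots> = \<sigma> g h \<odot>\<^bsub>P\<^esub> (\<theta> ?s a \<bullet> e g \<bullet> \<Gamma> ?s)"
    using g h aB B_commute[of "\<theta> ?s a" "e g"] by (simp add: theta_gen[symmetric] A.m_assoc)
  finally have "\<sigma> g h \<odot>\<^bsub>P\<^esub> (\<theta> g (\<theta> h a) \<bullet> \<Gamma> ?s) = \<sigma> g h \<odot>\<^bsub>P\<^esub> (\<theta> ?s a \<bullet> \<Gamma> ?s)"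
    using D_e x(2) y(2) g by simp
  then have "inv\<^bsub>K\<^esub> (\<sigma> g h) \<odot>\<^bsub>P\<^esub> (\<sigma> g h \<odot>\<^bsub>P\<^esub> (\<theta> g (\<theta> h a) \<bullet> \<Gamma> ?s)) =
      inv\<^bsub>K\<^esub> (\<sigma> g h) \<odot>\<^bsub>P\<^esub> (\<sigma> g h \<odot>\<^bsub>P\<^esub> (\<theta> ?s a \<bullet> \<Gamma> ?s))" by simp
  moreover have "\<sigma> g h \<in> Units K" using False g h by (simp add: K.field_Units)
  ultimately have eq: "\<theta> g (\<theta> h a) \<bullet> \<Gamma> ?s = \<theta> ?s a \<bullet> \<Gamma> ?s"
    using g h aB by (simp add: smult_assoc1[symmetric])
  show ?thesis
    by (rule gen_right_cancel[OF s _ _ D_e[OF s x(1)] D_e[OF s y(1)] eq]) (simp_all add: xB)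
qed

end

section \<open>The unital partial action and its twist\<close>

context partial_factor_rep
begin

lemma star_one: "star \<one> = \<one>\<^bsub>P\<^esub>"
  using e_one by (simp add: e_def gen_one)

lemma theta_id: "b \<in> carrier P \<Longrightarrow> \<theta> \<one> b = b"
  by (simp add: \<theta>_def gen_one star_one)

lemma D_one: "D \<one> = B"
  by (auto simp: D_iff e_one)

lemma theta_inverse: "\<lbrakk>g \<in> carrier G; y \<in> D g\<rbrakk> \<Longrightarrow> \<theta> g (\<theta> (inv g) y) = y"
  using theta_theta[of g "inv g" y] by (simp add: D_one theta_id D_iff)

abbreviation "BA \<equiv> P\<lparr>carrier := B\<rparr>"

sublocale B: kalgebra K BA
  by (rule k_subalgebra_kalgebra[OF B_subalgebra])

lemma BA_cring: "cring BA"
  by (intro cring.intro comm_monoid.intro comm_monoid_axioms.intro B.A.ring_axioms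
      B.A.monoid_axioms) (simp add: B_commute)

lemma D_genideal:
  assumes g: "g \<in> carrier G"
  shows "D g = Idl\<^bsub>BA\<^esub> {e g}"
proof -
  have "D g = {x \<bullet> e g | x. x \<in> B}"
    using B_commute[of _ "e g"] g by (force simp: D_def l_coset_def)
  also have "\<dots> = PIdl\<^bsub>BA\<^esub> (e g)" by (simp add: cgenideal_def)
  also have "\<dots> = Idl\<^bsub>BA\<^esub> {e g}"
    using g by (intro cring.cgenideal_eq_genideal[OF BA_cring]) simp
  finally show ?thesis .
qed

text \<open>
  Ideals generated by idempotents of a commutative ring multiply by intersection, as \<open>x = e(g) x\<close>
  shows for \<open>x\<close> in both.
\<close>

lemma ideal_prod_D:
  assumes g: "g \<in> carrier G" and h: "h \<in> carrier G"
  shows "ideal_prod BA (D g) (D h) = D g \<inter> D h"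
proof (intro equalityI subsetI)
  fix x assume "x \<in> ideal_prod BA (D g) (D h)"
  then show "x \<in> D g \<inter> D h"
  proof induction
    case (prod i j)
    then have ij: "i \<in> B" "j \<in> B" "e g \<bullet> i = i" "e h \<bullet> j = j" using D_iff g h by auto
    have "e h \<bullet> (i \<bullet> j) = (i \<bullet> e h) \<bullet> j" using ij h B_commute[of i "e h"] by (simp add: A.m_assoc[symmetric])
    also have "\<dots> = i \<bullet> j" using ij h by (simp add: A.m_assoc)
    finally show ?case using ij g h by (simp add: D_iff A.m_assoc[symmetric])
  next
    case (sum i j) then show ?case using g h by (auto simp: D_iff A.r_distr)
  qed
next
  fix x assume x: "x \<in> D g \<inter> D h"
  have "e g \<in> D g" using g by (simp add: D_iff e_idem)
  then have "e g \<otimes>\<^bsub>BA\<^esub> x \<in> ideal_prod BA (D g) (D h)" using x by (intro ideal_prod.prod) auto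
  then show "x \<in> ideal_prod BA (D g) (D h)" using x g by (simp add: D_iff)
qed

lemma theta_bij:
  assumes g: "g \<in> carrier G"
  shows "bij_betw (\<theta> g) (D (inv g)) (D g)"
proof (rule bij_betw_byWitness[where f' = "\<theta> (inv g)"])
  show "\<forall>a\<in>D (inv g). \<theta> (inv g) (\<theta> g a) = a" using theta_inverse[of "inv g"] g by simp
  show "\<forall>a\<in>D g. \<theta> g (\<theta> (inv g) a) = a" using theta_inverse g by simp
  show "\<theta> g ` D (inv g) \<subseteq> D g" using g theta_D D_iff[of "inv g"] by auto
  show "\<theta> (inv g) ` D g \<subseteq> D (inv g)" using g theta_D[of "inv g"] D_iff[of g] by auto
qed

lemma theta_image_Int:
  assumes g: "g \<in> carrier G" and h: "h \<in> carrier G"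
  shows "\<theta> g ` (D (inv g) \<inter> D h) = D g \<inter> D (g \<otimes> h)"
proof (intro equalityI subsetI)
  fix y assume "y \<in> \<theta> g ` (D (inv g) \<inter> D h)"
  then show "y \<in> D g \<inter> D (g \<otimes> h)"
    using g h theta_D[of g] theta_D_subset[of g h] D_iff[of h] by auto
next
  fix y assume y: "y \<in> D g \<inter> D (g \<otimes> h)"
  have "\<theta> (inv g) y \<in> D (inv g)" using y g theta_D[of "inv g" y] D_iff[of g] by auto
  moreover have "\<theta> (inv g) y \<in> D h"
    using y g h theta_D_subset[of "inv g" "g \<otimes> h" y] by (simp add: G.m_assoc[symmetric])
  ultimately show "y \<in> \<theta> g ` (D (inv g) \<inter> D h)"
    using theta_inverse[OF g, of y] y by (metis IntI IntD1 imageI)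
qed

lemma theta_kalg_iso:
  assumes g: "g \<in> carrier G"
  shows "\<theta> g \<in> kalg_iso K (BA\<lparr>carrier := D (inv g), one := e (inv g)\<rparr>) (BA\<lparr>carrier := D g, one := e g\<rparr>)"
proof -
  have DB: "a \<in> B" if "a \<in> D (inv g)" for a using that g by (simp add: D_iff)
  have "\<theta> g (e (inv g)) = e g" using g by (simp add: theta_e e_one)
  then show ?thesis
    unfolding kalg_iso_def kalg_hom_def
    using g theta_bij[OF g] DB
    by (auto intro!: ring_hom_memI simp: theta_D theta_mult theta_add theta_smult)
qed

lemma unital_partial_action_theta: "unital_partial_action G K BA D e \<theta>"
proof (intro unital_partial_action.intro unital_partial_action_axioms.intro G.group_axioms
    B.kalgebra_axioms, goal_cases)
  case (1 g) then show ?case by simp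
next
  case (2 g) then show ?case by (simp add: e_idem)
next
  case (3 g a) then show ?case by (simp add: B_commute)
next
  case (4 g) then show ?case by (rule D_genideal)
next
  case 5 show ?case by (simp add: D_one)
next
  case (6 g) then show ?case by (rule theta_kalg_iso)
next
  case (7 a) then show ?case by (simp add: theta_id)
next
  case (8 g h) then show ?case by (simp add: ideal_prod_D theta_image_Int)
next
  case (9 g h a) then show ?case by (intro theta_theta) (auto simp: ideal_prod_D)
qed

lemma e_lcomm:
  "\<lbrakk>g \<in> carrier G; h \<in> carrier G; x \<in> carrier P\<rbrakk> \<Longrightarrow> e g \<bullet> (e h \<bullet> x) = e h \<bullet> (e g \<bullet> x)"
  by (simp add: A.m_assoc[symmetric] e_commute)

lemma e_idem_left: "\<lbrakk>g \<in> carrier G; x \<in> carrier P\<rbrakk> \<Longrightarrow> e g \<bullet> (e g \<bullet> x) = e g \<bullet> x"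
  by (simp add: A.m_assoc[symmetric] e_idem)

text \<open>
  The two scalars are the coefficients of \<open>E \<Gamma>(ght)\<close> in \<open>(\<Gamma>(g) \<Gamma>(h)) \<Gamma>(t) = \<Gamma>(g) (\<Gamma>(h) \<Gamma>(t))\<close>.
\<close>

lemma sigma_cocycle:
  assumes g: "g \<in> carrier G" and h: "h \<in> carrier G" and t: "t \<in> carrier G"
  defines "E \<equiv> e g \<bullet> (e (g \<otimes> h) \<bullet> e (g \<otimes> h \<otimes> t))"
  shows "(\<sigma> h t \<otimes>\<^bsub>K\<^esub> \<sigma> g (h \<otimes> t)) \<odot>\<^bsub>P\<^esub> E = (\<sigma> g h \<otimes>\<^bsub>K\<^esub> \<sigma> (g \<otimes> h) t) \<odot>\<^bsub>P\<^esub> E"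
proof -
  let ?s = "g \<otimes> h \<otimes> t"
  have s: "?s \<in> carrier G" "g \<otimes> (h \<otimes> t) = ?s" using g h t by (simp_all add: G.m_assoc)
  have E: "E \<in> carrier P" "E \<bullet> e ?s = E"
    using g h t by (simp_all add: E_def A.m_assoc e_idem)
  have "(\<sigma> g h \<otimes>\<^bsub>K\<^esub> \<sigma> (g \<otimes> h) t) \<odot>\<^bsub>P\<^esub> (E \<bullet> \<Gamma> ?s) = (\<Gamma> g \<bullet> \<Gamma> h) \<bullet> \<Gamma> t"
    using g h t by (simp add: gen_mult E_def smult_assoc1 smult_mult_left smult_mult_right A.m_assoc e_gen)
  also have "\<dots> = \<Gamma> g \<bullet> (\<Gamma> h \<bullet> \<Gamma> t)" using g h t by (simp add: A.m_assoc)
  also have "\<dots> = \<sigma> h t \<odot>\<^bsub>P\<^esub> (\<Gamma> g \<bullet> e h \<bullet> \<Gamma> (h \<otimes> t))"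
    using g h t by (simp add: gen_mult[of h t] smult_mult_right A.m_assoc)
  also have "\<Gamma> g \<bullet> e h \<bullet> \<Gamma> (h \<otimes> t) = e (g \<otimes> h) \<bullet> (\<Gamma> g \<bullet> \<Gamma> (h \<otimes> t))"
    using g h t by (simp add: gen_e_shift A.m_assoc)
  also have "\<dots> = \<sigma> g (h \<otimes> t) \<odot>\<^bsub>P\<^esub> (E \<bullet> \<Gamma> ?s)"
    using g h t s by (simp add: gen_mult E_def smult_mult_right A.m_assoc e_gen e_lcomm[of "g \<otimes> h" g])
  finally have eq: "(\<sigma> g h \<otimes>\<^bsub>K\<^esub> \<sigma> (g \<otimes> h) t) \<odot>\<^bsub>P\<^esub> (E \<bullet> \<Gamma> ?s) =
      \<sigma> h t \<odot>\<^bsub>P\<^esub> (\<sigma> g (h \<otimes> t) \<odot>\<^bsub>P\<^esub> (E \<bullet> \<Gamma> ?s))" .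
  show ?thesis
    by (rule gen_right_cancel[OF s(1)]) (use g h t E eq in \<open>simp_all add: smult_mult_left smult_assoc1\<close>)
qed

lemma kvalued_twist_sigma: "kvalued_twist G K BA e \<theta> \<sigma>"
  unfolding kvalued_twist_def Let_def twist_elem_def
proof (intro conjI ballI, goal_cases)
  case (1 g h) then show ?case by simp
next
  case (2 g h) then show ?case by (simp add: e_e_zero_iff)
next
  case (3 g)
  then have "\<sigma> \<one> g \<odot>\<^bsub>P\<^esub> e g = (\<sigma> \<one> g \<odot>\<^bsub>P\<^esub> \<Gamma> g) \<bullet> star g"
    by (simp add: smult_mult_left gen_star)
  also have "\<dots> = e g" using 3 by (simp add: sigma_one_left gen_star)
  finally have "\<sigma> \<one> g \<odot>\<^bsub>P\<^esub> e g = e g" .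
  then show ?case using 3 by (simp add: e_one)
next
  case (4 g)
  then have "\<sigma> g \<one> \<odot>\<^bsub>P\<^esub> e g = (\<sigma> g \<one> \<odot>\<^bsub>P\<^esub> \<Gamma> g) \<bullet> star g"
    by (simp add: smult_mult_left gen_star)
  also have "\<dots> = e g" using 4 by (simp add: sigma_one_right gen_star)
  finally have "\<sigma> g \<one> \<odot>\<^bsub>P\<^esub> e g = e g" .
  then show ?case using 4 by (simp add: e_idem)
next
  case (5 g h t)
  let ?s = "g \<otimes> h \<otimes> t"
  let ?E = "e g \<bullet> (e (g \<otimes> h) \<bullet> e ?s)"
  have s: "g \<otimes> (h \<otimes> t) = ?s" using 5 by (simp add: G.m_assoc)
  have "\<theta> g (e (inv g) \<bullet> (\<sigma> h t \<odot>\<^bsub>P\<^esub> (e h \<bullet> e (h \<otimes> t)))) = \<sigma> h t \<odot>\<^bsub>P\<^esub> ?E"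
    using 5 s by (simp add: theta_e_inv_mult theta_smult theta_mult theta_e A.m_assoc
        e_lcomm[of "g \<otimes> h" g] e_idem_left e_one smult_mult_right)
  moreover have "\<sigma> h t \<odot>\<^bsub>P\<^esub> ?E \<bullet> (\<sigma> g (h \<otimes> t) \<odot>\<^bsub>P\<^esub> (e g \<bullet> e ?s)) =
      (\<sigma> h t \<otimes>\<^bsub>K\<^esub> \<sigma> g (h \<otimes> t)) \<odot>\<^bsub>P\<^esub> ?E"
  proof -
    have "?E \<bullet> (e g \<bullet> e ?s) = ?E"
      using 5 by (simp add: A.m_assoc e_lcomm[of _ g] e_idem e_idem_left)
    then show ?thesis
      using 5 by (simp add: smult_mult_left smult_mult_right smult_assoc1[symmetric] K.m_comm)
  qed
  moreover have "\<sigma> g h \<odot>\<^bsub>P\<^esub> (e g \<bullet> e (g \<otimes> h)) \<bullet> (\<sigma> (g \<otimes> h) t \<odot>\<^bsub>P\<^esub> (e (g \<otimes> h) \<bullet> e ?s)) =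
      (\<sigma> g h \<otimes>\<^bsub>K\<^esub> \<sigma> (g \<otimes> h) t) \<odot>\<^bsub>P\<^esub> ?E"
    using 5 by (simp add: smult_mult_left smult_mult_right smult_assoc1[symmetric] K.m_comm
        A.m_assoc e_idem_left)
  ultimately show ?case using sigma_cocycle[of g h t] 5 s by simp
qed

end

section \<open>The crossed product as a graded algebra\<close>

text \<open>
  The projections \<open>\<pi> s\<close> make \<open>P\<close> a graded algebra generated by elements \<open>\<Gamma>(g)\<close> of degree \<open>g\<close>.
  Homogeneity of products is assumed for factors \<open>\<Gamma>(g)\<close>, where it can be read off from
  words; that \<open>P\<close> is the sum of its components is proved below from generation.
\<close>

locale graded_partial_factor_rep = partial_factor_rep G K P \<Gamma> \<sigma>
  for G :: "('g, 'm) monoid_scheme" (structure) and K :: "('k, 'n) ring_scheme" (structure)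
    and P :: "('k, 'a) module" (structure) and \<Gamma> :: "'g \<Rightarrow> 'a" and \<sigma> :: "'g \<Rightarrow> 'g \<Rightarrow> 'k" +
  fixes \<pi> :: "'g \<Rightarrow> 'a \<Rightarrow> 'a"
  assumes generated: "\<lbrakk>k_subalgebra K P S; \<Gamma> ` carrier G \<subseteq> S\<rbrakk> \<Longrightarrow> S = carrier P"
    and pi_closed [simp]: "\<lbrakk>s \<in> carrier G; x \<in> carrier P\<rbrakk> \<Longrightarrow> \<pi> s x \<in> carrier P"
    and pi_add: "\<lbrakk>s \<in> carrier G; x \<in> carrier P; y \<in> carrier P\<rbrakk> \<Longrightarrow> \<pi> s (x \<oplus>\<^bsub>P\<^esub> y) = \<pi> s x \<oplus>\<^bsub>P\<^esub> \<pi> s y"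
    and pi_smult: "\<lbrakk>s \<in> carrier G; k \<in> carrier K; x \<in> carrier P\<rbrakk> \<Longrightarrow> \<pi> s (k \<odot>\<^bsub>P\<^esub> x) = k \<odot>\<^bsub>P\<^esub> \<pi> s x"
    and pi_one: "s \<in> carrier G \<Longrightarrow> \<pi> s \<one>\<^bsub>P\<^esub> = (if s = \<one> then \<one>\<^bsub>P\<^esub> else \<zero>\<^bsub>P\<^esub>)"
    and pi_gen_left: "\<lbrakk>s \<in> carrier G; g \<in> carrier G; x \<in> carrier P\<rbrakk> \<Longrightarrow>
      \<pi> s (\<Gamma> g \<otimes>\<^bsub>P\<^esub> x) = \<Gamma> g \<otimes>\<^bsub>P\<^esub> \<pi> (inv g \<otimes> s) x"
    and pi_gen_right: "\<lbrakk>s \<in> carrier G; g \<in> carrier G; x \<in> carrier P\<rbrakk> \<Longrightarrow>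
      \<pi> s (x \<otimes>\<^bsub>P\<^esub> \<Gamma> g) = \<pi> (s \<otimes> inv g) x \<otimes>\<^bsub>P\<^esub> \<Gamma> g"
begin

lemma pi_B:
  assumes "b \<in> B" "x \<in> carrier P" "s \<in> carrier G"
  shows "\<pi> s (b \<bullet> x) = b \<bullet> \<pi> s x"
proof -
  let ?S = "{b \<in> carrier P. \<forall>x\<in>carrier P. \<forall>s\<in>carrier G. \<pi> s (b \<bullet> x) = b \<bullet> \<pi> s x}"
  have "k_subalgebra K P ?S"
    by (rule k_subalgebraI) (auto simp: A.l_distr A.m_assoc smult_mult_left pi_add pi_smult)
  moreover have "e ` carrier G \<subseteq> ?S"
    by (auto simp: e_def star_def smult_mult_left smult_mult_right A.m_assoc pi_smult pi_gen_left
        G.m_assoc[symmetric])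
  ultimately have "b \<in> ?S" using assms(1) by (rule B_minimal)
  then show ?thesis using assms by auto
qed

lemma pi_B_gen:
  assumes "b \<in> B" "g \<in> carrier G" "s \<in> carrier G"
  shows "\<pi> s (b \<bullet> \<Gamma> g) = (if s = g then b \<bullet> \<Gamma> g else \<zero>\<^bsub>P\<^esub>)"
proof -
  have "\<pi> s (b \<bullet> \<Gamma> g) = b \<bullet> (\<Gamma> g \<bullet> \<pi> (inv g \<otimes> s) \<one>\<^bsub>P\<^esub>)"
    using assms pi_gen_left[of s g "\<one>\<^bsub>P\<^esub>"] by (simp add: pi_B)
  moreover have "(inv g \<otimes> s = \<one>) = (s = g)"
    using assms by (metis G.inv_equality G.inv_inv G.l_inv G.inv_closed)
  ultimately show ?thesis using assms by (simp add: pi_one)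
qed

definition decomposed :: "'a \<Rightarrow> 'g set \<Rightarrow> bool"
  where "decomposed x S \<longleftrightarrow> finite S \<and> S \<subseteq> carrier G \<and>
    (\<forall>s\<in>carrier G - S. \<pi> s x = \<zero>\<^bsub>P\<^esub>) \<and> x = (\<Oplus>\<^bsub>P\<^esub>s\<in>S. \<pi> s x)"

lemma decomposed_mono:
  assumes "decomposed x S" "x \<in> carrier P" "S \<subseteq> T" "finite T" "T \<subseteq> carrier G"
  shows "decomposed x T"
proof -
  have "(\<Oplus>\<^bsub>P\<^esub>s\<in>S. \<pi> s x) = (\<Oplus>\<^bsub>P\<^esub>s\<in>T. \<pi> s x)"
    by (rule add.finprod_mono_neutral_cong_left) (use assms in \<open>auto simp: decomposed_def\<close>)
  then show ?thesis using assms unfolding decomposed_def by auto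
qed

text \<open>
  Both properties of \<open>x\<close> needed later, established together: its components lie in \<open>B \<Gamma>(s)\<close>, and
  it is the finite sum of its components.
\<close>

definition homogeneous_sum :: "'a \<Rightarrow> bool"
  where "homogeneous_sum x \<longleftrightarrow> x \<in> carrier P \<and>
    (\<forall>s\<in>carrier G. \<exists>b\<in>B. \<pi> s x = b \<bullet> \<Gamma> s) \<and> (\<exists>S. decomposed x S)"

lemma homogeneous_sum_one: "homogeneous_sum \<one>\<^bsub>P\<^esub>"
proof -
  have "decomposed \<one>\<^bsub>P\<^esub> {\<one>}" by (simp add: decomposed_def pi_one)
  moreover have "\<exists>b\<in>B. \<pi> s \<one>\<^bsub>P\<^esub> = b \<bullet> \<Gamma> s" if "s \<in> carrier G" for s
    by (rule bexI[of _ "if s = \<one> then \<one>\<^bsub>P\<^esub> else \<zero>\<^bsub>P\<^esub>"]) (use that in \<open>simp_all add: pi_one gen_one\<close>)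
  ultimately show ?thesis by (auto simp: homogeneous_sum_def)
qed

lemma homogeneous_sum_add:
  assumes x: "homogeneous_sum x" and y: "homogeneous_sum y"
  shows "homogeneous_sum (x \<oplus>\<^bsub>P\<^esub> y)"
proof -
  have c: "x \<in> carrier P" "y \<in> carrier P" using x y by (auto simp: homogeneous_sum_def)
  obtain S T where ST: "decomposed x S" "decomposed y T" using x y by (auto simp: homogeneous_sum_def)
  let ?U = "S \<union> T"
  have fin: "finite ?U" "?U \<subseteq> carrier G" using ST by (auto simp: decomposed_def)
  have "decomposed x ?U" "decomposed y ?U" using ST c fin by (auto intro: decomposed_mono)
  then have d: "\<forall>s\<in>carrier G - ?U. \<pi> s x = \<zero>\<^bsub>P\<^esub> \<and> \<pi> s y = \<zero>\<^bsub>P\<^esub>"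
    and sx: "x = (\<Oplus>\<^bsub>P\<^esub>s\<in>?U. \<pi> s x)" and sy: "y = (\<Oplus>\<^bsub>P\<^esub>s\<in>?U. \<pi> s y)"
    by (auto simp: decomposed_def)
  have "(\<Oplus>\<^bsub>P\<^esub>s\<in>?U. \<pi> s (x \<oplus>\<^bsub>P\<^esub> y)) = (\<Oplus>\<^bsub>P\<^esub>s\<in>?U. \<pi> s x \<oplus>\<^bsub>P\<^esub> \<pi> s y)"
    by (rule M.finsum_cong') (use fin c in \<open>auto simp: pi_add subset_iff\<close>)
  also have "\<dots> = (\<Oplus>\<^bsub>P\<^esub>s\<in>?U. \<pi> s x) \<oplus>\<^bsub>P\<^esub> (\<Oplus>\<^bsub>P\<^esub>s\<in>?U. \<pi> s y)"
    by (rule M.finsum_addf) (use fin c in \<open>auto simp: subset_iff\<close>)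
  finally have "x \<oplus>\<^bsub>P\<^esub> y = (\<Oplus>\<^bsub>P\<^esub>s\<in>?U. \<pi> s (x \<oplus>\<^bsub>P\<^esub> y))" using sx sy by simp
  then have "decomposed (x \<oplus>\<^bsub>P\<^esub> y) ?U" unfolding decomposed_def using fin d c by (auto simp: pi_add)
  moreover have "\<exists>b\<in>B. \<pi> s (x \<oplus>\<^bsub>P\<^esub> y) = b \<bullet> \<Gamma> s" if s: "s \<in> carrier G" for s
  proof -
    obtain a b where "a \<in> B" "b \<in> B" "\<pi> s x = a \<bullet> \<Gamma> s" "\<pi> s y = b \<bullet> \<Gamma> s"
      using x y s unfolding homogeneous_sum_def by blast
    then show ?thesis using s c by (intro bexI[of _ "a \<oplus>\<^bsub>P\<^esub> b"]) (simp_all add: pi_add A.l_distr)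
  qed
  ultimately show ?thesis using c unfolding homogeneous_sum_def by blast
qed

lemma homogeneous_sum_smult:
  assumes x: "homogeneous_sum x" and k: "k \<in> carrier K"
  shows "homogeneous_sum (k \<odot>\<^bsub>P\<^esub> x)"
proof -
  have c: "x \<in> carrier P" using x by (auto simp: homogeneous_sum_def)
  obtain S where S: "decomposed x S" using x by (auto simp: homogeneous_sum_def)
  then have fin: "finite S" "S \<subseteq> carrier G" and sx: "x = (\<Oplus>\<^bsub>P\<^esub>s\<in>S. \<pi> s x)"
    by (auto simp: decomposed_def)
  have "(\<Oplus>\<^bsub>P\<^esub>s\<in>S. \<pi> s (k \<odot>\<^bsub>P\<^esub> x)) = (\<Oplus>\<^bsub>P\<^esub>s\<in>S. k \<odot>\<^bsub>P\<^esub> \<pi> s x)"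
    by (rule M.finsum_cong') (use fin c k in \<open>auto simp: pi_smult subset_iff\<close>)
  also have "\<dots> = k \<odot>\<^bsub>P\<^esub> (\<Oplus>\<^bsub>P\<^esub>s\<in>S. \<pi> s x)"
    by (rule finsum_smult_ldistr[symmetric]) (use fin c k in \<open>auto simp: subset_iff\<close>)
  finally have "k \<odot>\<^bsub>P\<^esub> x = (\<Oplus>\<^bsub>P\<^esub>s\<in>S. \<pi> s (k \<odot>\<^bsub>P\<^esub> x))" using sx by simp
  then have "decomposed (k \<odot>\<^bsub>P\<^esub> x) S" using S fin c k unfolding decomposed_def by (auto simp: pi_smult)
  moreover have "\<exists>b\<in>B. \<pi> s (k \<odot>\<^bsub>P\<^esub> x) = b \<bullet> \<Gamma> s" if s: "s \<in> carrier G" for s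
  proof -
    obtain a where "a \<in> B" "\<pi> s x = a \<bullet> \<Gamma> s" using x s unfolding homogeneous_sum_def by blast
    then show ?thesis using s c k by (intro bexI[of _ "k \<odot>\<^bsub>P\<^esub> a"]) (simp_all add: pi_smult smult_mult_left)
  qed
  ultimately show ?thesis using c k unfolding homogeneous_sum_def by blast
qed

lemma homogeneous_sum_gen:
  assumes x: "homogeneous_sum x" and g: "g \<in> carrier G"
  shows "homogeneous_sum (x \<bullet> \<Gamma> g)"
proof -
  have c: "x \<in> carrier P" using x by (auto simp: homogeneous_sum_def)
  obtain S where S: "decomposed x S" using x by (auto simp: homogeneous_sum_def)
  then have fin: "finite S" "S \<subseteq> carrier G" and sx: "x = (\<Oplus>\<^bsub>P\<^esub>s\<in>S. \<pi> s x)"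
    and van: "\<And>s. \<lbrakk>s \<in> carrier G; s \<notin> S\<rbrakk> \<Longrightarrow> \<pi> s x = \<zero>\<^bsub>P\<^esub>"
    by (auto simp: decomposed_def)
  let ?T = "(\<lambda>s. s \<otimes> g) ` S"
  have T: "finite ?T" "?T \<subseteq> carrier G" using fin g by auto
  have "(\<Oplus>\<^bsub>P\<^esub>s\<in>?T. \<pi> s (x \<bullet> \<Gamma> g)) = (\<Oplus>\<^bsub>P\<^esub>s\<in>S. \<pi> (s \<otimes> g) (x \<bullet> \<Gamma> g))"
  proof (rule M.finsum_reindex)
    show "inj_on (\<lambda>s. s \<otimes> g) S" using fin g by (auto intro!: inj_onI simp: subset_iff)
  qed (use T c g in auto)
  also have "\<dots> = (\<Oplus>\<^bsub>P\<^esub>s\<in>S. \<pi> s x \<bullet> \<Gamma> g)"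
    by (rule M.finsum_cong') (use fin c g in \<open>auto simp: pi_gen_right G.m_assoc subset_iff\<close>)
  also have "\<dots> = (\<Oplus>\<^bsub>P\<^esub>s\<in>S. \<pi> s x) \<bullet> \<Gamma> g"
    by (rule A.finsum_ldistr[symmetric]) (use fin c g in auto)
  finally have eq: "x \<bullet> \<Gamma> g = (\<Oplus>\<^bsub>P\<^esub>s\<in>?T. \<pi> s (x \<bullet> \<Gamma> g))" using sx by simp
  have "\<pi> s (x \<bullet> \<Gamma> g) = \<zero>\<^bsub>P\<^esub>" if s: "s \<in> carrier G" "s \<notin> ?T" for s
  proof -
    have "s \<otimes> inv g \<notin> S"
    proof
      assume "s \<otimes> inv g \<in> S"
      then have "s \<otimes> inv g \<otimes> g \<in> ?T" by blast
      then show False using s g by (simp add: G.m_assoc)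
    qed
    then show ?thesis using s g c van by (simp add: pi_gen_right)
  qed
  then have "decomposed (x \<bullet> \<Gamma> g) ?T" unfolding decomposed_def using T eq by blast
  moreover have "\<exists>b\<in>B. \<pi> s (x \<bullet> \<Gamma> g) = b \<bullet> \<Gamma> s" if s: "s \<in> carrier G" for s
  proof -
    let ?h = "s \<otimes> inv g"
    have h: "?h \<in> carrier G" "?h \<otimes> g = s" using s g by (simp_all add: G.m_assoc)
    obtain b where b: "b \<in> B" "\<pi> ?h x = b \<bullet> \<Gamma> ?h" using x h unfolding homogeneous_sum_def by blast
    have "\<pi> s (x \<bullet> \<Gamma> g) = b \<bullet> (\<Gamma> ?h \<bullet> \<Gamma> g)" using s g c b by (simp add: pi_gen_right A.m_assoc)
    also have "\<dots> = (\<sigma> ?h g \<odot>\<^bsub>P\<^esub> (b \<bullet> e ?h)) \<bullet> \<Gamma> s"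
      using gen_mult[OF h(1) g] h(2) s g b by (simp add: smult_mult_right smult_mult_left A.m_assoc)
    finally show ?thesis using b s g by (intro bexI[of _ "\<sigma> ?h g \<odot>\<^bsub>P\<^esub> (b \<bullet> e ?h)"]) simp_all
  qed
  ultimately show ?thesis using c g by (auto simp: homogeneous_sum_def)
qed

text \<open>
  The elements by which the property can be multiplied on the right form a subalgebra
  containing the generators, hence are everything; apply this to \<open>1 x\<close>.
\<close>

lemma homogeneous_sum:
  assumes "x \<in> carrier P"
  shows "homogeneous_sum x"
proof -
  have carr: "y \<in> carrier P" if "homogeneous_sum y" for y using that by (simp add: homogeneous_sum_def)
  let ?M = "{y \<in> carrier P. \<forall>x. homogeneous_sum x \<longrightarrow> homogeneous_sum (x \<bullet> y)}"
  have "k_subalgebra K P ?M"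
  proof (rule k_subalgebraI, goal_cases)
    case 2 then show ?case using carr by auto
  next
    case (3 x y) then show ?case using carr homogeneous_sum_add by (auto simp: A.r_distr)
  next
    case (4 x y) then show ?case using carr by (auto simp: A.m_assoc[symmetric])
  next
    case (5 k x) then show ?case using carr homogeneous_sum_smult by (auto simp: smult_mult_right)
  qed auto
  moreover have "\<Gamma> ` carrier G \<subseteq> ?M" using homogeneous_sum_gen by auto
  ultimately have "?M = carrier P" by (rule generated)
  then have "homogeneous_sum (\<one>\<^bsub>P\<^esub> \<bullet> x)" using homogeneous_sum_one assms by blast
  then show ?thesis using assms by simp
qed

text \<open>
  The coefficient of \<open>x\<close> at \<open>s\<close>: the unique \<open>b\<close> in \<open>D s\<close> with \<open>\<pi> s x = b \<Gamma>(s)\<close>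
  (lemma \<open>beta_D_gen\<close>).
\<close>

definition \<beta> :: "'g \<Rightarrow> 'a \<Rightarrow> 'a" where "\<beta> s x = \<pi> s x \<bullet> star s"

lemma beta_closed [simp]: "\<lbrakk>s \<in> carrier G; x \<in> carrier P\<rbrakk> \<Longrightarrow> \<beta> s x \<in> carrier P"
  by (simp add: \<beta>_def)

lemma beta_D_gen:
  assumes s: "s \<in> carrier G" and x: "x \<in> carrier P"
  shows "\<beta> s x \<in> D s" and "\<beta> s x \<bullet> \<Gamma> s = \<pi> s x"
proof -
  obtain b where b: "b \<in> B" "\<pi> s x = b \<bullet> \<Gamma> s"
    using homogeneous_sum[OF x] s unfolding homogeneous_sum_def by blast
  have be: "\<beta> s x = b \<bullet> e s" using b s by (simp add: \<beta>_def A.m_assoc gen_star)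
  then show "\<beta> s x \<in> D s" using e_mult_D[OF s b(1)] B_commute[OF b(1), of "e s"] s by simp
  show "\<beta> s x \<bullet> \<Gamma> s = \<pi> s x" using be b s by (simp add: A.m_assoc e_gen)
qed

lemma beta_B [simp]: "\<lbrakk>s \<in> carrier G; x \<in> carrier P\<rbrakk> \<Longrightarrow> \<beta> s x \<in> B"
  using beta_D_gen(1) by (simp add: D_iff)

lemma beta_add: "\<lbrakk>s \<in> carrier G; x \<in> carrier P; y \<in> carrier P\<rbrakk> \<Longrightarrow> \<beta> s (x \<oplus>\<^bsub>P\<^esub> y) = \<beta> s x \<oplus>\<^bsub>P\<^esub> \<beta> s y"
  by (simp add: \<beta>_def pi_add A.l_distr)

lemma beta_smult: "\<lbrakk>s \<in> carrier G; k \<in> carrier K; x \<in> carrier P\<rbrakk> \<Longrightarrow> \<beta> s (k \<odot>\<^bsub>P\<^esub> x) = k \<odot>\<^bsub>P\<^esub> \<beta> s x"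
  by (simp add: \<beta>_def pi_smult smult_mult_left)

lemma beta_zero: "s \<in> carrier G \<Longrightarrow> \<beta> s \<zero>\<^bsub>P\<^esub> = \<zero>\<^bsub>P\<^esub>"
  using beta_smult[of s "\<zero>\<^bsub>K\<^esub>" "\<zero>\<^bsub>P\<^esub>"] by simp

lemma beta_one: "s \<in> carrier G \<Longrightarrow> \<beta> s \<one>\<^bsub>P\<^esub> = (if s = \<one> then \<one>\<^bsub>P\<^esub> else \<zero>\<^bsub>P\<^esub>)"
  by (simp add: \<beta>_def pi_one star_one)

lemma beta_D_gen_eq:
  assumes "b \<in> D g" "g \<in> carrier G" "s \<in> carrier G"
  shows "\<beta> s (b \<bullet> \<Gamma> g) = (if s = g then b else \<zero>\<^bsub>P\<^esub>)"
proof -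
  have "b \<in> B" "b \<bullet> e g = b" using assms D_iff D_e by auto
  then show ?thesis using assms by (simp add: \<beta>_def pi_B_gen A.m_assoc gen_star)
qed

lemma beta_finsum:
  assumes s: "s \<in> carrier G"
  shows "\<lbrakk>finite T; f \<in> T \<rightarrow> carrier P\<rbrakk> \<Longrightarrow> \<beta> s (\<Oplus>\<^bsub>P\<^esub>g\<in>T. f g) = (\<Oplus>\<^bsub>P\<^esub>g\<in>T. \<beta> s (f g))"
proof (induction T rule: finite_induct)
  case empty then show ?case using s by (simp add: beta_zero)
next
  case (insert t T)
  then have "f \<in> T \<rightarrow> carrier P" "f t \<in> carrier P" by auto
  then show ?case using insert s by (simp add: beta_add Pi_iff)
qed

definition support :: "'a \<Rightarrow> 'g set" where "support x = {g \<in> carrier G. \<beta> g x \<noteq> \<zero>\<^bsub>P\<^esub>}"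

lemma support_finite:
  assumes x: "x \<in> carrier P"
  shows "finite (support x)" and "x = (\<Oplus>\<^bsub>P\<^esub>g\<in>support x. \<beta> g x \<bullet> \<Gamma> g)"
proof -
  obtain S where S: "decomposed x S" using homogeneous_sum[OF x] by (auto simp: homogeneous_sum_def)
  have van: "\<pi> s x = \<zero>\<^bsub>P\<^esub>" if "s \<in> carrier G" "s \<notin> S" for s
    using S that by (simp add: decomposed_def)
  have sub: "support x \<subseteq> S"
  proof
    fix s assume "s \<in> support x"
    then have "s \<in> carrier G" "\<beta> s x \<noteq> \<zero>\<^bsub>P\<^esub>" by (auto simp: support_def)
    then show "s \<in> S" using van by (force simp: \<beta>_def)
  qed
  have fin: "finite S" "S \<subseteq> carrier G" using S by (auto simp: decomposed_def)
  show "finite (support x)" using sub fin finite_subset by auto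
  have "(\<Oplus>\<^bsub>P\<^esub>g\<in>support x. \<beta> g x \<bullet> \<Gamma> g) = (\<Oplus>\<^bsub>P\<^esub>g\<in>S. \<pi> g x)"
  proof (rule add.finprod_mono_neutral_cong_left[OF fin(1) sub])
    fix g assume "g \<in> S - support x"
    then have "g \<in> carrier G" "\<beta> g x = \<zero>\<^bsub>P\<^esub>" using fin by (auto simp: support_def)
    then show "\<pi> g x = \<zero>\<^bsub>P\<^esub>" using beta_D_gen(2)[of g x] x by simp
  qed (use fin x beta_D_gen(2) in \<open>auto simp: support_def subset_iff\<close>)
  then show "x = (\<Oplus>\<^bsub>P\<^esub>g\<in>support x. \<beta> g x \<bullet> \<Gamma> g)" using S by (simp add: decomposed_def)
qed

lemma beta_ext:
  assumes x: "x \<in> carrier P" and y: "y \<in> carrier P" and eq: "\<And>s. s \<in> carrier G \<Longrightarrow> \<beta> s x = \<beta> s y"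
  shows "x = y"
proof -
  have s: "support x = support y" using eq by (auto simp: support_def)
  have "(\<Oplus>\<^bsub>P\<^esub>g\<in>support x. \<beta> g x \<bullet> \<Gamma> g) = (\<Oplus>\<^bsub>P\<^esub>g\<in>support y. \<beta> g y \<bullet> \<Gamma> g)"
    unfolding s by (rule M.finsum_cong') (use y eq in \<open>auto simp: support_def\<close>)
  then show ?thesis using support_finite(2)[OF x] support_finite(2)[OF y] by metis
qed

text \<open>
  The multiplication rule of the crossed product.  Multiplication by \<open>b \<Gamma>(g)\<close> takes the component
  \<open>\<beta> h y \<Gamma>(h)\<close> of \<open>y\<close>, \<open>h = g\<inverse> s\<close>, to degree \<open>s\<close>; there \<open>\<Gamma>(g)\<close> moves past \<open>\<beta> h y\<close> by \<open>\<theta> g\<close>, and the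
  idempotents from \<open>\<Gamma>(g) \<Gamma>(h) = \<sigma>(g, h) e(g) \<Gamma>(s)\<close> are absorbed by \<open>b\<close> and by \<open>\<theta> g (\<beta> h y)\<close>.
\<close>

lemma beta_homogeneous_mult:
  assumes b: "b \<in> D g" and g: "g \<in> carrier G" and s: "s \<in> carrier G" and y: "y \<in> carrier P"
  shows "\<beta> s (b \<bullet> \<Gamma> g \<bullet> y) =
    \<sigma> g (inv g \<otimes> s) \<odot>\<^bsub>P\<^esub> (b \<bullet> \<theta> g (e (inv g) \<bullet> \<beta> (inv g \<otimes> s) y))"
proof -
  let ?h = "inv g \<otimes> s"
  have h: "?h \<in> carrier G" "g \<otimes> ?h = s" using g s by (simp_all add: G.m_assoc[symmetric])
  have bB: "b \<in> B" "b \<bullet> e g = b" using b g D_iff D_e by auto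
  let ?c = "\<beta> ?h y"
  have c: "?c \<in> D ?h" "?c \<in> B" using beta_D_gen(1) h y by auto
  have t: "\<theta> g ?c \<in> D s" using theta_D_subset[OF g h(1) c(1)] h by simp
  have tB: "\<theta> g ?c \<in> B" using g c by simp
  have "\<beta> s (b \<bullet> \<Gamma> g \<bullet> y) = b \<bullet> (\<Gamma> g \<bullet> \<pi> ?h y) \<bullet> star s"
    using bB g s y by (simp add: \<beta>_def A.m_assoc pi_B pi_gen_left)
  also have "\<Gamma> g \<bullet> \<pi> ?h y = \<Gamma> g \<bullet> ?c \<bullet> \<Gamma> ?h"
    using beta_D_gen(2)[OF h(1) y] g c h by (simp add: A.m_assoc)
  also have "\<dots> = \<theta> g ?c \<bullet> (\<Gamma> g \<bullet> \<Gamma> ?h)"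
    using g h c by (simp add: theta_gen[symmetric] A.m_assoc)
  also have "\<dots> = \<sigma> g ?h \<odot>\<^bsub>P\<^esub> (e g \<bullet> \<theta> g ?c \<bullet> \<Gamma> s)"
    using g h s tB B_commute[OF tB, of "e g"] by (simp add: gen_mult smult_mult_right A.m_assoc[symmetric])
  also have "b \<bullet> \<dots> \<bullet> star s = \<sigma> g ?h \<odot>\<^bsub>P\<^esub> ((b \<bullet> e g) \<bullet> (\<theta> g ?c \<bullet> e s))"
    using g h s tB bB(1) by (simp add: smult_mult_left smult_mult_right A.m_assoc gen_star)
  also have "\<dots> = \<sigma> g ?h \<odot>\<^bsub>P\<^esub> (b \<bullet> \<theta> g ?c)" using bB D_e[OF s t] by simp
  finally show ?thesis using theta_e_inv_mult[OF g c(2)] by simp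
qed

abbreviation "C \<equiv> crossed_product G BA D e \<theta> \<sigma>"

definition \<Phi> :: "'a \<Rightarrow> 'g \<Rightarrow> 'a" where "\<Phi> x = (\<lambda>s\<in>carrier G. \<beta> s x)"

lemma Phi_bij: "bij_betw \<Phi> (carrier P) (carrier C)"
proof (rule bij_betw_imageI)
  show "inj_on \<Phi> (carrier P)"
  proof (rule inj_onI)
    fix x y assume x: "x \<in> carrier P" and y: "y \<in> carrier P" and eq: "\<Phi> x = \<Phi> y"
    have "\<beta> s x = \<beta> s y" if "s \<in> carrier G" for s
      using fun_cong[OF eq, of s] that by (simp add: \<Phi>_def)
    then show "x = y" by (rule beta_ext[OF x y])
  qed
  show "\<Phi> ` carrier P = carrier C"
  proof (intro equalityI subsetI)
    fix c assume "c \<in> \<Phi> ` carrier P"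
    then obtain x where x: "x \<in> carrier P" "c = \<Phi> x" by auto
    have "{g \<in> carrier G. \<Phi> x g \<noteq> \<zero>\<^bsub>BA\<^esub>} = support x" by (auto simp: support_def \<Phi>_def)
    then show "c \<in> carrier C" using x support_finite(1)[OF x(1)] beta_D_gen(1)
      by (auto simp: crossed_product_def \<Phi>_def)
  next
    fix c assume "c \<in> carrier C"
    then have cD: "\<And>g. g \<in> carrier G \<Longrightarrow> c g \<in> D g" and ext: "c \<in> extensional (carrier G)"
      and fin: "finite {g \<in> carrier G. c g \<noteq> \<zero>\<^bsub>P\<^esub>}"
      by (auto simp: crossed_product_def PiE_def)
    let ?S = "{g \<in> carrier G. c g \<noteq> \<zero>\<^bsub>P\<^esub>}"
    have cP: "c g \<in> carrier P" if "g \<in> carrier G" for g using cD[OF that] that by (simp add: D_iff)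
    define x where "x = (\<Oplus>\<^bsub>P\<^esub>g\<in>?S. c g \<bullet> \<Gamma> g)"
    have x: "x \<in> carrier P" unfolding x_def using cP by (intro M.finsum_closed) auto
    have "\<beta> s x = c s" if s: "s \<in> carrier G" for s
    proof -
      have "\<beta> s x = (\<Oplus>\<^bsub>P\<^esub>g\<in>?S. \<beta> s (c g \<bullet> \<Gamma> g))"
        unfolding x_def using fin cP by (intro beta_finsum[OF s]) auto
      also have "\<dots> = (\<Oplus>\<^bsub>P\<^esub>g\<in>?S. if s = g then c g else \<zero>\<^bsub>P\<^esub>)"
        by (rule M.finsum_cong') (use s cP beta_D_gen_eq cD in auto)
      also have "\<dots> = c s"
      proof (cases "s \<in> ?S")
        case True then show ?thesis using fin cP by (intro M.finsum_singleton) auto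
      next
        case False
        then have "(\<Oplus>\<^bsub>P\<^esub>g\<in>?S. if s = g then c g else \<zero>\<^bsub>P\<^esub>) = (\<Oplus>\<^bsub>P\<^esub>g\<in>?S. \<zero>\<^bsub>P\<^esub>)"
          by (intro M.finsum_cong') auto
        then show ?thesis using False s by simp
      qed
      finally show ?thesis .
    qed
    then have "\<Phi> x = c" using ext by (auto simp: \<Phi>_def extensional_def fun_eq_iff)
    then show "c \<in> \<Phi> ` carrier P" using x by blast
  qed
qed

text \<open>
  Only the left factor is expanded into its components, so that no double sum occurs.
\<close>

lemma Phi_mult:
  assumes x: "x \<in> carrier P" and y: "y \<in> carrier P"
  shows "\<Phi> (x \<bullet> y) = \<Phi> x \<otimes>\<^bsub>C\<^esub> \<Phi> y"
proof
  fix s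
  show "\<Phi> (x \<bullet> y) s = (\<Phi> x \<otimes>\<^bsub>C\<^esub> \<Phi> y) s"
  proof (cases "s \<in> carrier G")
    case False then show ?thesis by (simp add: \<Phi>_def crossed_product_def)
  next
    case s: True
    let ?term = "\<lambda>g. \<sigma> g (inv g \<otimes> s) \<odot>\<^bsub>P\<^esub> (\<beta> g x \<bullet> \<theta> g (e (inv g) \<bullet> \<beta> (inv g \<otimes> s) y))"
    note fin = support_finite(1)[OF x]
    have sup: "{g \<in> carrier G. \<Phi> x g \<noteq> \<zero>\<^bsub>P\<^esub>} = support x" by (auto simp: support_def \<Phi>_def)
    have tB: "?term g \<in> B" if "g \<in> carrier G" for g using that s x y by simp
    have "\<beta> s (x \<bullet> y) = \<beta> s ((\<Oplus>\<^bsub>P\<^esub>g\<in>support x. \<beta> g x \<bullet> \<Gamma> g) \<bullet> y)"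
      using support_finite(2)[OF x] by simp
    also have "\<dots> = \<beta> s (\<Oplus>\<^bsub>P\<^esub>g\<in>support x. \<beta> g x \<bullet> \<Gamma> g \<bullet> y)"
      using x y fin by (subst A.finsum_ldistr) (auto simp: support_def)
    also have "\<dots> = (\<Oplus>\<^bsub>P\<^esub>g\<in>support x. \<beta> s (\<beta> g x \<bullet> \<Gamma> g \<bullet> y))"
      using x y fin by (intro beta_finsum[OF s]) (auto simp: support_def)
    also have "\<dots> = (\<Oplus>\<^bsub>P\<^esub>g\<in>support x. ?term g)"
      by (rule M.finsum_cong')
        (use x y s tB beta_D_gen(1) beta_homogeneous_mult in \<open>auto simp: support_def\<close>)
    also have "\<dots> = (\<Oplus>\<^bsub>BA\<^esub>g\<in>support x. ?term g)"
      by (rule k_subalgebra_finsum[OF B_subalgebra, symmetric]) (use tB in \<open>auto simp: support_def\<close>)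
    also have "\<dots> = (\<Oplus>\<^bsub>BA\<^esub>g\<in>support x. \<sigma> g (inv g \<otimes> s) \<odot>\<^bsub>BA\<^esub>
        (\<Phi> x g \<otimes>\<^bsub>BA\<^esub> \<theta> g (e (inv g) \<otimes>\<^bsub>BA\<^esub> \<Phi> y (inv g \<otimes> s))))"
      by (rule B.M.finsum_cong') (use s tB in \<open>auto simp: support_def \<Phi>_def\<close>)
    also have "\<dots> = (\<Phi> x \<otimes>\<^bsub>C\<^esub> \<Phi> y) s"
      using s by (simp add: crossed_product_def sup)
    finally show ?thesis using s by (simp add: \<Phi>_def)
  qed
qed

lemma Phi_linear:
  "\<lbrakk>x \<in> carrier P; y \<in> carrier P\<rbrakk> \<Longrightarrow> \<Phi> (x \<oplus>\<^bsub>P\<^esub> y) = \<Phi> x \<oplus>\<^bsub>C\<^esub> \<Phi> y"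
  "\<lbrakk>k \<in> carrier K; x \<in> carrier P\<rbrakk> \<Longrightarrow> \<Phi> (k \<odot>\<^bsub>P\<^esub> x) = k \<odot>\<^bsub>C\<^esub> \<Phi> x"
  "\<Phi> \<one>\<^bsub>P\<^esub> = \<one>\<^bsub>C\<^esub>" "\<Phi> \<zero>\<^bsub>P\<^esub> = \<zero>\<^bsub>C\<^esub>"
  by (auto simp: \<Phi>_def crossed_product_def beta_add beta_smult beta_one beta_zero fun_eq_iff)

lemma crossed_product_kalgebra: "kalgebra K C"
proof (rule kalgebra_surj_image[OF kalgebra_axioms, of \<Phi>])
  show "\<Phi> ` carrier P = carrier C" using Phi_bij by (rule bij_betw_imp_surj_on)
  have "\<Phi> \<one>\<^bsub>P\<^esub> \<noteq> \<Phi> \<zero>\<^bsub>P\<^esub>"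
    using Phi_bij one_neq_zero by (auto simp: bij_betw_def dest: inj_onD)
  then show "\<one>\<^bsub>C\<^esub> \<noteq> \<zero>\<^bsub>C\<^esub>" by (simp add: Phi_linear)
qed (simp_all add: Phi_mult Phi_linear)

lemma Phi_kalg_iso: "\<Phi> \<in> kalg_iso K P C"
proof -
  have "\<Phi> x \<in> carrier C" if "x \<in> carrier P" for x using Phi_bij that by (auto simp: bij_betw_def)
  then show ?thesis
    unfolding kalg_iso_def kalg_hom_def using Phi_bij
    by (auto intro!: ring_hom_memI simp: Phi_mult Phi_linear)
qed

lemma Phi_homogeneous:
  assumes "g \<in> carrier G" "b \<in> D g"
  shows "\<Phi> (b \<bullet> \<Gamma> g) = delta G BA b g"
  using assms by (auto simp: \<Phi>_def delta_def beta_D_gen_eq fun_eq_iff)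

lemma Phi_gen: "g \<in> carrier G \<Longrightarrow> \<Phi> (\<Gamma> g) = delta G BA (e g) g"
  using Phi_homogeneous[of g "e g"] by (simp add: D_iff e_idem e_gen)

lemma hom_unique:
  assumes f: "f \<in> kalg_hom K P C" and f': "f' \<in> kalg_hom K P C"
    and gens: "\<And>g. g \<in> carrier G \<Longrightarrow> f (\<Gamma> g) = f' (\<Gamma> g)" and x: "x \<in> carrier P"
  shows "f x = f' x"
proof -
  note h = kalg_homD[OF f] kalg_homD[OF f']
  have "k_subalgebra K P {x \<in> carrier P. f x = f' x}"
    by (rule k_subalgebraI) (auto simp: h)
  then have "{x \<in> carrier P. f x = f' x} = carrier P" by (rule generated) (auto simp: gens)
  then show ?thesis using x by blast
qed

end

section \<open>The isomorphism theorem\<close>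

theorem theorem3p11:
  fixes G :: "('g, 'm) monoid_scheme"
    and K :: "('k, 'n) ring_scheme"
    and \<sigma> :: "'g \<Rightarrow> 'g \<Rightarrow> 'k"
  assumes "field K"
    and "group G"
    and "\<sigma> \<in> pm TYPE('r) G K"
  shows "let P = twisted_par_alg G K \<sigma>; gen = par_gen G K \<sigma> in
    kalgebra K P \<and>
    (\<exists>e B \<theta>.
      let BA = P\<lparr>carrier := B\<rparr>;
          D = (\<lambda>g. e g <#\<^bsub>P\<^esub> B);
          C = crossed_product G BA D e \<theta> \<sigma>
      in
        (\<forall>g\<in>carrier G. e g \<in> carrier P \<and> e g \<otimes>\<^bsub>P\<^esub> e g = e g) \<and>
        k_subalgebra K P B \<and>
        B = alg_generate K P (e ` carrier G) \<and>
        (\<forall>x\<in>B. \<forall>y\<in>B. x \<otimes>\<^bsub>P\<^esub> y = y \<otimes>\<^bsub>P\<^esub> x) \<and>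
        unital_partial_action G K BA D e \<theta> \<and>
        kvalued_twist G K BA e \<theta> \<sigma> \<and>
        kalgebra K C \<and>
        (\<exists>\<Phi> \<Psi>.
          \<Phi> \<in> kalg_iso K P C \<and>
          (\<forall>g\<in>carrier G. \<Phi> (gen g) = delta G BA (e g) g) \<and>
          (\<forall>\<Phi>'\<in>kalg_hom K P C.
             (\<forall>g\<in>carrier G. \<Phi>' (gen g) = delta G BA (e g) g) \<longrightarrow>
             (\<forall>x\<in>carrier P. \<Phi>' x = \<Phi> x)) \<and>
          \<Psi> \<in> kalg_iso K C P \<and>
          (\<forall>x\<in>carrier P. \<Psi> (\<Phi> x) = x) \<and>
          (\<forall>y\<in>carrier C. \<Phi> (\<Psi> y) = y) \<and>
          (\<forall>g\<in>carrier G. \<forall>b\<in>D g. \<Psi> (delta G BA b g) = b \<otimes>\<^bsub>P\<^esub> gen g)))"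
proof -
  obtain R :: "('k, 'r) module" and \<Gamma> where R: "kalgebra K R" and fs: "factor_set G K R \<Gamma> \<sigma>"
    using assms(3) by (auto simp: pm_def)
  have rep: "partial_proj_rep G K R \<Gamma> \<sigma>"
    and nz: "\<And>g h. \<lbrakk>g \<in> carrier G; h \<in> carrier G; \<Gamma> g \<otimes>\<^bsub>R\<^esub> \<Gamma> h = \<zero>\<^bsub>R\<^esub>\<rbrakk> \<Longrightarrow> \<sigma> g h = \<zero>\<^bsub>K\<^esub>"
    using fs by (auto simp: factor_set_def)
  have \<sigma>: "\<And>g h. \<lbrakk>g \<in> carrier G; h \<in> carrier G\<rbrakk> \<Longrightarrow> \<sigma> g h \<in> carrier K"
    and \<Gamma>: "\<Gamma> \<in> carrier G \<rightarrow> carrier R"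
    using rep by (auto simp: partial_proj_rep_def)
  interpret G: group G by fact
  interpret K: field K by fact
  interpret R: kalgebra K R by (rule R)
  let ?F = "free_algebra K (carrier G)"
  let ?I = "par_ideal G K \<sigma>"
  let ?P = "twisted_par_alg G K \<sigma>"
  let ?gen = "par_gen G K \<sigma>"
  let ?x = "free_gen K"
  interpret F: kalgebra K ?F by (rule K.free_algebra_kalgebra)
  have I: "ideal ?I ?F" by (rule par_ideal_ideal[OF assms(2,1) \<sigma>])
  interpret I: ideal ?I ?F by (rule I)
  let ?q = "\<lambda>f. ?I +>\<^bsub>?F\<^esub> f"
  note ev = free_ev_hom[OF assms(1) R \<Gamma>]
  have killed: "free_ev K R \<Gamma> f = \<zero>\<^bsub>R\<^esub>" if "f \<in> ?I" for f
    by (rule par_ideal_killed[OF assms(2,1) \<sigma> R rep that])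
  (* The given representation shows that the quotient is not trivial. *)
  have one: "\<one>\<^bsub>?F\<^esub> \<notin> ?I"
    using killed[of "\<one>\<^bsub>?F\<^esub>"] R.one_neq_zero kalg_homD(4)[OF ev(1)] by auto
  have P: "kalgebra K ?P" and q: "?q \<in> kalg_hom K ?F ?P"
    unfolding twisted_par_alg_def
    by (rule alg_quot_kalgebra[OF F.kalgebra_axioms I one])+
  interpret P: kalgebra K ?P by (rule P)
  note qh = kalg_homD[OF q]
  have surj: "?q ` carrier ?F = carrier ?P"
    unfolding twisted_par_alg_def by (rule coset_surj[OF F.kalgebra_axioms I])
  have q0: "?q f = \<zero>\<^bsub>?P\<^esub> \<longleftrightarrow> f \<in> ?I" if "f \<in> carrier ?F" for f
    unfolding twisted_par_alg_def by (rule coset_zero_iff[OF F.kalgebra_axioms I that])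
  have qeq: "?q f = ?q f' \<longleftrightarrow> f \<ominus>\<^bsub>?F\<^esub> f' \<in> ?I" if "f \<in> carrier ?F" "f' \<in> carrier ?F" for f f'
    by (rule coset_eq_iff[OF F.kalgebra_axioms I that])
  have gen: "?gen g = ?q (?x g)" for g by (simp add: par_gen_def)
  have xc: "?x g \<in> carrier ?F" if "g \<in> carrier G" for g using that by (rule K.free_gen_closed)

  have Prep: "partial_proj_rep G K ?P ?gen \<sigma>"
  proof -
    have "\<forall>r\<in>par_relators G K \<sigma>. ?q r = \<zero>\<^bsub>?P\<^esub>"
    proof
      fix r assume r: "r \<in> par_relators G K \<sigma>"
      note cl = par_relators_closed[OF assms(2,1) \<sigma>]
      have "r \<in> ?I"
        unfolding par_ideal_def by (rule subsetD[OF F.A.genideal_self[OF cl] r])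
      then show "?q r = \<zero>\<^bsub>?P\<^esub>" using q0[OF subsetD[OF cl r]] by simp
    qed
    then have "partial_proj_rep G K ?P (\<lambda>g. ?q (?x g)) \<sigma>"
      using par_relators_killed_iff[OF assms(2,1) P \<sigma> q] by simp
    then show ?thesis by (simp only: gen[symmetric])
  qed
  have Pnz: "\<sigma> g h = \<zero>\<^bsub>K\<^esub>"
    if g: "g \<in> carrier G" and h: "h \<in> carrier G" and z: "?gen g \<otimes>\<^bsub>?P\<^esub> ?gen h = \<zero>\<^bsub>?P\<^esub>" for g h
  proof (rule nz[OF g h])
    have "?x g \<otimes>\<^bsub>?F\<^esub> ?x h \<in> ?I"
      using z g h q0[of "?x g \<otimes>\<^bsub>?F\<^esub> ?x h"] by (simp add: gen qh xc)
    from killed[OF this] show "\<Gamma> g \<otimes>\<^bsub>R\<^esub> \<Gamma> h = \<zero>\<^bsub>R\<^esub>"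
      using g h by (simp add: kalg_homD(2)[OF ev(1)] xc ev(2))
  qed

  (* The components of a coset are those of a representative, as the ideal is graded. *)
  define \<pi> where "\<pi> s X = ?q (degree_part G K s (inv_into (carrier ?F) ?q X))" for s X
  note dp = degree_part_closed[OF assms(2,1)] degree_part_add[OF assms(2,1)]
    degree_part_smult[OF assms(2,1)] degree_part_one[OF assms(2,1)]
    degree_part_gen_left[OF assms(2,1)] degree_part_gen_right[OF assms(2,1)]
  have pi: "\<pi> s (?q f) = ?q (degree_part G K s f)" if s: "s \<in> carrier G" and f: "f \<in> carrier ?F" for s f
  proof -
    let ?f = "inv_into (carrier ?F) ?q (?q f)"
    have f': "?f \<in> carrier ?F" "?q ?f = ?q f"
      using inv_into_into[OF imageI[OF f], of ?q] f_inv_into_f[OF imageI[OF f], of ?q] by simp_all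
    then have "?f \<ominus>\<^bsub>?F\<^esub> f \<in> ?I" using qeq f by blast
    then have "degree_part G K s (?f \<ominus>\<^bsub>?F\<^esub> f) \<in> ?I"
      using par_ideal_degree_part[where \<sigma> = \<sigma>, OF assms(2,1) \<sigma> _ s] by blast
    then have "?q (degree_part G K s (?f \<ominus>\<^bsub>?F\<^esub> f)) = \<zero>\<^bsub>?P\<^esub>"
      using q0 f f' by (simp add: dp)
    moreover have "?q (degree_part G K s ?f) =
        ?q (degree_part G K s (?f \<ominus>\<^bsub>?F\<^esub> f)) \<oplus>\<^bsub>?P\<^esub> ?q (degree_part G K s f)"
    proof -
      have "?f = (?f \<ominus>\<^bsub>?F\<^esub> f) \<oplus>\<^bsub>?F\<^esub> f" using f f' by (simp add: a_minus_def F.M.a_assoc F.M.l_neg)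
      then have "degree_part G K s ?f = degree_part G K s (?f \<ominus>\<^bsub>?F\<^esub> f) \<oplus>\<^bsub>?F\<^esub> degree_part G K s f"
        using f f' dp(2) by (metis F.M.minus_closed)
      then show ?thesis using f f' by (simp add: qh dp)
    qed
    ultimately show ?thesis using f qh(1) dp(1) by (simp add: \<pi>_def)
  qed
  have rep_ex: "\<exists>f\<in>carrier ?F. X = ?q f" if "X \<in> carrier ?P" for X using that surj by blast

  interpret gr: graded_partial_factor_rep G K ?P ?gen \<sigma> \<pi>
  proof (intro graded_partial_factor_rep.intro partial_factor_rep.intro
      partial_factor_rep_axioms.intro graded_partial_factor_rep_axioms.intro
      assms(1,2) P Prep, goal_cases)
    case (1 g h) then show ?case by (rule Pnz)
  next
    case (2 S)
    note S = k_subalgebraD[OF 2(1)]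
    have "k_subalgebra K ?F {f \<in> carrier ?F. ?q f \<in> S}"
      by (rule F.k_subalgebraI) (auto simp: qh S)
    then have "{f \<in> carrier ?F. ?q f \<in> S} = carrier ?F"
      by (rule K.free_algebra_generated) (use 2(2) xc gen in auto)
    then show ?case using S(1) rep_ex by blast
  next
    case (3 s X) then show ?case using rep_ex[of X] by (auto simp: pi qh dp)
  next
    case (4 s X Y)
    then obtain f g where "f \<in> carrier ?F" "g \<in> carrier ?F" "X = ?q f" "Y = ?q g" using rep_ex by meson
    then show ?case using 4 pi[of s "f \<oplus>\<^bsub>?F\<^esub> g"] by (simp add: pi qh dp)
  next
    case (5 s k X)
    then obtain f where "f \<in> carrier ?F" "X = ?q f" using rep_ex by meson
    then show ?case using 5 pi[of s "k \<odot>\<^bsub>?F\<^esub> f"] by (simp add: pi qh dp)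
  next
    case (6 s)
    have "?q \<zero>\<^bsub>?F\<^esub> = \<zero>\<^bsub>?P\<^esub>" by (rule kalg_hom_zero[OF F.kalgebra_axioms P q])
    then show ?case using 6 pi[of s "\<one>\<^bsub>?F\<^esub>"] by (simp add: qh dp)
  next
    case (7 s g X)
    then obtain f where "f \<in> carrier ?F" "X = ?q f" using rep_ex by meson
    then show ?case using 7 pi[of s "?x g \<otimes>\<^bsub>?F\<^esub> f"] by (simp add: pi gen qh dp xc)
  next
    case (8 s g X)
    then obtain f where "f \<in> carrier ?F" "X = ?q f" using rep_ex by meson
    then show ?case using 8 pi[of s "f \<otimes>\<^bsub>?F\<^esub> ?x g"] by (simp add: pi gen qh dp xc)
  qed

  have D: "(\<lambda>g. gr.e g <#\<^bsub>?P\<^esub> gr.B) = gr.D" by (simp add: gr.D_def fun_eq_iff)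
  let ?\<Psi> = "inv_into (carrier ?P) gr.\<Phi>"
  have \<Psi>: "?\<Psi> (gr.\<Phi> x) = x" if "x \<in> carrier ?P" for x
    using gr.Phi_bij that by (simp add: bij_betw_def)
  show ?thesis
    unfolding Let_def
  proof (intro conjI P exI[of _ gr.e] exI[of _ gr.B] exI[of _ gr.\<theta>] exI[of _ gr.\<Phi>] exI[of _ ?\<Psi>]
      ballI impI, unfold D, goal_cases)
    case (1 g) then show ?case by simp
  next
    case (2 g) then show ?case by (rule gr.e_idem)
  next
    case 3 show ?case by (rule gr.B_subalgebra)
  next
    case 4 show ?case by (simp add: gr.B_def)
  next
    case (5 x y) then show ?case by (rule gr.B_commute)
  next
    case 6 show ?case by (rule gr.unital_partial_action_theta)
  next
    case 7 show ?case by (rule gr.kvalued_twist_sigma)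
  next
    case 8 show ?case by (rule gr.crossed_product_kalgebra)
  next
    case 9 show ?case by (rule gr.Phi_kalg_iso)
  next
    case (10 g) then show ?case by (rule gr.Phi_gen)
  next
    case (11 \<Phi>' x)
    have hom: "gr.\<Phi> \<in> kalg_hom K ?P gr.C" using gr.Phi_kalg_iso by (simp add: kalg_iso_def)
    show ?case by (rule gr.hom_unique[OF 11(1) hom _ 11(3)]) (use 11(2) in \<open>simp add: gr.Phi_gen\<close>)
  next
    case 12 show ?case by (rule P.kalg_iso_inv_into[OF gr.Phi_kalg_iso])
  next
    case (13 x) then show ?case by (rule \<Psi>)
  next
    case (14 y) then show ?case
      using gr.Phi_bij by (intro f_inv_into_f) (simp add: bij_betw_def)
  next
    case (15 g b)
    then have b: "b \<in> gr.D g" by (simp add: gr.D_def)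
    then have "b \<in> carrier ?P" using 15 by (simp add: gr.D_iff)
    then show ?case using 15 b \<Psi>[of "b \<otimes>\<^bsub>?P\<^esub> ?gen g"] by (simp add: gr.Phi_homogeneous)
  qed
qed

end
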